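(* Let $(A,\mathcal R)$ be a quasitriangular Hopf algebra over a field $\Bbbk$ with a projection $\pi:A\to H$ onto a quasitriangular Hopf subalgebra $(H,\mathcal R)$. Set $B:=H_{\mathcal R}$ and $R:=A^{\mathrm{co}H}$. Then $K:=RB$ is a quasitriangular Hopf subalgebra of $(A,\mathcal R)$, and $\varphi:K\otimes_BH\to A$, $w\otimes_Bh\mapsto wh$, is an isomorphism of quasitriangular Hopf algebras, where the domain is structured as follows, for all $w,w'\in K$, $h,h'\in H$: $$(w\otimes_Bh)(w'\otimes_Bh')=w(h_1\triangleright w_1')\otimes_B(h_2\triangleleft w_2')h',\qquad 1_{K\otimes_BH}=1_K\otimes_B1_H,$$ $$\Delta(w\otimes_Bh)=(w_1\otimes_Bh_1)\otimes_\Bbbk(w_2\otimes_Bh_2),\qquad \varepsilon(w\otimes_Bh)=\varepsilon_K(w)\varepsilon_H(h),$$ $$S_{K\otimes_BH}(w\otimes_Bh)=(S_H(h_2)\triangleright S_K(w_2))\otimes_B(S_H(h_1)\triangleleft S_K(w_1)),$$ $$\mathcal R_{K\otimes_BH}=(1_K\otimes_B\mathcal R^i)\otimes_\Bbbk(1_K\otimes_B\mathcal R_i),$$ where $h\triangleright w:=h_1w_1S_H\pi(w_2)S_H\pi(h_2)\in R$ and $h\triangleleft w:=h\pi(w)\in H$.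
   Context: Sweedler notation is used, and $\mathcal R=\mathcal R^i\otimes\mathcal R_i$ (summation understood). A quasitriangular Hopf algebra $(A,\mathcal R)$ is a Hopf algebra with an invertible $\mathcal R\in A\otimes A$ such that $\Delta^{\mathrm{op}}(\cdot)=\mathcal R\Delta(\cdot)\mathcal R^{-1}$, $(\mathrm{Id}\otimes\Delta)(\mathcal R)=\mathcal R_{13}\mathcal R_{12}$, $(\Delta\otimes\mathrm{Id})(\mathcal R)=\mathcal R_{13}\mathcal R_{23}$; a morphism is a bialgebra map $f$ with $(f\otimes f)(\mathcal R)=\mathcal S$. A quasitriangular Hopf subalgebra $(H,\mathcal R)$ of $(A,\mathcal R)$ is a Hopf subalgebra $H\subseteq A$ with $\mathcal R\in H\otimes H$ making $H$ quasitriangular. A projection $\pi:A\to H$ is a Hopf algebra map with $\pi|_H=\mathrm{Id}_H$. $H_{\mathcal R}$ denotes the minimal quasitriangular Hopf algebra of $(H,\mathcal R)$: the smallest Hopf subalgebra $L$ of $H$ with $\mathcal R\in L\otimes L$. $A^{\mathrm{co}H}=\{r\in A\mid r_1\otimes\pi(r_2)=r\otimes1_H\}$. $RB$ is the linear span of products $rb$, $r\in R$, $b\in B$, in $A$; $K$ and $H$ are $B$-modules by multiplication in $A$. *)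

theory Defs
  imports "HOL-Algebra.Algebra"
begin

section \<open>Tensor products\<close>

text \<open>
  \<open>M\<close> is a right and \<open>N\<close> a left module over a ring with underlying set \<open>S\<close>, with actions \<open>ra\<close>
  and \<open>la\<close>. The tensor product is the quotient of the free abelian group on
  \<open>carrier M \<times> carrier N\<close> by the subgroup generated by the relators, so tensors are cosets.
\<close>

type_synonym ('a, 'b) tensor = "(('a \<times> 'b) \<Rightarrow>\<^sub>0 int) set"

definition tensor_relators ::
  "'s set \<Rightarrow> ('a \<Rightarrow> 's \<Rightarrow> 'a) \<Rightarrow> ('s \<Rightarrow> 'b \<Rightarrow> 'b) \<Rightarrow> ('a, 'm) ring_scheme \<Rightarrow> ('b, 'n) ring_scheme
    \<Rightarrow> (('a \<times> 'b) \<Rightarrow>\<^sub>0 int) set" where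
  "tensor_relators S ra la M N =
     {frag_of (x \<oplus>\<^bsub>M\<^esub> x', y) - frag_of (x, y) - frag_of (x', y) | x x' y.
        x \<in> carrier M \<and> x' \<in> carrier M \<and> y \<in> carrier N}
   \<union> {frag_of (x, y \<oplus>\<^bsub>N\<^esub> y') - frag_of (x, y) - frag_of (x, y') | x y y'.
        x \<in> carrier M \<and> y \<in> carrier N \<and> y' \<in> carrier N}
   \<union> {frag_of (ra x s, y) - frag_of (x, la s y) | x s y.
        x \<in> carrier M \<and> s \<in> S \<and> y \<in> carrier N}"

definition tensor_kernel ::
  "'s set \<Rightarrow> ('a \<Rightarrow> 's \<Rightarrow> 'a) \<Rightarrow> ('s \<Rightarrow> 'b \<Rightarrow> 'b) \<Rightarrow> ('a, 'm) ring_scheme \<Rightarrow> ('b, 'n) ring_scheme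
    \<Rightarrow> (('a \<times> 'b) \<Rightarrow>\<^sub>0 int) set" where
  "tensor_kernel S ra la M N =
     generate (free_Abelian_group (carrier M \<times> carrier N)) (tensor_relators S ra la M N)"

definition tensor_group ::
  "'s set \<Rightarrow> ('a \<Rightarrow> 's \<Rightarrow> 'a) \<Rightarrow> ('s \<Rightarrow> 'b \<Rightarrow> 'b) \<Rightarrow> ('a, 'm) ring_scheme \<Rightarrow> ('b, 'n) ring_scheme
    \<Rightarrow> ('a, 'b) tensor monoid" where
  "tensor_group S ra la M N =
     free_Abelian_group (carrier M \<times> carrier N) Mod tensor_kernel S ra la M N"

definition pure_tensor ::
  "'s set \<Rightarrow> ('a \<Rightarrow> 's \<Rightarrow> 'a) \<Rightarrow> ('s \<Rightarrow> 'b \<Rightarrow> 'b) \<Rightarrow> ('a, 'm) ring_scheme \<Rightarrow> ('b, 'n) ring_scheme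
    \<Rightarrow> 'a \<Rightarrow> 'b \<Rightarrow> ('a, 'b) tensor" where
  "pure_tensor S ra la M N x y =
     tensor_kernel S ra la M N #>\<^bsub>free_Abelian_group (carrier M \<times> carrier N)\<^esub> frag_of (x, y)"

text \<open>
  For a balanced biadditive \<open>f\<close> into a commutative group \<open>G\<close>, \<open>tensor_lift G f\<close> is the homomorphism
  sending the pure tensor of \<open>x\<close> and \<open>y\<close> to \<open>f x y\<close>; the choice of representative is then irrelevant.
  Sweedler notation is rendered with it: the expression \<open>f x\<^sub>1 x\<^sub>2\<close> is
  \<open>tensor_lift G (\<lambda>x1 x2. f x1 x2) (comult U x)\<close>.
\<close>

definition tensor_lift ::
  "('c, 'm) monoid_scheme \<Rightarrow> ('a \<Rightarrow> 'b \<Rightarrow> 'c) \<Rightarrow> ('a, 'b) tensor \<Rightarrow> 'c" where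
  "tensor_lift G f t =
     (let c = SOME c. c \<in> t
      in finprod G (\<lambda>(x, y). f x y [^]\<^bsub>G\<^esub> Poly_Mapping.lookup c (x, y)) (Poly_Mapping.keys c))"

definition tens_grp ::
  "('k, 'l) ring_scheme \<Rightarrow> ('k, 'a, 'm) module_scheme \<Rightarrow> ('k, 'b, 'n) module_scheme
    \<Rightarrow> ('a, 'b) tensor monoid" where
  "tens_grp k U V =
     tensor_group (carrier k) (\<lambda>x c. c \<odot>\<^bsub>U\<^esub> x) (\<lambda>c y. c \<odot>\<^bsub>V\<^esub> y) U V"

definition tens ::
  "('k, 'l) ring_scheme \<Rightarrow> ('k, 'a, 'm) module_scheme \<Rightarrow> ('k, 'b, 'n) module_scheme
    \<Rightarrow> 'a \<Rightarrow> 'b \<Rightarrow> ('a, 'b) tensor" where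
  "tens k U V =
     pure_tensor (carrier k) (\<lambda>x c. c \<odot>\<^bsub>U\<^esub> x) (\<lambda>c y. c \<odot>\<^bsub>V\<^esub> y) U V"

definition tensor_algebra ::
  "('k, 'l) ring_scheme \<Rightarrow> ('k, 'a, 'm) module_scheme \<Rightarrow> ('k, 'b, 'n) module_scheme
    \<Rightarrow> ('k, ('a, 'b) tensor) module" where
  "tensor_algebra k U V =
     \<lparr>carrier = carrier (tens_grp k U V),
      monoid.mult = (\<lambda>s t. tensor_lift (tens_grp k U V) (\<lambda>x y.
                tensor_lift (tens_grp k U V) (\<lambda>x' y'.
                  tens k U V (x \<otimes>\<^bsub>U\<^esub> x') (y \<otimes>\<^bsub>V\<^esub> y')) t) s),
      one = tens k U V \<one>\<^bsub>U\<^esub> \<one>\<^bsub>V\<^esub>,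
      ring.zero = \<one>\<^bsub>tens_grp k U V\<^esub>,
      add = (\<otimes>\<^bsub>tens_grp k U V\<^esub>),
      smult = (\<lambda>c. tensor_lift (tens_grp k U V) (\<lambda>x y. tens k U V (c \<odot>\<^bsub>U\<^esub> x) y))\<rparr>"

text \<open>The map \<open>f \<otimes> g\<close> with values in \<open>U \<otimes> V\<close>.\<close>

definition tensor_map ::
  "('k, 'l) ring_scheme \<Rightarrow> ('k, 'a, 'm) module_scheme \<Rightarrow> ('k, 'b, 'n) module_scheme
    \<Rightarrow> ('c \<Rightarrow> 'a) \<Rightarrow> ('d \<Rightarrow> 'b) \<Rightarrow> ('c, 'd) tensor \<Rightarrow> ('a, 'b) tensor" where
  "tensor_map k U V f g = tensor_lift (tens_grp k U V) (\<lambda>x y. tens k U V (f x) (g y))"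


section \<open>Hopf algebras\<close>

record ('k, 'a) hopf = "('k, 'a) module" +
  comult :: "'a \<Rightarrow> ('a, 'a) tensor"
  counit :: "'a \<Rightarrow> 'k"
  antipode :: "'a \<Rightarrow> 'a"

record ('k, 'a) qt_hopf = "('k, 'a) hopf" +
  rmat :: "('a, 'a) tensor"

text \<open>The library's locale \<open>algebra\<close> is restricted to commutative algebras.\<close>

locale k_algebra = k: field k + module k A + ring A for k and A (structure) +
  assumes smult_mult_left:
    "\<lbrakk>c \<in> carrier k; x \<in> carrier A; y \<in> carrier A\<rbrakk> \<Longrightarrow> (c \<odot> x) \<otimes> y = c \<odot> (x \<otimes> y)"
  and smult_mult_right:
    "\<lbrakk>c \<in> carrier k; x \<in> carrier A; y \<in> carrier A\<rbrakk> \<Longrightarrow> x \<otimes> (c \<odot> y) = c \<odot> (x \<otimes> y)"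

definition alg_hom ::
  "('k, 'l) ring_scheme \<Rightarrow> ('k, 'a, 'm) module_scheme \<Rightarrow> ('k, 'b, 'n) module_scheme
    \<Rightarrow> ('a \<Rightarrow> 'b) set" where
  "alg_hom k U V =
     {f \<in> ring_hom U V. \<forall>c\<in>carrier k. \<forall>x\<in>carrier U. f (c \<odot>\<^bsub>U\<^esub> x) = c \<odot>\<^bsub>V\<^esub> f x}"

text \<open>Coassociativity is stated in \<open>A \<otimes> (A \<otimes> A)\<close>.\<close>

locale hopf_algebra = k_algebra k A
  for k :: "('k, 'l) ring_scheme" and A :: "('k, 'a, 'm) hopf_scheme" (structure) +
  assumes comult_hom: "comult A \<in> alg_hom k A (tensor_algebra k A A)"
    and counit_hom: "counit A \<in> ring_hom A k"
    and counit_smult: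
      "\<lbrakk>c \<in> carrier k; x \<in> carrier A\<rbrakk> \<Longrightarrow> counit A (c \<odot> x) = c \<otimes>\<^bsub>k\<^esub> counit A x"
    and coassoc: "x \<in> carrier A \<Longrightarrow>
        tensor_lift (tens_grp k A (tensor_algebra k A A)) (\<lambda>x1 x2.
          tensor_lift (tens_grp k A (tensor_algebra k A A)) (\<lambda>x11 x12.
            tens k A (tensor_algebra k A A) x11 (tens k A A x12 x2)) (comult A x1)) (comult A x)
      = tensor_map k A (tensor_algebra k A A) (\<lambda>y. y) (comult A) (comult A x)"
    and counit_left: "x \<in> carrier A \<Longrightarrow>
        tensor_lift (add_monoid A) (\<lambda>x1 x2. counit A x1 \<odot> x2) (comult A x) = x"
    and counit_right: "x \<in> carrier A \<Longrightarrow>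
        tensor_lift (add_monoid A) (\<lambda>x1 x2. counit A x2 \<odot> x1) (comult A x) = x"
    and antipode_closed: "antipode A \<in> carrier A \<rightarrow> carrier A"
    and antipode_add: "\<lbrakk>x \<in> carrier A; y \<in> carrier A\<rbrakk> \<Longrightarrow>
        antipode A (x \<oplus> y) = antipode A x \<oplus> antipode A y"
    and antipode_smult: "\<lbrakk>c \<in> carrier k; x \<in> carrier A\<rbrakk> \<Longrightarrow>
        antipode A (c \<odot> x) = c \<odot> antipode A x"
    and antipode_left: "x \<in> carrier A \<Longrightarrow>
        tensor_lift (add_monoid A) (\<lambda>x1 x2. antipode A x1 \<otimes> x2) (comult A x) = counit A x \<odot> \<one>"
    and antipode_right: "x \<in> carrier A \<Longrightarrow>
        tensor_lift (add_monoid A) (\<lambda>x1 x2. x1 \<otimes> antipode A x2) (comult A x) = counit A x \<odot> \<one>"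

definition bialg_hom ::
  "('k, 'l) ring_scheme \<Rightarrow> ('k, 'a, 'm) hopf_scheme \<Rightarrow> ('k, 'b, 'n) hopf_scheme
    \<Rightarrow> ('a \<Rightarrow> 'b) set" where
  "bialg_hom k U V =
     {f \<in> alg_hom k U V. \<forall>x\<in>carrier U.
        counit V (f x) = counit U x \<and> comult V (f x) = tensor_map k V V f f (comult U x)}"

definition hopf_hom ::
  "('k, 'l) ring_scheme \<Rightarrow> ('k, 'a, 'm) hopf_scheme \<Rightarrow> ('k, 'b, 'n) hopf_scheme
    \<Rightarrow> ('a \<Rightarrow> 'b) set" where
  "hopf_hom k U V =
     {f \<in> bialg_hom k U V. \<forall>x\<in>carrier U. f (antipode U x) = antipode V (f x)}"


section \<open>Quasitriangular structures\<close>

text \<open>The opposite coproduct, and the two identities for the coproduct of \<open>\<R>\<close>, both in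
  \<open>A \<otimes> (A \<otimes> A)\<close>.\<close>

definition comult_op ::
  "('k, 'l) ring_scheme \<Rightarrow> ('k, 'a, 'm) hopf_scheme \<Rightarrow> 'a \<Rightarrow> ('a, 'a) tensor" where
  "comult_op k A x = tensor_lift (tens_grp k A A) (\<lambda>x1 x2. tens k A A x2 x1) (comult A x)"

definition R12 ::
  "('k, 'l) ring_scheme \<Rightarrow> ('k, 'a, 'm) qt_hopf_scheme \<Rightarrow> ('a, ('a, 'a) tensor) tensor" where
  "R12 k A = tensor_lift (tens_grp k A (tensor_algebra k A A))
     (\<lambda>x y. tens k A (tensor_algebra k A A) x (tens k A A y \<one>\<^bsub>A\<^esub>)) (rmat A)"

definition R13 ::
  "('k, 'l) ring_scheme \<Rightarrow> ('k, 'a, 'm) qt_hopf_scheme \<Rightarrow> ('a, ('a, 'a) tensor) tensor" where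
  "R13 k A = tensor_lift (tens_grp k A (tensor_algebra k A A))
     (\<lambda>x y. tens k A (tensor_algebra k A A) x (tens k A A \<one>\<^bsub>A\<^esub> y)) (rmat A)"

definition R23 ::
  "('k, 'l) ring_scheme \<Rightarrow> ('k, 'a, 'm) qt_hopf_scheme \<Rightarrow> ('a, ('a, 'a) tensor) tensor" where
  "R23 k A = tens k A (tensor_algebra k A A) \<one>\<^bsub>A\<^esub> (rmat A)"

locale qt_hopf_algebra = hopf_algebra k A
  for k :: "('k, 'l) ring_scheme" and A :: "('k, 'a, 'm) qt_hopf_scheme" (structure) +
  assumes rmat_unit: "rmat A \<in> Units (tensor_algebra k A A)"
    and rmat_comult_op: "x \<in> carrier A \<Longrightarrow>
        comult_op k A x = rmat A \<otimes>\<^bsub>tensor_algebra k A A\<^esub> comult A x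
          \<otimes>\<^bsub>tensor_algebra k A A\<^esub> inv\<^bsub>tensor_algebra k A A\<^esub> (rmat A)"
    and rmat_id_comult:
      "tensor_map k A (tensor_algebra k A A) (\<lambda>y. y) (comult A) (rmat A)
       = R13 k A \<otimes>\<^bsub>tensor_algebra k A (tensor_algebra k A A)\<^esub> R12 k A"
    and rmat_comult_id:
      "tensor_lift (tens_grp k A (tensor_algebra k A A)) (\<lambda>x y.
         tensor_lift (tens_grp k A (tensor_algebra k A A)) (\<lambda>x1 x2.
           tens k A (tensor_algebra k A A) x1 (tens k A A x2 y)) (comult A x)) (rmat A)
       = R13 k A \<otimes>\<^bsub>tensor_algebra k A (tensor_algebra k A A)\<^esub> R23 k A"

definition qt_hom ::
  "('k, 'l) ring_scheme \<Rightarrow> ('k, 'a, 'm) qt_hopf_scheme \<Rightarrow> ('k, 'b, 'n) qt_hopf_scheme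
    \<Rightarrow> ('a \<Rightarrow> 'b) set" where
  "qt_hom k U V = {f \<in> bialg_hom k U V. tensor_map k V V f f (rmat U) = rmat V}"

definition qt_iso ::
  "('k, 'l) ring_scheme \<Rightarrow> ('k, 'a, 'm) qt_hopf_scheme \<Rightarrow> ('k, 'b, 'n) qt_hopf_scheme
    \<Rightarrow> ('a \<Rightarrow> 'b) set" where
  "qt_iso k U V = {f \<in> qt_hom k U V. bij_betw f (carrier U) (carrier V)}"


section \<open>Hopf subalgebras\<close>

text \<open>
  The cosets representing \<open>L \<otimes> L\<close> and \<open>A \<otimes> A\<close> differ, so \<open>L \<otimes> L\<close> is regarded as a part of \<open>A \<otimes> A\<close>
  through the canonical map, which is injective since \<open>L\<close> is a subspace over a field.
\<close>

definition tensor_incl ::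
  "('k, 'l) ring_scheme \<Rightarrow> ('k, 'a, 'm) module_scheme \<Rightarrow> ('a, 'a) tensor \<Rightarrow> ('a, 'a) tensor" where
  "tensor_incl k A = tensor_map k A A (\<lambda>x. x) (\<lambda>x. x)"

definition sub_tensors ::
  "('k, 'l) ring_scheme \<Rightarrow> ('k, 'a, 'm) module_scheme \<Rightarrow> 'a set \<Rightarrow> ('a, 'a) tensor set" where
  "sub_tensors k A L =
     tensor_incl k A ` carrier (tens_grp k (A\<lparr>carrier := L\<rparr>) (A\<lparr>carrier := L\<rparr>))"

definition restrict_tensor ::
  "('k, 'l) ring_scheme \<Rightarrow> ('k, 'a, 'm) module_scheme \<Rightarrow> 'a set
    \<Rightarrow> ('a, 'a) tensor \<Rightarrow> ('a, 'a) tensor" where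
  "restrict_tensor k A L =
     inv_into (carrier (tens_grp k (A\<lparr>carrier := L\<rparr>) (A\<lparr>carrier := L\<rparr>))) (tensor_incl k A)"

definition hopf_subalgebra ::
  "('k, 'l) ring_scheme \<Rightarrow> ('k, 'a, 'm) hopf_scheme \<Rightarrow> 'a set \<Rightarrow> bool" where
  "hopf_subalgebra k A L \<longleftrightarrow>
     submodule L k A \<and> subring L A \<and>
     (\<forall>x\<in>L. comult A x \<in> sub_tensors k A L \<and> antipode A x \<in> L)"

definition sub_hopf ::
  "('k, 'l) ring_scheme \<Rightarrow> ('k, 'a, 'm) hopf_scheme \<Rightarrow> 'a set \<Rightarrow> ('k, 'a, 'm) hopf_scheme" where
  "sub_hopf k A L =
     A\<lparr>carrier := L, comult := \<lambda>x. restrict_tensor k A L (comult A x)\<rparr>"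

definition sub_qt ::
  "('k, 'l) ring_scheme \<Rightarrow> ('k, 'a, 'm) qt_hopf_scheme \<Rightarrow> 'a set
    \<Rightarrow> ('k, 'a, 'm) qt_hopf_scheme" where
  "sub_qt k A L = (sub_hopf k A L)\<lparr>rmat := restrict_tensor k A L (rmat A)\<rparr>"

definition qt_hopf_subalgebra ::
  "('k, 'l) ring_scheme \<Rightarrow> ('k, 'a, 'm) qt_hopf_scheme \<Rightarrow> 'a set \<Rightarrow> bool" where
  "qt_hopf_subalgebra k A L \<longleftrightarrow>
     hopf_subalgebra k A L \<and> rmat A \<in> sub_tensors k A L \<and> qt_hopf_algebra k (sub_qt k A L)"

text \<open>\<open>LEAST\<close> is taken with respect to inclusion.\<close>

definition minimal_qt ::
  "('k, 'l) ring_scheme \<Rightarrow> ('k, 'a, 'm) qt_hopf_scheme \<Rightarrow> 'a set" where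
  "minimal_qt k H = (LEAST L. hopf_subalgebra k H L \<and> rmat H \<in> sub_tensors k H L)"


section \<open>Hopf algebras with a projection\<close>

definition hopf_projection ::
  "('k, 'l) ring_scheme \<Rightarrow> ('k, 'a, 'm) hopf_scheme \<Rightarrow> 'a set \<Rightarrow> ('a \<Rightarrow> 'a) \<Rightarrow> bool" where
  "hopf_projection k A H \<pi> \<longleftrightarrow>
     \<pi> \<in> hopf_hom k A (sub_hopf k A H) \<and> (\<forall>h\<in>H. \<pi> h = h)"

text \<open>The defining equation lives in \<open>A \<otimes> H\<close>.\<close>

definition coinvariants ::
  "('k, 'l) ring_scheme \<Rightarrow> ('k, 'a, 'm) hopf_scheme \<Rightarrow> 'a set \<Rightarrow> ('a \<Rightarrow> 'a) \<Rightarrow> 'a set" where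
  "coinvariants k A H \<pi> =
     {r \<in> carrier A.
        tensor_map k A (sub_hopf k A H) (\<lambda>x. x) \<pi> (comult A r) = tens k A (sub_hopf k A H) r \<one>\<^bsub>A\<^esub>}"

definition product_span ::
  "('k, 'l) ring_scheme \<Rightarrow> ('k, 'a, 'm) module_scheme \<Rightarrow> 'a set \<Rightarrow> 'a set \<Rightarrow> 'a set" where
  "product_span k A R B =
     (\<lambda>W. submodule W k A) hull {r \<otimes>\<^bsub>A\<^esub> b | r b. r \<in> R \<and> b \<in> B}"

text \<open>\<open>h \<triangleright> w = h\<^sub>1 w\<^sub>1 S(\<pi>(w\<^sub>2)) S(\<pi>(h\<^sub>2))\<close> and \<open>h \<triangleleft> w = h \<pi>(w)\<close>.\<close>

definition act_left ::
  "('k, 'a, 'm) hopf_scheme \<Rightarrow> ('a \<Rightarrow> 'a) \<Rightarrow> 'a \<Rightarrow> 'a \<Rightarrow> 'a" where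
  "act_left A \<pi> h w =
     tensor_lift (add_monoid A) (\<lambda>h1 h2.
       tensor_lift (add_monoid A) (\<lambda>w1 w2.
         h1 \<otimes>\<^bsub>A\<^esub> w1 \<otimes>\<^bsub>A\<^esub> antipode A (\<pi> w2) \<otimes>\<^bsub>A\<^esub> antipode A (\<pi> h2)) (comult A w)) (comult A h)"

definition act_right ::
  "('k, 'a, 'm) hopf_scheme \<Rightarrow> ('a \<Rightarrow> 'a) \<Rightarrow> 'a \<Rightarrow> 'a \<Rightarrow> 'a" where
  "act_right A \<pi> h w = h \<otimes>\<^bsub>A\<^esub> \<pi> w"

text \<open>\<open>K \<otimes>\<^sub>B H\<close> for subsets \<open>B\<close>, \<open>K\<close>, \<open>H\<close> of an algebra \<open>A\<close> with \<open>B\<close> acting by multiplication in \<open>A\<close>.\<close>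

definition rel_tens_grp ::
  "('a, 'm) ring_scheme \<Rightarrow> 'a set \<Rightarrow> 'a set \<Rightarrow> 'a set \<Rightarrow> ('a, 'a) tensor monoid" where
  "rel_tens_grp A B K H =
     tensor_group B (\<otimes>\<^bsub>A\<^esub>) (\<otimes>\<^bsub>A\<^esub>) (A\<lparr>carrier := K\<rparr>) (A\<lparr>carrier := H\<rparr>)"

definition rel_tens ::
  "('a, 'm) ring_scheme \<Rightarrow> 'a set \<Rightarrow> 'a set \<Rightarrow> 'a set \<Rightarrow> 'a \<Rightarrow> 'a \<Rightarrow> ('a, 'a) tensor" where
  "rel_tens A B K H =
     pure_tensor B (\<otimes>\<^bsub>A\<^esub>) (\<otimes>\<^bsub>A\<^esub>) (A\<lparr>carrier := K\<rparr>) (A\<lparr>carrier := H\<rparr>)"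

end

theory Submission
  imports Defs
begin

text \<open>
  Write \<open>\<Pi>(a) = a\<^sub>1 S\<pi>(a\<^sub>2)\<close> for the projection of \<open>A\<close> onto \<open>R\<close>; then \<open>a = \<Pi>(a\<^sub>1) \<pi>(a\<^sub>2)\<close>, and \<open>R \<otimes> H \<rightarrow> A\<close>
  is bijective. Since \<open>\<R> \<in> B \<otimes> B\<close>, applying \<open>id \<otimes> \<pi>\<close> to \<open>\<Delta>\<^sup>o\<^sup>p(r) \<R> = \<R> \<Delta>(r)\<close> for \<open>r \<in> R\<close> gives
  \<open>r\<^sub>2 \<otimes> \<pi>(r\<^sub>1) = \<R> (r \<otimes> 1) \<R>\<^sup>-\<^sup>1\<close>, so the coaction \<open>r \<mapsto> \<pi>(r\<^sub>1) \<otimes> r\<^sub>2\<close> takes values in \<open>B \<otimes> R\<close>. Together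
  with \<open>br = \<Pi>(b\<^sub>1 r) b\<^sub>2\<close> this makes \<open>K = RB\<close> closed under product, coproduct and antipode.
  The inverse of \<open>\<phi>\<close> is \<open>a \<mapsto> \<Pi>(a\<^sub>1) \<otimes>\<^sub>B \<pi>(a\<^sub>2)\<close>, and the structure of \<open>K \<otimes>\<^sub>B H\<close> is the one transported
  along \<open>\<phi>\<close>; the displayed formulas follow from \<open>h \<triangleright> w = \<Pi>(hw)\<close>.

  The minimal \<open>B\<close> exists because over a field \<open>\<R> \<in> L \<otimes> L\<close> for all \<open>L\<close> in a family implies the same for
  the intersection: membership in \<open>L \<otimes> A\<close> can be tested on slices by linear functionals. All
  identities in tensor products of subobjects are checked in tensor powers of \<open>A\<close>, the comparison
  maps being split injections.
\<close>

section \<open>Balanced tensor products\<close>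

definition balanced_map ::
  "'s set \<Rightarrow> ('a \<Rightarrow> 's \<Rightarrow> 'a) \<Rightarrow> ('s \<Rightarrow> 'b \<Rightarrow> 'b) \<Rightarrow> ('a, 'm) ring_scheme \<Rightarrow> ('b, 'n) ring_scheme
    \<Rightarrow> ('c, 'p) monoid_scheme \<Rightarrow> ('a \<Rightarrow> 'b \<Rightarrow> 'c) \<Rightarrow> bool" where
  "balanced_map S ra la M N G f \<longleftrightarrow>
     (\<forall>x\<in>carrier M. \<forall>y\<in>carrier N. f x y \<in> carrier G) \<and>
     (\<forall>x\<in>carrier M. \<forall>x'\<in>carrier M. \<forall>y\<in>carrier N. f (x \<oplus>\<^bsub>M\<^esub> x') y = f x y \<otimes>\<^bsub>G\<^esub> f x' y) \<and>
     (\<forall>x\<in>carrier M. \<forall>y\<in>carrier N. \<forall>y'\<in>carrier N. f x (y \<oplus>\<^bsub>N\<^esub> y') = f x y \<otimes>\<^bsub>G\<^esub> f x y') \<and>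
     (\<forall>x\<in>carrier M. \<forall>s\<in>S. \<forall>y\<in>carrier N. f (ra x s) y = f x (la s y))"

locale balanced_tensor = M: abelian_group M + N: abelian_group N
  for S :: "'s set" and ra :: "'a \<Rightarrow> 's \<Rightarrow> 'a" and la :: "'s \<Rightarrow> 'b \<Rightarrow> 'b"
    and M :: "('a, 'm) ring_scheme" and N :: "('b, 'n) ring_scheme" +
  assumes ra_closed: "\<lbrakk>x \<in> carrier M; s \<in> S\<rbrakk> \<Longrightarrow> ra x s \<in> carrier M"
    and la_closed: "\<lbrakk>s \<in> S; y \<in> carrier N\<rbrakk> \<Longrightarrow> la s y \<in> carrier N"
begin

abbreviation "F \<equiv> free_Abelian_group (carrier M \<times> carrier N)"
abbreviation "Q \<equiv> tensor_kernel S ra la M N"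
abbreviation "T \<equiv> tensor_group S ra la M N"
abbreviation "pt \<equiv> pure_tensor S ra la M N"

lemma relators_carrier: "tensor_relators S ra la M N \<subseteq> carrier F"
proof -
  have k3: "Poly_Mapping.keys (frag_of a - frag_of b - frag_of c) \<subseteq> carrier M \<times> carrier N"
    if "a \<in> carrier M \<times> carrier N" "b \<in> carrier M \<times> carrier N" "c \<in> carrier M \<times> carrier N" for a b c
    using that keys_diff[of "frag_of a - frag_of b" "frag_of c"]
        keys_diff[of "frag_of a" "frag_of b"]
    by (auto dest!: subsetD)
  have k2: "Poly_Mapping.keys (frag_of a - frag_of b) \<subseteq> carrier M \<times> carrier N"
    if "a \<in> carrier M \<times> carrier N" "b \<in> carrier M \<times> carrier N" for a b
    using that keys_diff[of "frag_of a" "frag_of b"] by (auto dest!: subsetD)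
  show ?thesis
    unfolding tensor_relators_def
    using k3 k2 by (auto simp: ra_closed la_closed)
qed

lemma subgroup_kernel: "subgroup Q F"
  unfolding tensor_kernel_def
  by (rule group.generate_is_subgroup[OF group_free_Abelian_group relators_carrier])

lemma normal_kernel: "Q \<lhd> F"
  using abelian_free_Abelian_group comm_group.normal_iff_subgroup subgroup_kernel by blast

lemma comm_group_tensor: "comm_group T"
  unfolding tensor_group_def
  by (rule comm_group.abelian_FactGroup[OF abelian_free_Abelian_group subgroup_kernel])

sublocale T: comm_group T by (rule comm_group_tensor)

lemma coset_hom: "(\<lambda>c. Q #>\<^bsub>F\<^esub> c) \<in> hom F T"
  unfolding tensor_group_def by (rule normal.r_coset_hom_Mod[OF normal_kernel])

lemma pure_closed [simp, intro]: "\<lbrakk>x \<in> carrier M; y \<in> carrier N\<rbrakk> \<Longrightarrow> pt x y \<in> carrier T"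
  unfolding pure_tensor_def by (rule hom_in_carrier[OF coset_hom]) auto

lemma coset_one: "c \<in> Q \<Longrightarrow> Q #>\<^bsub>F\<^esub> c = \<one>\<^bsub>T\<^esub>"
  unfolding tensor_group_def one_FactGroup
  by (rule group.coset_join2[OF group_free_Abelian_group _ subgroup_kernel])
     (use subgroup.subset[OF subgroup_kernel] in blast)+

lemma coset_diff3:
  assumes "frag_of a - frag_of b - frag_of c \<in> tensor_relators S ra la M N"
    "a \<in> carrier M \<times> carrier N" "b \<in> carrier M \<times> carrier N" "c \<in> carrier M \<times> carrier N"
  shows "Q #>\<^bsub>F\<^esub> frag_of a = (Q #>\<^bsub>F\<^esub> frag_of b) \<otimes>\<^bsub>T\<^esub> (Q #>\<^bsub>F\<^esub> frag_of c)"
proof -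
  let ?r = "frag_of a - frag_of b - frag_of c"
  have "?r \<in> Q" using assms(1) unfolding tensor_kernel_def by (rule generate.incl)
  moreover have "frag_of a = ?r \<otimes>\<^bsub>F\<^esub> (frag_of b \<otimes>\<^bsub>F\<^esub> frag_of c)" by simp
  moreover have "?r \<in> carrier F" using assms relators_carrier by blast
  moreover have "frag_of b \<otimes>\<^bsub>F\<^esub> frag_of c \<in> carrier F" "frag_of b \<in> carrier F" "frag_of c
      \<in> carrier F"
    using assms group.is_monoid[OF group_free_Abelian_group] monoid.m_closed
    by (metis frag_of_in_free_Abelian_group)+
  ultimately show ?thesis
    using hom_mult[OF coset_hom] coset_one hom_in_carrier[OF coset_hom] T.l_one T.m_closed
    by metis
qed

lemma pure_add_left: "\<lbrakk>x \<in> carrier M; x' \<in> carrier M; y \<in> carrier N\<rbrakk>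
    \<Longrightarrow> pt (x \<oplus>\<^bsub>M\<^esub> x') y = pt x y \<otimes>\<^bsub>T\<^esub> pt x' y"
  unfolding pure_tensor_def
  by (rule coset_diff3) (auto simp: tensor_relators_def)

lemma pure_add_right: "\<lbrakk>x \<in> carrier M; y \<in> carrier N; y' \<in> carrier N\<rbrakk>
    \<Longrightarrow> pt x (y \<oplus>\<^bsub>N\<^esub> y') = pt x y \<otimes>\<^bsub>T\<^esub> pt x y'"
  unfolding pure_tensor_def
  by (rule coset_diff3) (auto simp: tensor_relators_def)

lemma pure_balance:
  assumes "x \<in> carrier M" "s \<in> S" "y \<in> carrier N"
  shows "pt (ra x s) y = pt x (la s y)"
proof -
  let ?r = "frag_of (ra x s, y) - frag_of (x, la s y)"
  have r: "?r \<in> tensor_relators S ra la M N" using assms by (auto simp: tensor_relators_def)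
  then have "?r \<in> Q" unfolding tensor_kernel_def by (rule generate.incl)
  moreover have "frag_of (ra x s, y) = ?r \<otimes>\<^bsub>F\<^esub> frag_of (x, la s y)" by simp
  moreover have "?r \<in> carrier F" using r relators_carrier by blast
  moreover have "frag_of (x, la s y) \<in> carrier F" using assms la_closed by auto
  ultimately show ?thesis
    unfolding pure_tensor_def
    using hom_mult[OF coset_hom] coset_one hom_in_carrier[OF coset_hom] T.l_one by metis
qed

lemma pure_zero_left: "y \<in> carrier N \<Longrightarrow> pt \<zero>\<^bsub>M\<^esub> y = \<one>\<^bsub>T\<^esub>"
  using pure_add_left[of "\<zero>\<^bsub>M\<^esub>" "\<zero>\<^bsub>M\<^esub>" y]
  by (metis M.l_zero M.zero_closed T.l_cancel_one' pure_closed)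

lemma pure_minus: "\<lbrakk>x \<in> carrier M; y \<in> carrier N\<rbrakk> \<Longrightarrow> pt (\<ominus>\<^bsub>M\<^esub> x) y = inv\<^bsub>T\<^esub> pt x y"
  using pure_add_left[of "\<ominus>\<^bsub>M\<^esub> x" x y]
  by (metis M.a_inv_closed M.l_neg T.inv_equality pure_closed pure_zero_left)

lemma tensor_induct [consumes 1, case_names pure add]:
  assumes t: "t \<in> carrier T"
    and pure: "\<And>x y. \<lbrakk>x \<in> carrier M; y \<in> carrier N\<rbrakk> \<Longrightarrow> P (pt x y)"
    and add: "\<And>s t. \<lbrakk>s \<in> carrier T; t \<in> carrier T; P s; P t\<rbrakk> \<Longrightarrow> P (s \<otimes>\<^bsub>T\<^esub> t)"
  shows "P t"
proof -
  have tc: "t \<in> (\<lambda>c. Q #>\<^bsub>F\<^esub> c) ` carrier F"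
    using t unfolding tensor_group_def carrier_FactGroup .
  have inv: "P (inv\<^bsub>T\<^esub> t) \<and> P t" if im: "t \<in> (\<lambda>c. Q #>\<^bsub>F\<^esub> c) ` carrier F" for t
  proof -
    obtain c where "c \<in> carrier F" and tc: "t = Q #>\<^bsub>F\<^esub> c"
      using im by blast
    from this(1) have "Poly_Mapping.keys c \<subseteq> carrier M \<times> carrier N" by simp
    then have "P (inv\<^bsub>T\<^esub> (Q #>\<^bsub>F\<^esub> c)) \<and> P (Q #>\<^bsub>F\<^esub> c)"
    proof (induction c rule: free_Abelian_group_induct[consumes 1])
      case 1
      have "Q #>\<^bsub>F\<^esub> 0 = \<one>\<^bsub>T\<^esub>"
        using hom_one[OF coset_hom group_free_Abelian_group T.is_group] by simp
      moreover have "P \<one>\<^bsub>T\<^esub>"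
        using pure[of "\<zero>\<^bsub>M\<^esub>" "\<zero>\<^bsub>N\<^esub>"] pure_zero_left by auto
      ultimately show ?case by simp
    next
      case (2 x y)
      have cl: "x \<in> carrier F" "- y \<in> carrier F" "y \<in> carrier F" using 2 by auto
      have cl': "Q #>\<^bsub>F\<^esub> x \<in> carrier T" "Q #>\<^bsub>F\<^esub> y \<in> carrier T"
        using cl by (auto simp: hom_in_carrier[OF coset_hom])
      have "Q #>\<^bsub>F\<^esub> (x - y) = (Q #>\<^bsub>F\<^esub> x) \<otimes>\<^bsub>T\<^esub> (Q #>\<^bsub>F\<^esub> (- y))"
        using hom_mult[OF coset_hom cl(1,2)] by simp
      moreover have "Q #>\<^bsub>F\<^esub> (- y) = inv\<^bsub>T\<^esub> (Q #>\<^bsub>F\<^esub> y)"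
        using group_hom.hom_inv[of F T _ y] coset_hom cl(3) 2(2)
        by (simp add: group_hom_def group_hom_axioms_def T.is_group)
      ultimately have e: "Q #>\<^bsub>F\<^esub> (x - y) = (Q #>\<^bsub>F\<^esub> x) \<otimes>\<^bsub>T\<^esub> inv\<^bsub>T\<^esub> (Q #>\<^bsub>F\<^esub> y)" by simp
      then have "inv\<^bsub>T\<^esub> (Q #>\<^bsub>F\<^esub> (x - y)) = inv\<^bsub>T\<^esub> (Q #>\<^bsub>F\<^esub> x) \<otimes>\<^bsub>T\<^esub> (Q #>\<^bsub>F\<^esub> y)"
        using cl' by (simp add: T.inv_mult)
      with e show ?case using 2 cl' by (auto intro!: add)
    next
      case (3 a)
      obtain x y where a: "a = (x, y)" "x \<in> carrier M" "y \<in> carrier N" using 3 by auto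
      then have "P (pt (\<ominus>\<^bsub>M\<^esub> x) y) \<and> P (pt x y)" by (auto intro!: pure)
      then show ?case using a pure_minus by (simp add: pure_tensor_def)
    qed
    then show ?thesis using tc by simp
  qed
  show ?thesis using inv[OF tc] ..
qed

end

locale balanced_lift = balanced_tensor S ra la M N + G: comm_group G
  for S :: "'s set" and ra :: "'a \<Rightarrow> 's \<Rightarrow> 'a" and la :: "'s \<Rightarrow> 'b \<Rightarrow> 'b"
    and M :: "('a, 'm) ring_scheme" and N :: "('b, 'n) ring_scheme"
    and G :: "('c, 'p) monoid_scheme" +
  fixes f :: "'a \<Rightarrow> 'b \<Rightarrow> 'c"
  assumes f: "balanced_map S ra la M N G f"
begin

definition ext_frag :: "('a \<times> 'b \<Rightarrow>\<^sub>0 int) \<Rightarrow> 'c" where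
  "ext_frag c = finprod G (\<lambda>(x, y). f x y [^]\<^bsub>G\<^esub> Poly_Mapping.lookup c (x, y)) (Poly_Mapping.keys c)"

lemma ext_frag_superset:
  assumes "finite Y" "Poly_Mapping.keys c \<subseteq> Y" "Y \<subseteq> carrier M \<times> carrier N"
  shows "ext_frag c = finprod G (\<lambda>(x, y). f x y [^]\<^bsub>G\<^esub> Poly_Mapping.lookup c (x, y)) Y"
  unfolding ext_frag_def
  by (rule G.finprod_mono_neutral_cong_left[OF assms(1,2)])
     (use assms(3) f in \<open>auto simp: in_keys_iff balanced_map_def\<close>)

lemma ext_frag_hom: "ext_frag \<in> hom F G"
proof (rule homI)
  fix c assume "c \<in> carrier F"
  then show "ext_frag c \<in> carrier G"
    unfolding ext_frag_def using f by (auto intro!: G.finprod_closed simp: balanced_map_def)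
next
  fix c d assume cd: "c \<in> carrier F" "d \<in> carrier F"
  let ?Y = "Poly_Mapping.keys c \<union> Poly_Mapping.keys d"
  have Y: "finite ?Y" "?Y \<subseteq> carrier M \<times> carrier N" using cd by auto
  have "ext_frag (c + d) = finprod G (\<lambda>(x, y). f x y [^]\<^bsub>G\<^esub> Poly_Mapping.lookup (c + d) (x, y)) ?Y"
    by (rule ext_frag_superset) (use Y in \<open>auto dest: subsetD[OF keys_add]\<close>)
  also have "\<dots> = finprod G (\<lambda>p. (case p of (x, y) \<Rightarrow> f x y [^]\<^bsub>G\<^esub> Poly_Mapping.lookup c (x, y)) \<otimes>\<^bsub>G\<^esub>
        (case p of (x, y) \<Rightarrow> f x y [^]\<^bsub>G\<^esub> Poly_Mapping.lookup d (x, y))) ?Y"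
    using Y f by (intro G.finprod_cong')
        (auto simp: lookup_add G.int_pow_mult balanced_map_def subset_iff)
  also have "\<dots> = ext_frag c \<otimes>\<^bsub>G\<^esub> ext_frag d"
    using Y f by (subst G.finprod_multf)
      (auto simp: ext_frag_superset[of ?Y] balanced_map_def subset_iff Pi_iff)
  finally show "ext_frag (c \<otimes>\<^bsub>F\<^esub> d) = ext_frag c \<otimes>\<^bsub>G\<^esub> ext_frag d" by simp
qed

lemma ext_frag_of: "\<lbrakk>x \<in> carrier M; y \<in> carrier N\<rbrakk> \<Longrightarrow> ext_frag (frag_of (x, y)) = f x y"
  using f by (simp add: ext_frag_def balanced_map_def)

lemma group_hom_ext_frag: "group_hom F G ext_frag"
  using ext_frag_hom by (simp add: group_hom_def group_hom_axioms_def G.is_group)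

lemma ext_frag_diff:
  assumes "Poly_Mapping.keys a \<subseteq> carrier M \<times> carrier N" "Poly_Mapping.keys b \<subseteq> carrier M \<times> carrier
      N"
  shows "ext_frag (a - b) = ext_frag a \<otimes>\<^bsub>G\<^esub> inv\<^bsub>G\<^esub> ext_frag b"
proof -
  have "a - b = a \<otimes>\<^bsub>F\<^esub> inv\<^bsub>F\<^esub> b" using assms by simp
  then show ?thesis
    using assms group_hom.hom_inv[OF group_hom_ext_frag] hom_mult[OF ext_frag_hom, of a "inv\<^bsub>F\<^esub> b"]
    by (metis carrier_free_Abelian_group_iff group.inv_closed group_free_Abelian_group)
qed

lemma kernel_ext_frag: "Q \<subseteq> kernel F G ext_frag"
  unfolding tensor_kernel_def
proof (rule group.generate_subgroup_incl[OF group_free_Abelian_group])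
  show "subgroup (kernel F G ext_frag) F"
    by (rule group_hom.subgroup_kernel[OF group_hom_ext_frag])
  have fcl: "f x y \<in> carrier G" if "x \<in> carrier M" "y \<in> carrier N" for x y
    using f that by (simp add: balanced_map_def)
  have 3: "ext_frag (frag_of (x, y) - frag_of (x', y') - frag_of (x'', y'')) = \<one>\<^bsub>G\<^esub>"
    if "x \<in> carrier M" "y \<in> carrier N" "x' \<in> carrier M" "y' \<in> carrier N" "x'' \<in> carrier M" "y''
        \<in> carrier N"
      "f x y = f x' y' \<otimes>\<^bsub>G\<^esub> f x'' y''" for x y x' y' x'' y''
  proof -
    have "Poly_Mapping.keys (frag_of (x, y) - frag_of (x', y')) \<subseteq> carrier M \<times> carrier N"
      using that keys_diff[of "frag_of (x, y)" "frag_of (x', y')"] by auto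
    then have "ext_frag (frag_of (x, y) - frag_of (x', y') - frag_of (x'', y''))
       = (f x' y' \<otimes>\<^bsub>G\<^esub> f x'' y'') \<otimes>\<^bsub>G\<^esub> inv\<^bsub>G\<^esub> f x' y' \<otimes>\<^bsub>G\<^esub> inv\<^bsub>G\<^esub> f x'' y''"
      using that by (simp add: ext_frag_diff ext_frag_of)
    also have "\<dots> = \<one>\<^bsub>G\<^esub>" using that
      by (metis G.inv_closed G.inv_solve_right' G.m_assoc G.m_comm G.r_inv G.m_closed fcl)
    finally show ?thesis .
  qed
  have 2: "ext_frag (frag_of (x, y) - frag_of (x', y')) = \<one>\<^bsub>G\<^esub>"
    if "x \<in> carrier M" "y \<in> carrier N" "x' \<in> carrier M" "y' \<in> carrier N"
      "f x y = f x' y'" for x y x' y'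
    using that fcl by (simp add: ext_frag_diff ext_frag_of)
  have "ext_frag c = \<one>\<^bsub>G\<^esub>" if "c \<in> tensor_relators S ra la M N" for c
    using that unfolding tensor_relators_def
    by (elim UnE CollectE exE conjE; hypsubst; intro 3 2)
       (use f in \<open>auto simp: balanced_map_def ra_closed la_closed\<close>)
  then show "tensor_relators S ra la M N \<subseteq> kernel F G ext_frag"
    using relators_carrier unfolding kernel_def by blast
qed

lemma tensor_lift_coset:
  assumes "c \<in> carrier F"
  shows "tensor_lift G f (Q #>\<^bsub>F\<^esub> c) = ext_frag c"
proof -
  let ?d = "SOME d. d \<in> Q #>\<^bsub>F\<^esub> c"
  have "c \<in> Q #>\<^bsub>F\<^esub> c"
    by (rule group.rcos_self[OF group_free_Abelian_group assms subgroup_kernel])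
  then have "?d \<in> Q #>\<^bsub>F\<^esub> c" by (rule someI)
  then obtain q where q: "q \<in> Q" and d: "?d = q \<otimes>\<^bsub>F\<^esub> c" by (auto simp: r_coset_def)
  have "q \<in> carrier F" using q subgroup.subset[OF subgroup_kernel] by blast
  then have "ext_frag ?d = ext_frag q \<otimes>\<^bsub>G\<^esub> ext_frag c"
    unfolding d by (rule hom_mult[OF ext_frag_hom _ assms])
  also have "\<dots> = ext_frag c"
    using kernel_ext_frag q hom_in_carrier[OF ext_frag_hom assms] by (auto simp: kernel_def)
  finally show ?thesis by (simp add: tensor_lift_def ext_frag_def Let_def)
qed

lemma tensor_lift_hom: "tensor_lift G f \<in> hom T G"
proof (rule homI)
  fix s assume "s \<in> carrier T"
  then show "tensor_lift G f s \<in> carrier G"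
    unfolding tensor_group_def carrier_FactGroup
    using hom_in_carrier[OF ext_frag_hom] by (auto simp: tensor_lift_coset)
next
  fix s t assume "s \<in> carrier T" "t \<in> carrier T"
  then obtain c d where cd: "c \<in> carrier F" "d \<in> carrier F" "s = Q #>\<^bsub>F\<^esub> c" "t = Q #>\<^bsub>F\<^esub> d"
    unfolding tensor_group_def carrier_FactGroup by blast
  have "s \<otimes>\<^bsub>T\<^esub> t = Q #>\<^bsub>F\<^esub> (c \<otimes>\<^bsub>F\<^esub> d)" using cd hom_mult[OF coset_hom] by metis
  moreover have "c \<otimes>\<^bsub>F\<^esub> d \<in> carrier F"
    using cd group.is_monoid[OF group_free_Abelian_group] monoid.m_closed by metis
  ultimately show "tensor_lift G f (s \<otimes>\<^bsub>T\<^esub> t) = tensor_lift G f s \<otimes>\<^bsub>G\<^esub> tensor_lift G f t"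
    using cd hom_mult[OF ext_frag_hom cd(1,2)] by (simp add: tensor_lift_coset)
qed

lemma tensor_lift_pure: "\<lbrakk>x \<in> carrier M; y \<in> carrier N\<rbrakk> \<Longrightarrow> tensor_lift G f (pt x y) = f x y"
  unfolding pure_tensor_def by (simp add: tensor_lift_coset ext_frag_of)

end

section \<open>Tensor products of modules\<close>

definition lin ::
  "('k, 'l) ring_scheme \<Rightarrow> ('k, 'a, 'm) module_scheme \<Rightarrow> ('k, 'b, 'n) module_scheme
    \<Rightarrow> ('a \<Rightarrow> 'b) \<Rightarrow> bool" where
  "lin k M N f \<longleftrightarrow> f \<in> carrier M \<rightarrow> carrier N \<and>
     (\<forall>x\<in>carrier M. \<forall>y\<in>carrier M. f (x \<oplus>\<^bsub>M\<^esub> y) = f x \<oplus>\<^bsub>N\<^esub> f y) \<and>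
     (\<forall>c\<in>carrier k. \<forall>x\<in>carrier M. f (c \<odot>\<^bsub>M\<^esub> x) = c \<odot>\<^bsub>N\<^esub> f x)"

definition bilin ::
  "('k, 'l) ring_scheme \<Rightarrow> ('k, 'a, 'm) module_scheme \<Rightarrow> ('k, 'b, 'n) module_scheme
    \<Rightarrow> ('k, 'c, 'p) module_scheme \<Rightarrow> ('a \<Rightarrow> 'b \<Rightarrow> 'c) \<Rightarrow> bool" where
  "bilin k U V M F \<longleftrightarrow>
     (\<forall>x\<in>carrier U. lin k V M (F x)) \<and> (\<forall>y\<in>carrier V. lin k U M (\<lambda>x. F x y))"

definition tsum ::
  "('c, 'm) ring_scheme \<Rightarrow> ('a \<Rightarrow> 'b \<Rightarrow> 'c) \<Rightarrow> ('a, 'b) tensor \<Rightarrow> 'c" where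
  "tsum M F t = tensor_lift (add_monoid M) F t"

definition self_module :: "('k, 'l) ring_scheme \<Rightarrow> ('k, 'k) module" where
  "self_module k = \<lparr>carrier = carrier k, monoid.mult = monoid.mult k, one = \<one>\<^bsub>k\<^esub>,
     ring.zero = \<zero>\<^bsub>k\<^esub>, add = add k, smult = monoid.mult k\<rparr>"

lemma lin_closed: "\<lbrakk>lin k M N f; x \<in> carrier M\<rbrakk> \<Longrightarrow> f x \<in> carrier N"
  and lin_add: "\<lbrakk>lin k M N f; x \<in> carrier M; y \<in> carrier M\<rbrakk> \<Longrightarrow> f (x \<oplus>\<^bsub>M\<^esub> y) = f x \<oplus>\<^bsub>N\<^esub> f y"
  and lin_smult: "\<lbrakk>lin k M N f; c \<in> carrier k; x \<in> carrier M\<rbrakk> \<Longrightarrow> f (c \<odot>\<^bsub>M\<^esub> x) = c \<odot>\<^bsub>N\<^esub> f x"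
  unfolding lin_def by auto

lemma linI:
  assumes "\<And>x. x \<in> carrier M \<Longrightarrow> f x \<in> carrier N"
    and "\<And>x y. \<lbrakk>x \<in> carrier M; y \<in> carrier M\<rbrakk> \<Longrightarrow> f (x \<oplus>\<^bsub>M\<^esub> y) = f x \<oplus>\<^bsub>N\<^esub> f y"
    and "\<And>c x. \<lbrakk>c \<in> carrier k; x \<in> carrier M\<rbrakk> \<Longrightarrow> f (c \<odot>\<^bsub>M\<^esub> x) = c \<odot>\<^bsub>N\<^esub> f x"
  shows "lin k M N f"
  using assms unfolding lin_def by auto

lemma lin_zero:
  assumes "lin k M N f" "module k M" "module k N"
  shows "f \<zero>\<^bsub>M\<^esub> = \<zero>\<^bsub>N\<^esub>"
proof -
  interpret M: module k M by fact
  interpret N: module k N by fact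
  have "f (\<zero>\<^bsub>k\<^esub> \<odot>\<^bsub>M\<^esub> \<zero>\<^bsub>M\<^esub>) = \<zero>\<^bsub>k\<^esub> \<odot>\<^bsub>N\<^esub> f \<zero>\<^bsub>M\<^esub>"
    by (rule lin_smult[OF assms(1)]) auto
  then show ?thesis using lin_closed[OF assms(1)] by simp
qed

lemma lin_neg:
  assumes "lin k M N f" "module k M" "module k N" "x \<in> carrier M"
  shows "f (\<ominus>\<^bsub>M\<^esub> x) = \<ominus>\<^bsub>N\<^esub> f x"
proof -
  interpret M: module k M by fact
  interpret N: module k N by fact
  have "f (\<ominus>\<^bsub>M\<^esub> x) \<oplus>\<^bsub>N\<^esub> f x = \<zero>\<^bsub>N\<^esub>"
    using lin_add[OF assms(1), of "\<ominus>\<^bsub>M\<^esub> x" x] lin_zero[OF assms(1-3)] assms(4) by (simp add: M.l_neg)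
  then show ?thesis using lin_closed[OF assms(1)] assms(4)
    by (metis M.a_inv_closed N.minus_equality)
qed

lemma lin_minus:
  assumes "lin k M N f" "module k M" "module k N" "x \<in> carrier M" "y \<in> carrier M"
  shows "f (x \<ominus>\<^bsub>M\<^esub> y) = f x \<ominus>\<^bsub>N\<^esub> f y"
  using assms lin_neg[OF assms(1-3)] lin_add[OF assms(1)]
  by (simp add: a_minus_def module_def abelian_group.a_inv_closed)

lemma lin_cong:
  assumes "lin k M N f" "module k M" "\<And>x. x \<in> carrier M \<Longrightarrow> f x = g x"
  shows "lin k M N g"
proof -
  interpret M: module k M by fact
  show ?thesis using assms(1) by (intro linI) (simp_all add: lin_def assms(3)[symmetric] Pi_iff)
qed

lemma lin_comp: "\<lbrakk>lin k M N f; lin k N P g\<rbrakk> \<Longrightarrow> lin k M P (\<lambda>x. g (f x))"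
  by (rule linI) (auto simp: lin_def Pi_iff)

lemma bilinI:
  assumes "\<And>x. x \<in> carrier U \<Longrightarrow> lin k V M (F x)" "\<And>y. y \<in> carrier V \<Longrightarrow> lin k U M (\<lambda>x. F x y)"
  shows "bilin k U V M F"
  using assms unfolding bilin_def by auto

lemma bilinD1: "\<lbrakk>bilin k U V M F; x \<in> carrier U\<rbrakk> \<Longrightarrow> lin k V M (F x)"
  and bilinD2: "\<lbrakk>bilin k U V M F; y \<in> carrier V\<rbrakk> \<Longrightarrow> lin k U M (\<lambda>x. F x y)"
  unfolding bilin_def by auto

lemma bilin_closed: "\<lbrakk>bilin k U V M F; x \<in> carrier U; y \<in> carrier V\<rbrakk> \<Longrightarrow> F x y \<in> carrier M"
  using bilinD1 lin_closed by fastforce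

lemma tensor_lift_cong_group:
  assumes "carrier G = carrier G'" "monoid.mult G = monoid.mult G'" "one G = one G'"
  shows "tensor_lift G f t = tensor_lift G' f t"
proof -
  have "m_inv G = m_inv G'" using assms unfolding m_inv_def by presburger
  moreover have "x [^]\<^bsub>G\<^esub> n = x [^]\<^bsub>G'\<^esub> n" for x and n :: nat
    using assms unfolding nat_pow_def by presburger
  ultimately have "x [^]\<^bsub>G\<^esub> n = x [^]\<^bsub>G'\<^esub> n" for x and n :: int
    unfolding int_pow_def2 by presburger
  then show ?thesis
    using assms unfolding tensor_lift_def finprod_def Let_def by (simp cong: if_cong)
qed

lemma tensor_algebra_simps:
  "carrier (tensor_algebra k U V) = carrier (tens_grp k U V)"
  "add (tensor_algebra k U V) = monoid.mult (tens_grp k U V)"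
  "\<zero>\<^bsub>tensor_algebra k U V\<^esub> = \<one>\<^bsub>tens_grp k U V\<^esub>"
  "\<one>\<^bsub>tensor_algebra k U V\<^esub> = tens k U V \<one>\<^bsub>U\<^esub> \<one>\<^bsub>V\<^esub>"
  unfolding tensor_algebra_def by simp_all

lemma tensor_lift_tens_grp: "tensor_lift (tens_grp k U V) F t = tsum (tensor_algebra k U V) F t"
  unfolding tsum_def by (rule tensor_lift_cong_group) (simp_all add: tensor_algebra_simps)

lemma tensor_algebra_smult:
  "c \<odot>\<^bsub>tensor_algebra k U V\<^esub> t = tsum (tensor_algebra k U V) (\<lambda>x y. tens k U V (c \<odot>\<^bsub>U\<^esub> x) y) t"
  unfolding tensor_lift_tens_grp[symmetric] by (simp add: tensor_algebra_def)

lemma tensor_algebra_mult: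
  "s \<otimes>\<^bsub>tensor_algebra k U V\<^esub> t = tsum (tensor_algebra k U V) (\<lambda>x y.
     tsum (tensor_algebra k U V) (\<lambda>x' y'. tens k U V (x \<otimes>\<^bsub>U\<^esub> x') (y \<otimes>\<^bsub>V\<^esub> y')) t) s"
  unfolding tensor_lift_tens_grp[symmetric] by (simp add: tensor_algebra_def)

lemma tensor_map_tsum:
  "tensor_map k U V f g t = tsum (tensor_algebra k U V) (\<lambda>x y. tens k U V (f x) (g y)) t"
  unfolding tensor_map_def tensor_lift_tens_grp ..

locale module_pair = U: module k U + V: module k V
  for k :: "('k, 'l) ring_scheme" and U :: "('k, 'a, 'm) module_scheme"
    and V :: "('k, 'b, 'n) module_scheme"
begin

abbreviation "W \<equiv> tensor_algebra k U V"

sublocale B: balanced_tensor "carrier k" "\<lambda>x c. c \<odot>\<^bsub>U\<^esub> x" "\<lambda>c y. c \<odot>\<^bsub>V\<^esub> y" U V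
  by unfold_locales auto

lemma grp: "tens_grp k U V = B.T" and tens: "tens k U V = B.pt"
  unfolding tens_grp_def tens_def by simp_all

lemma add_monoid_W: "comm_group (add_monoid W)"
proof -
  have "comm_group (tens_grp k U V)" unfolding grp by (rule B.comm_group_tensor)
  then interpret G: comm_group "tens_grp k U V" .
  show ?thesis
    using G.l_inv_ex
    by (intro comm_groupI) (simp_all add: tensor_algebra_simps G.m_assoc, simp_all add: G.m_comm)
qed

lemma tens_closed [intro, simp]: "\<lbrakk>x \<in> carrier U; y \<in> carrier V\<rbrakk> \<Longrightarrow> tens k U V x y \<in> carrier W"
  by (simp add: tensor_algebra_simps grp tens)

lemma tens_add_left: "\<lbrakk>x \<in> carrier U; x' \<in> carrier U; y \<in> carrier V\<rbrakk>
    \<Longrightarrow> tens k U V (x \<oplus>\<^bsub>U\<^esub> x') y = tens k U V x y \<oplus>\<^bsub>W\<^esub> tens k U V x' y"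
  and tens_add_right: "\<lbrakk>x \<in> carrier U; y \<in> carrier V; y' \<in> carrier V\<rbrakk>
    \<Longrightarrow> tens k U V x (y \<oplus>\<^bsub>V\<^esub> y') = tens k U V x y \<oplus>\<^bsub>W\<^esub> tens k U V x y'"
  and tens_balance: "\<lbrakk>c \<in> carrier k; x \<in> carrier U; y \<in> carrier V\<rbrakk>
    \<Longrightarrow> tens k U V (c \<odot>\<^bsub>U\<^esub> x) y = tens k U V x (c \<odot>\<^bsub>V\<^esub> y)"
  unfolding tensor_algebra_simps grp tens
  by (simp_all add: B.pure_add_left B.pure_add_right B.pure_balance)

lemma tensor_induct [consumes 1, case_names pure add]:
  assumes "t \<in> carrier W"
    and "\<And>x y. \<lbrakk>x \<in> carrier U; y \<in> carrier V\<rbrakk> \<Longrightarrow> P (tens k U V x y)"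
    and "\<And>s t. \<lbrakk>s \<in> carrier W; t \<in> carrier W; P s; P t\<rbrakk> \<Longrightarrow> P (s \<oplus>\<^bsub>W\<^esub> t)"
  shows "P t"
  using assms unfolding tensor_algebra_simps grp tens by (rule B.tensor_induct)

lemma tsum_additive:
  assumes M: "comm_group (add_monoid M)"
    and bal: "balanced_map (carrier k) (\<lambda>x c. c \<odot>\<^bsub>U\<^esub> x) (\<lambda>c y. c \<odot>\<^bsub>V\<^esub> y) U V (add_monoid M) F"
  shows "t \<in> carrier W \<Longrightarrow> tsum M F t \<in> carrier M"
    and "\<lbrakk>s \<in> carrier W; t \<in> carrier W\<rbrakk> \<Longrightarrow> tsum M F (s \<oplus>\<^bsub>W\<^esub> t) = tsum M F s \<oplus>\<^bsub>M\<^esub> tsum M F t"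
    and "\<lbrakk>x \<in> carrier U; y \<in> carrier V\<rbrakk> \<Longrightarrow> tsum M F (tens k U V x y) = F x y"
proof -
  interpret L: balanced_lift "carrier k" "\<lambda>x c. c \<odot>\<^bsub>U\<^esub> x" "\<lambda>c y. c \<odot>\<^bsub>V\<^esub> y" U V "add_monoid M" F
    by (intro balanced_lift.intro B.balanced_tensor_axioms balanced_lift_axioms.intro M bal)
  show "t \<in> carrier W \<Longrightarrow> tsum M F t \<in> carrier M"
    using hom_in_carrier[OF L.tensor_lift_hom] by (simp add: tsum_def tensor_algebra_simps grp)
  show "\<lbrakk>s \<in> carrier W; t \<in> carrier W\<rbrakk> \<Longrightarrow> tsum M F (s \<oplus>\<^bsub>W\<^esub> t) = tsum M F s \<oplus>\<^bsub>M\<^esub> tsum M F t"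
    using hom_mult[OF L.tensor_lift_hom] by (simp add: tsum_def tensor_algebra_simps grp)
  show "\<lbrakk>x \<in> carrier U; y \<in> carrier V\<rbrakk> \<Longrightarrow> tsum M F (tens k U V x y) = F x y"
    using L.tensor_lift_pure by (simp add: tsum_def tens)
qed

lemma balanced_smult: "c \<in> carrier k \<Longrightarrow>
  balanced_map (carrier k) (\<lambda>x c. c \<odot>\<^bsub>U\<^esub> x) (\<lambda>c y. c \<odot>\<^bsub>V\<^esub> y) U V (add_monoid W)
      (\<lambda>x y. tens k U V (c \<odot>\<^bsub>U\<^esub> x) y)"
  unfolding balanced_map_def
  by (auto simp: U.smult_r_distr tens_add_left tens_add_right tens_balance
      V.smult_assoc1[symmetric]
      U.R.m_comm)

lemma smult_tens: "\<lbrakk>c \<in> carrier k; x \<in> carrier U; y \<in> carrier V\<rbrakk>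
    \<Longrightarrow> c \<odot>\<^bsub>W\<^esub> tens k U V x y = tens k U V (c \<odot>\<^bsub>U\<^esub> x) y"
  unfolding tensor_algebra_smult by (rule tsum_additive(3)[OF add_monoid_W balanced_smult])

lemma abelian_group_W: "abelian_group W"
proof -
  interpret G: comm_group "add_monoid W" by (rule add_monoid_W)
  show ?thesis
    by (rule abelian_groupI) (use G.m_assoc G.m_comm G.l_inv_ex G.m_closed G.one_closed G.l_one in
        simp_all)
qed

lemma module_W: "module k W"
proof -
  interpret W: abelian_group W by (rule abelian_group_W)
  have cl: "c \<odot>\<^bsub>W\<^esub> t \<in> carrier W" if "c \<in> carrier k" "t \<in> carrier W" for c t
    unfolding tensor_algebra_smult using tsum_additive(1)[OF add_monoid_W balanced_smult] that
        by blast
  have ad: "c \<odot>\<^bsub>W\<^esub> (s \<oplus>\<^bsub>W\<^esub> t) = c \<odot>\<^bsub>W\<^esub> s \<oplus>\<^bsub>W\<^esub> c \<odot>\<^bsub>W\<^esub> t"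
    if "c \<in> carrier k" "s \<in> carrier W" "t \<in> carrier W" for c s t
    unfolding tensor_algebra_smult using tsum_additive(2)[OF add_monoid_W balanced_smult] that
        by blast
  show ?thesis
  proof (rule moduleI)
    fix a b t assume ab: "a \<in> carrier k" "b \<in> carrier k" and t: "t \<in> carrier W"
    show "(a \<oplus>\<^bsub>k\<^esub> b) \<odot>\<^bsub>W\<^esub> t = a \<odot>\<^bsub>W\<^esub> t \<oplus>\<^bsub>W\<^esub> b \<odot>\<^bsub>W\<^esub> t"
      using t by (induction t rule: tensor_induct)
        (use ab in \<open>simp_all add: smult_tens U.smult_l_distr tens_add_left ad cl W.a_ac\<close>)
    show "(a \<otimes>\<^bsub>k\<^esub> b) \<odot>\<^bsub>W\<^esub> t = a \<odot>\<^bsub>W\<^esub> (b \<odot>\<^bsub>W\<^esub> t)"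
      using t by (induction t rule: tensor_induct)
        (use ab in \<open>simp_all add: smult_tens U.smult_assoc1 ad cl\<close>)
  next
    fix t assume t: "t \<in> carrier W"
    show "\<one>\<^bsub>k\<^esub> \<odot>\<^bsub>W\<^esub> t = t"
      using t by (induction t rule: tensor_induct) (simp_all add: smult_tens ad)
  qed (use cl ad in \<open>auto intro: U.cring_axioms abelian_group_W\<close>)
qed

lemma bilin_tens: "bilin k U V W (tens k U V)"
  by (intro bilinI linI) (auto simp: smult_tens tens_add_left tens_add_right
      tens_balance[symmetric])

lemma bilin_balanced:
  assumes "bilin k U V M F"
  shows "balanced_map (carrier k) (\<lambda>x c. c \<odot>\<^bsub>U\<^esub> x) (\<lambda>c y. c \<odot>\<^bsub>V\<^esub> y) U V (add_monoid M) F"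
  using assms unfolding balanced_map_def bilin_def lin_def by (auto simp: Pi_iff)

lemma
  assumes "module k M" "bilin k U V M F"
  shows tsum_lin: "lin k W M (tsum M F)"
    and tsum_tens: "\<lbrakk>x \<in> carrier U; y \<in> carrier V\<rbrakk> \<Longrightarrow> tsum M F (tens k U V x y) = F x y"
proof -
  interpret M: module k M by fact
  interpret W: module k W by (rule module_W)
  have cg: "comm_group (add_monoid M)" by (rule M.a_comm_group)
  note * = tsum_additive[OF cg bilin_balanced[OF assms(2)]]
  show "\<lbrakk>x \<in> carrier U; y \<in> carrier V\<rbrakk> \<Longrightarrow> tsum M F (tens k U V x y) = F x y" by (rule *(3))
  show "lin k W M (tsum M F)"
  proof (rule linI)
    fix c t assume c: "c \<in> carrier k" and t: "t \<in> carrier W"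
    show "tsum M F (c \<odot>\<^bsub>W\<^esub> t) = c \<odot>\<^bsub>M\<^esub> tsum M F t"
      using t
    proof (induction t rule: tensor_induct)
      case (pure x y)
      then show ?case using c lin_smult[OF bilinD2[OF assms(2)]] by (simp add: smult_tens *(3))
    next
      case (add s t)
      then show ?case using c by (simp add: W.smult_r_distr M.smult_r_distr *(1,2))
    qed
  qed (use * in auto)
qed

lemma tensor_ext:
  assumes "lin k W M f" "lin k W M g" "\<And>x y. \<lbrakk>x \<in> carrier U; y \<in> carrier V\<rbrakk> \<Longrightarrow> f (tens k U V x y)
      = g (tens k U V x y)"
    and "t \<in> carrier W"
  shows "f t = g t"
  using assms(4) by (induction t rule: tensor_induct)
      (simp_all add: assms(3) lin_add[OF assms(1)] lin_add[OF assms(2)])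

end

lemma module_tensor [intro]: "\<lbrakk>module k U; module k V\<rbrakk> \<Longrightarrow> module k (tensor_algebra k U V)"
  by (rule module_pair.module_W[OF module_pair.intro])

lemmas tens_closed = module_pair.tens_closed[OF module_pair.intro]
lemmas tensor_ext = module_pair.tensor_ext[OF module_pair.intro]
lemmas tsum_tens = module_pair.tsum_tens[OF module_pair.intro]
lemmas tsum_lin = module_pair.tsum_lin[OF module_pair.intro]
lemmas tensor_induct = module_pair.tensor_induct[OF module_pair.intro, consumes 3, case_names pure
    add]
lemmas bilin_tens = module_pair.bilin_tens[OF module_pair.intro]

lemma lin_id: "lin k M M (\<lambda>x. x)"
  by (rule linI) auto

lemma lin_smult_const:
  assumes "module k M" "c \<in> carrier k" "lin k U M f"
  shows "lin k U M (\<lambda>x. c \<odot>\<^bsub>M\<^esub> f x)"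
proof -
  interpret M: module k M by fact
  show ?thesis using assms(2,3)
    by (intro linI) (simp_all add: lin_def Pi_iff M.smult_r_distr M.smult_assoc1[symmetric]
        M.R.m_comm)
qed

lemma lin_add_fun:
  assumes "module k M" "lin k U M f" "lin k U M g"
  shows "lin k U M (\<lambda>x. f x \<oplus>\<^bsub>M\<^esub> g x)"
proof -
  interpret M: module k M by fact
  show ?thesis using assms(2,3)
    by (intro linI) (simp_all add: lin_def Pi_iff M.smult_r_distr M.a_ac)
qed

lemma lin_diff_fun:
  assumes "module k M" "lin k U M f" "lin k U M g"
  shows "lin k U M (\<lambda>x. f x \<ominus>\<^bsub>M\<^esub> g x)"
proof -
  interpret M: module k M by fact
  show ?thesis using assms(2,3)
    by (intro linI)
      (simp_all add: lin_def Pi_iff M.smult_r_distr M.a_ac a_minus_def M.smult_r_minus M.minus_add)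
qed

lemma lin_bilin_left: "\<lbrakk>bilin k U V M F; lin k Y U f; y \<in> carrier V\<rbrakk> \<Longrightarrow> lin k Y M (\<lambda>x. F (f x) y)"
  by (rule lin_comp[OF _ bilinD2])

lemma lin_bilin_right: "\<lbrakk>bilin k U V M F; lin k Y V f; x \<in> carrier U\<rbrakk> \<Longrightarrow> lin k Y M (\<lambda>y. F x (f y))"
  by (rule lin_comp[OF _ bilinD1])

lemma lin_comp_bilin: "\<lbrakk>lin k M N g; bilin k U V M F\<rbrakk> \<Longrightarrow> bilin k U V N (\<lambda>x y. g (F x y))"
  by (intro bilinI) (auto intro: lin_comp bilinD1 bilinD2)

lemma bilin_comp: "\<lbrakk>bilin k U V M F; lin k U' U f; lin k V' V g\<rbrakk>
    \<Longrightarrow> bilin k U' V' M (\<lambda>x y. F (f x) (g y))"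
  by (intro bilinI) (auto intro: lin_bilin_left lin_bilin_right lin_closed)

lemma bilin_flip: "bilin k U V M F \<Longrightarrow> bilin k V U M (\<lambda>x y. F y x)"
  by (simp add: bilin_def)

lemma bilin_cong:
  assumes "bilin k U V M F" "module k U" "module k V"
    "\<And>x y. \<lbrakk>x \<in> carrier U; y \<in> carrier V\<rbrakk> \<Longrightarrow> F x y = G x y"
  shows "bilin k U V M G"
  by (intro bilinI) (auto intro: lin_cong[OF bilinD1[OF assms(1)] assms(3)]
      lin_cong[OF bilinD2[OF assms(1)] assms(2)] assms(4))

lemma bilin_smult: "module k M \<Longrightarrow> bilin k (self_module k) M M (\<lambda>c x. c \<odot>\<^bsub>M\<^esub> x)"
proof -
  assume "module k M"
  then interpret M: module k M .
  show ?thesis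
    by (intro bilinI linI)
      (auto simp: self_module_def M.smult_l_distr M.smult_r_distr M.smult_assoc1 M.R.m_comm simp
          flip: M.smult_assoc1)
qed

lemmas lin_smult_left = lin_bilin_left[OF bilin_smult]

lemmas lin_tens_left = lin_bilin_left[OF bilin_tens]
lemmas lin_tens_right = lin_bilin_right[OF bilin_tens]

lemma tsum_closed: "\<lbrakk>module k U; module k V; module k M; bilin k U V M F; t
    \<in> carrier (tensor_algebra k U V)\<rbrakk>
    \<Longrightarrow> tsum M F t \<in> carrier M"
  using lin_closed[OF tsum_lin] .

lemma tsum_apply:
  assumes "module k U" "module k V" "module k M" "module k N"
    and "lin k M N g" "bilin k U V M F" "t \<in> carrier (tensor_algebra k U V)"
  shows "g (tsum M F t) = tsum N (\<lambda>a b. g (F a b)) t"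
  by (rule tensor_ext[OF assms(1,2) lin_comp[OF tsum_lin[OF assms(1,2,3,6)] assms(5)]
        tsum_lin[OF assms(1,2,4) lin_comp_bilin[OF assms(5,6)]] _ assms(7)])
     (simp add: tsum_tens[OF assms(1,2,3,6)]
         tsum_tens[OF assms(1,2,4) lin_comp_bilin[OF assms(5,6)]])

lemma tsum_cong:
  assumes "module k U" "module k V" "module k M" "bilin k U V M F" "t
      \<in> carrier (tensor_algebra k U V)"
    and "\<And>a b. \<lbrakk>a \<in> carrier U; b \<in> carrier V\<rbrakk> \<Longrightarrow> F a b = G a b"
  shows "tsum M F t = tsum M G t"
proof -
  have G: "bilin k U V M G" by (rule bilin_cong[OF assms(4,1,2,6)])
  show ?thesis
    by (rule tensor_ext[OF assms(1,2) tsum_lin[OF assms(1,2,3,4)] tsum_lin[OF assms(1,2,3) G] _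
        assms(5)])
       (simp add: tsum_tens[OF assms(1,2,3,4)] tsum_tens[OF assms(1,2,3) G] assms(6))
qed

lemma lin_tsum_arg:
  "\<lbrakk>module k U; module k V; module k M; bilin k U V M F; lin k Y (tensor_algebra k U V) f\<rbrakk>
    \<Longrightarrow> lin k Y M (\<lambda>x. tsum M F (f x))"
  by (rule lin_comp[OF _ tsum_lin])

lemma lin_tsum_param:
  assumes "module k U" "module k V" "module k M" "t \<in> carrier (tensor_algebra k U V)"
    and F1: "\<And>a b. \<lbrakk>a \<in> carrier U; b \<in> carrier V\<rbrakk> \<Longrightarrow> lin k Y M (\<lambda>x. F x a b)"
    and F2: "\<And>x. x \<in> carrier Y \<Longrightarrow> bilin k U V M (F x)"
    and Y: "module k Y"
  shows "lin k Y M (\<lambda>x. tsum M (F x) t)"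
proof -
  interpret Y: module k Y by fact
  interpret UV: module k "tensor_algebra k U V" using assms by blast
  show ?thesis
    using assms(4)
  proof (induction t rule: tensor_induct[OF assms(1,2), consumes 1, case_names pure add])
    case (pure a b)
    show ?case
      by (rule lin_cong[OF F1[OF pure] Y]) (simp add: tsum_tens[OF assms(1-3) F2] pure)
  next
    case (add s t)
    show ?case
      by (rule lin_cong[OF lin_add_fun[OF assms(3) add(3,4)] Y])
         (simp add: lin_add[OF tsum_lin[OF assms(1-3) F2]] add)
  qed
qed

lemma bilin_tsum_param:
  assumes "module k U" "module k V" "module k M" "module k P" "module k Q" "t
      \<in> carrier (tensor_algebra k U V)"
    and "\<And>a b. \<lbrakk>a \<in> carrier U; b \<in> carrier V\<rbrakk> \<Longrightarrow> bilin k P Q M (\<lambda>x y. F x y a b)"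
    and "\<And>x y. \<lbrakk>x \<in> carrier P; y \<in> carrier Q\<rbrakk> \<Longrightarrow> bilin k U V M (F x y)"
  shows "bilin k P Q M (\<lambda>x y. tsum M (F x y) t)"
  by (intro bilinI lin_tsum_param[OF assms(1-3,6)] assms(4,5,8))
     (auto intro: bilinD1[OF assms(7)] bilinD2[OF assms(7)])

lemma tsum_swap:
  assumes "module k U" "module k V" "module k M" "module k P" "module k Q"
    and s: "s \<in> carrier (tensor_algebra k P Q)" and t: "t \<in> carrier (tensor_algebra k U V)"
    and F1: "\<And>a b. \<lbrakk>a \<in> carrier U; b \<in> carrier V\<rbrakk> \<Longrightarrow> bilin k P Q M (\<lambda>x y. F x y a b)"
    and F2: "\<And>x y. \<lbrakk>x \<in> carrier P; y \<in> carrier Q\<rbrakk> \<Longrightarrow> bilin k U V M (F x y)"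
  shows "tsum M (\<lambda>x y. tsum M (\<lambda>a b. F x y a b) t) s = tsum M (\<lambda>a b. tsum M (\<lambda>x y. F x y a b) s) t"
proof -
  note m = assms(1-5)
  have b1: "bilin k P Q M (\<lambda>x y. tsum M (F x y) t)"
    by (rule bilin_tsum_param[OF m t F1 F2])
  have b2: "bilin k U V M (\<lambda>a b. tsum M (\<lambda>x y. F x y a b) s)"
      if "s \<in> carrier (tensor_algebra k P Q)" for s
    by (rule bilin_tsum_param[OF m(4,5,3,1,2) that F2 F1])
  have l: "lin k (tensor_algebra k P Q) M (\<lambda>s. tsum M (\<lambda>a b. tsum M (\<lambda>x y. F x y a b) s) t)"
  proof (rule lin_tsum_param[OF m(1-3) t _ b2 module_tensor[OF m(4,5)]])
    fix a b assume ab: "a \<in> carrier U" "b \<in> carrier V"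
    show "lin k (tensor_algebra k P Q) M (tsum M (\<lambda>x y. F x y a b))"
      by (rule tsum_lin[OF m(4,5,3) F1[OF ab]])
  qed
  show ?thesis
  proof (rule tensor_ext[OF m(4,5) tsum_lin[OF m(4,5,3) b1] l _ s])
    fix x y assume xy: "x \<in> carrier P" "y \<in> carrier Q"
    have "tsum M (\<lambda>a b. tsum M (\<lambda>x y. F x y a b) (tens k P Q x y)) t = tsum M (F x y) t"
      by (rule tsum_cong[OF m(1-3) b2 t])
         (simp_all add: xy tens_closed[OF m(4,5)] tsum_tens[OF m(4,5,3) F1])
    then show "tsum M (\<lambda>x y. tsum M (F x y) t) (tens k P Q x y)
       = tsum M (\<lambda>a b. tsum M (\<lambda>x y. F x y a b) (tens k P Q x y)) t"
      by (simp add: tsum_tens[OF m(4,5,3) b1] xy)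
  qed
qed


lemma lin_tensor_map:
  assumes "module k C" "module k D" "module k U" "module k V" "lin k C U f" "lin k D V g"
  shows "lin k (tensor_algebra k C D) (tensor_algebra k U V) (tensor_map k U V f g)"
  unfolding tensor_map_tsum[abs_def]
  by (rule tsum_lin[OF assms(1,2) module_tensor[OF assms(3,4)]
      bilin_comp[OF bilin_tens[OF assms(3,4)] assms(5,6)]])

lemma tensor_map_tens:
  assumes "module k C" "module k D" "module k U" "module k V" "lin k C U f" "lin k D V g"
    and "x \<in> carrier C" "y \<in> carrier D"
  shows "tensor_map k U V f g (tens k C D x y) = tens k U V (f x) (g y)"
  unfolding tensor_map_tsum
  by (rule tsum_tens[OF assms(1,2) module_tensor[OF assms(3,4)]
      bilin_comp[OF bilin_tens[OF assms(3,4)] assms(5,6)] assms(7,8)])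

lemma tsum_tensor_map:
  assumes "module k C" "module k D" "module k U" "module k V" "module k M"
    and "lin k C U f" "lin k D V g" "bilin k U V M F" "t \<in> carrier (tensor_algebra k C D)"
  shows "tsum M F (tensor_map k U V f g t) = tsum M (\<lambda>x y. F (f x) (g y)) t"
  by (rule tensor_ext[OF assms(1,2) lin_comp[OF lin_tensor_map[OF assms(1-4,6,7)]
      tsum_lin[OF assms(3-5,8)]]
        tsum_lin[OF assms(1,2,5) bilin_comp[OF assms(8,6,7)]] _ assms(9)])
     (use assms in \<open>simp add: tensor_map_tens[OF assms(1-4,6,7)] tsum_tens[OF assms(3-5,8)]
        tsum_tens[OF assms(1,2,5) bilin_comp[OF assms(8,6,7)]] lin_closed\<close>)

lemma tensor_map_comp:
  assumes "module k C" "module k D" "module k U" "module k V" "module k P" "module k Q"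
    and "lin k C U f" "lin k D V g" "lin k U P f'" "lin k V Q g'" "t
        \<in> carrier (tensor_algebra k C D)"
  shows "tensor_map k P Q f' g' (tensor_map k U V f g t)
      = tensor_map k P Q (\<lambda>x. f' (f x)) (\<lambda>y. g' (g y)) t"
  unfolding tensor_map_tsum[of k P Q]
  by (rule tsum_tensor_map[OF assms(1-4) module_tensor[OF assms(5,6)] assms(7,8)
        bilin_comp[OF bilin_tens[OF assms(5,6)] assms(9,10)] assms(11)])

lemma tensor_map_ident:
  assumes "module k C" "module k D" "\<And>x. x \<in> carrier C \<Longrightarrow> f x = x" "\<And>y. y \<in> carrier D \<Longrightarrow> g y = y"
    and "t \<in> carrier (tensor_algebra k C D)"
  shows "tensor_map k C D f g t = t"
proof -
  have "lin k C C f" "lin k D D g"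
    by (rule lin_cong[OF lin_id assms(1)], simp add: assms, rule lin_cong[OF lin_id assms(2)], simp
        add: assms)
  note l = this
  show ?thesis
    by (rule tensor_ext[OF assms(1,2) lin_tensor_map[OF assms(1,2,1,2) l] lin_id _ assms(5)])
     (simp add: tensor_map_tens[OF assms(1,2,1,2) l] assms(3,4))
qed

lemma tensor_map_cong:
  assumes "module k C" "module k D" "module k U" "module k V" "lin k C U f" "lin k D V g"
    "\<And>x. x \<in> carrier C \<Longrightarrow> f x = f' x" "\<And>y. y \<in> carrier D \<Longrightarrow> g y = g' y" "t
        \<in> carrier (tensor_algebra k C D)"
  shows "tensor_map k U V f g t = tensor_map k U V f' g' t"
  unfolding tensor_map_tsum
  by (rule tsum_cong[OF assms(1,2) module_tensor[OF assms(3,4)]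
      bilin_comp[OF bilin_tens[OF assms(3,4)] assms(5,6)] assms(9)])
     (simp add: assms)

lemma tensor_map_retract:
  assumes "module k C" "module k D" "module k U" "module k V"
    and "lin k C U j" "lin k D V l" "lin k U C p" "lin k V D q"
    and "\<And>x. x \<in> carrier C \<Longrightarrow> p (j x) = x" "\<And>y. y \<in> carrier D \<Longrightarrow> q (l y) = y"
    and "t \<in> carrier (tensor_algebra k C D)"
  shows "tensor_map k C D p q (tensor_map k U V j l t) = t"
  using assms by (simp add: tensor_map_comp[OF assms(1-4,1,2,5-8)] tensor_map_ident)

section \<open>Tensor products of algebras\<close>

lemma k_algebra_module: "k_algebra k A \<Longrightarrow> module k A"
  by (simp add: k_algebra_def)

lemma bilin_mult: "k_algebra k A \<Longrightarrow> bilin k A A A (\<lambda>x y. x \<otimes>\<^bsub>A\<^esub> y)"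
proof -
  assume "k_algebra k A"
  then interpret k_algebra k A .
  show ?thesis
    by (intro bilinI linI) (auto simp: l_distr r_distr smult_mult_left smult_mult_right)
qed

locale algebra_pair = U: k_algebra k U + V: k_algebra k V
  for k :: "('k, 'l) ring_scheme" and U :: "('k, 'a, 'm) module_scheme"
    and V :: "('k, 'b, 'n) module_scheme"
begin

sublocale module_pair k U V by unfold_locales

lemmas mU = U.module_axioms and mV = V.module_axioms

interpretation W: module k W by (rule module_W)

lemma bilin_mult_tens:
  assumes "x \<in> carrier U" "y \<in> carrier V"
  shows "bilin k U V W (\<lambda>x' y'. tens k U V (x \<otimes>\<^bsub>U\<^esub> x') (y \<otimes>\<^bsub>V\<^esub> y'))"
  by (rule bilin_comp[OF bilin_tens])
     (use assms in \<open>auto intro: bilinD1[OF bilin_mult] U.k_algebra_axioms V.k_algebra_axioms\<close>)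

lemma bilin_mult_tens':
  assumes "x' \<in> carrier U" "y' \<in> carrier V"
  shows "bilin k U V W (\<lambda>x y. tens k U V (x \<otimes>\<^bsub>U\<^esub> x') (y \<otimes>\<^bsub>V\<^esub> y'))"
  by (rule bilin_comp[OF bilin_tens])
     (use assms in \<open>auto intro: bilinD2[OF bilin_mult] U.k_algebra_axioms V.k_algebra_axioms\<close>)

lemma bilin_mult_inner:
  assumes "t \<in> carrier W"
  shows "bilin k U V W (\<lambda>x y. tsum W (\<lambda>x' y'. tens k U V (x \<otimes>\<^bsub>U\<^esub> x') (y \<otimes>\<^bsub>V\<^esub> y')) t)"
  by (rule bilin_tsum_param[OF mU mV module_W mU mV assms bilin_mult_tens' bilin_mult_tens])

lemma bilin_mult_W: "bilin k W W W (\<lambda>s t. s \<otimes>\<^bsub>W\<^esub> t)"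
  unfolding tensor_algebra_mult[abs_def]
proof (rule bilinI)
  fix t assume t: "t \<in> carrier W"
  show "lin k W W (\<lambda>s. tsum W (\<lambda>x y. tsum W (\<lambda>x' y'. tens k U V (x \<otimes>\<^bsub>U\<^esub> x') (y \<otimes>\<^bsub>V\<^esub> y')) t) s)"
    by (rule tsum_lin[OF module_W bilin_mult_inner[OF t]])
next
  fix s assume s: "s \<in> carrier W"
  show "lin k W W (\<lambda>t. tsum W (\<lambda>x y. tsum W (\<lambda>x' y'. tens k U V (x \<otimes>\<^bsub>U\<^esub> x') (y \<otimes>\<^bsub>V\<^esub> y')) t) s)"
    by (rule lin_tsum_param[OF mU mV module_W s _ bilin_mult_inner module_W])
       (auto intro: tsum_lin[OF module_W] bilin_mult_tens)
qed

lemma mult_tens: "\<lbrakk>x \<in> carrier U; y \<in> carrier V; x' \<in> carrier U; y' \<in> carrier V\<rbrakk>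
    \<Longrightarrow> tens k U V x y \<otimes>\<^bsub>W\<^esub> tens k U V x' y' = tens k U V (x \<otimes>\<^bsub>U\<^esub> x') (y \<otimes>\<^bsub>V\<^esub> y')"
  unfolding tensor_algebra_mult
  by (simp add: tsum_tens[OF module_W bilin_mult_inner] tsum_tens[OF module_W bilin_mult_tens])

lemma k_algebra_W: "k_algebra k W"
proof -
  note cl = bilin_closed[OF bilin_mult_W]
  note d1 = lin_add[OF bilinD1[OF bilin_mult_W]] and d2 = lin_add[OF bilinD2[OF bilin_mult_W]]
  have one: "\<one>\<^bsub>W\<^esub> = tens k U V \<one>\<^bsub>U\<^esub> \<one>\<^bsub>V\<^esub>" by (simp add: tensor_algebra_simps)
  have "monoid W"
  proof (rule monoidI)
    fix r s t assume r: "r \<in> carrier W" and s: "s \<in> carrier W" and t: "t \<in> carrier W"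
    show "r \<otimes>\<^bsub>W\<^esub> s \<otimes>\<^bsub>W\<^esub> t = r \<otimes>\<^bsub>W\<^esub> (s \<otimes>\<^bsub>W\<^esub> t)"
      using r
    proof (induction r rule: tensor_induct)
      case (pure x y)
      show ?case using s
      proof (induction s rule: tensor_induct)
        case (pure x' y')
        show ?case using t
        proof (induction t rule: tensor_induct)
          case (pure x'' y'')
          show ?case using \<open>x \<in> _\<close> \<open>x' \<in> _\<close> \<open>y \<in> _\<close> \<open>y' \<in> _\<close> pure
              by (simp add: mult_tens U.m_assoc V.m_assoc)
        next
          case (add t t')
          then show ?case using pure \<open>x \<in> _\<close> \<open>y \<in> _\<close> by (simp add: d1 cl)
        qed
      next
        case (add s s')
        then show ?case using pure t by (simp add: d1 d2 cl)
      qed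
    next
      case (add r r')
      then show ?case using s t by (simp add: d2 cl)
    qed
  next
    fix t assume t: "t \<in> carrier W"
    show "\<one>\<^bsub>W\<^esub> \<otimes>\<^bsub>W\<^esub> t = t" "t \<otimes>\<^bsub>W\<^esub> \<one>\<^bsub>W\<^esub> = t"
      using t by (induction t rule: tensor_induct) (simp_all add: one mult_tens d1 d2)
  qed (auto simp: one intro: cl)
  then have "ring W"
    by (intro ringI W.abelian_group_axioms) (auto simp: d1 d2)
  then show ?thesis
    using U.k.field_axioms module_W lin_smult[OF bilinD1[OF bilin_mult_W]]
        lin_smult[OF bilinD2[OF bilin_mult_W]]
    by (simp add: k_algebra_def k_algebra_axioms_def)
qed

end

lemma k_algebra_tensor [intro]: "\<lbrakk>k_algebra k U; k_algebra k V\<rbrakk>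
    \<Longrightarrow> k_algebra k (tensor_algebra k U V)"
  by (rule algebra_pair.k_algebra_W[OF algebra_pair.intro])

lemmas mult_tens = algebra_pair.mult_tens[OF algebra_pair.intro]
lemmas lin_mult_left = lin_bilin_left[OF bilin_mult]
lemmas lin_mult_right = lin_bilin_right[OF bilin_mult]

lemma tensor_map_mult:
  assumes "k_algebra k C" "k_algebra k D" "k_algebra k U" "k_algebra k V" "lin k C U f"
      "lin k D V g"
    and "\<And>x y. \<lbrakk>x \<in> carrier C; y \<in> carrier C\<rbrakk> \<Longrightarrow> f (x \<otimes>\<^bsub>C\<^esub> y) = f x \<otimes>\<^bsub>U\<^esub> f y"
    and "\<And>x y. \<lbrakk>x \<in> carrier D; y \<in> carrier D\<rbrakk> \<Longrightarrow> g (x \<otimes>\<^bsub>D\<^esub> y) = g x \<otimes>\<^bsub>V\<^esub> g y"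
    and s: "s \<in> carrier (tensor_algebra k C D)" and t: "t \<in> carrier (tensor_algebra k C D)"
  shows "tensor_map k U V f g (s \<otimes>\<^bsub>tensor_algebra k C D\<^esub> t)
    = tensor_map k U V f g s \<otimes>\<^bsub>tensor_algebra k U V\<^esub> tensor_map k U V f g t"
proof -
  note m = assms(1-4)[THEN k_algebra_module]
  note l = lin_tensor_map[OF m assms(5,6)]
  note b = bilin_mult[OF k_algebra_tensor[OF assms(1,2)]]
  note b' = bilin_mult[OF k_algebra_tensor[OF assms(3,4)]]
  note lx = lin_closed[OF assms(5)] lin_closed[OF assms(6)]
  interpret C: k_algebra k C by fact
  interpret D: k_algebra k D by fact
  show ?thesis
    using s
  proof (rule tensor_ext[OF m(1,2) lin_comp[OF bilinD2[OF b t] l]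
      lin_comp[OF l bilinD2[OF b' lin_closed[OF l t]]], rotated])
    fix x y assume xy: "x \<in> carrier C" "y \<in> carrier D"
    note cl = tens_closed[OF m(1,2) xy]
    show "tensor_map k U V f g (tens k C D x y \<otimes>\<^bsub>tensor_algebra k C D\<^esub> t)
       = tensor_map k U V f g (tens k C D x y) \<otimes>\<^bsub>tensor_algebra k U V\<^esub> tensor_map k U V f g t"
      by (rule tensor_ext[OF m(1,2) lin_comp[OF bilinD1[OF b cl] l]
          lin_comp[OF l bilinD1[OF b' lin_closed[OF l cl]]] _ t])
         (simp add: xy lx tensor_map_tens[OF m assms(5,6)] mult_tens[OF assms(1,2)]
             mult_tens[OF assms(3,4)] assms(7,8))
  qed
qed

section \<open>Subspaces\<close>

lemma (in abelian_group) diff_zero_iff: "\<lbrakk>x \<in> carrier G; y \<in> carrier G\<rbrakk> \<Longrightarrow> x \<ominus> y = \<zero> \<longleftrightarrow> x = y"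
  by (metis a_minus_def a_inv_closed minus_equality minus_minus r_neg)

lemma submodule_subset: "submodule L k U \<Longrightarrow> x \<in> L \<Longrightarrow> x \<in> carrier U"
  using subgroup.subset[of L "add_monoid U"] by (auto simp: submodule_def)

lemma submodule_zero: "submodule L k U \<Longrightarrow> \<zero>\<^bsub>U\<^esub> \<in> L"
  using subgroup.one_closed[of L "add_monoid U"] by (auto simp: submodule_def)

lemma submodule_add: "submodule L k U \<Longrightarrow> x \<in> L \<Longrightarrow> y \<in> L \<Longrightarrow> x \<oplus>\<^bsub>U\<^esub> y \<in> L"
  using subgroup.m_closed[of L "add_monoid U"] by (auto simp: submodule_def)

lemma submodule_smult: "submodule L k U \<Longrightarrow> c \<in> carrier k \<Longrightarrow> x \<in> L \<Longrightarrow> c \<odot>\<^bsub>U\<^esub> x \<in> L"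
  by (rule submodule.smult_closed)

lemma submodule_neg: "submodule L k U \<Longrightarrow> x \<in> L \<Longrightarrow> \<ominus>\<^bsub>U\<^esub> x \<in> L"
  using subgroup.m_inv_closed[of L "add_monoid U"] by (auto simp: submodule_def a_inv_def)

lemma submodule_diff: "submodule L k U \<Longrightarrow> x \<in> L \<Longrightarrow> y \<in> L \<Longrightarrow> x \<ominus>\<^bsub>U\<^esub> y \<in> L"
  by (simp add: a_minus_def submodule_add submodule_neg)

lemmas submodule_closed = submodule_zero submodule_add submodule_smult submodule_neg submodule_diff

lemma submoduleI':
  assumes "module k U" "L \<subseteq> carrier U" "\<zero>\<^bsub>U\<^esub> \<in> L"
    "\<And>x y. \<lbrakk>x \<in> L; y \<in> L\<rbrakk> \<Longrightarrow> x \<oplus>\<^bsub>U\<^esub> y \<in> L"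
    "\<And>c x. \<lbrakk>c \<in> carrier k; x \<in> L\<rbrakk> \<Longrightarrow> c \<odot>\<^bsub>U\<^esub> x \<in> L"
  shows "submodule L k U"
proof -
  interpret module k U by fact
  show ?thesis
  proof (rule submoduleI)
    fix x assume x: "x \<in> L"
    have "\<ominus>\<^bsub>U\<^esub> x = (\<ominus>\<^bsub>k\<^esub> \<one>\<^bsub>k\<^esub>) \<odot>\<^bsub>U\<^esub> x" using x assms(2) by (auto simp: smult_l_minus)
    then show "\<ominus>\<^bsub>U\<^esub> x \<in> L" using assms(5)[OF _ x] by simp
  qed (use assms in auto)
qed

lemma module_sub: "\<lbrakk>module k U; submodule L k U\<rbrakk> \<Longrightarrow> module k (U\<lparr>carrier := L\<rparr>)"
  by (rule submodule.submodule_is_module)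

lemma lin_sub_incl: "submodule L k U \<Longrightarrow> lin k (U\<lparr>carrier := L\<rparr>) U (\<lambda>x. x)"
  by (rule linI) (auto intro: submodule_subset)

lemma lin_vimage_submodule:
  assumes "module k U" "module k V" "lin k U V f" "submodule L k V"
  shows "submodule {x \<in> carrier U. f x \<in> L} k U"
proof -
  interpret U: module k U by fact
  show ?thesis
    by (rule submoduleI') (use assms lin_zero[OF assms(3,1,2)] in
      \<open>auto simp: lin_add[OF assms(3)] lin_smult[OF assms(3)] submodule_closed\<close>)
qed

lemma submodule_Inter:
  assumes "module k U" "\<L> \<noteq> {}" "\<And>L. L \<in> \<L> \<Longrightarrow> submodule L k U"
  shows "submodule (\<Inter>\<L>) k U"
  by (rule submoduleI'[OF assms(1)])
     (use assms(2) submodule_subset[OF assms(3)] submodule_zero[OF assms(3)]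
         submodule_add[OF assms(3)]
       submodule_smult[OF assms(3)] in auto)

lemma complement_exists:
  assumes k: "field k" and U: "module k U" and L: "submodule L k U"
  obtains C where "submodule C k U" "C \<inter> L = {\<zero>\<^bsub>U\<^esub>}"
    "\<And>x. x \<in> carrier U \<Longrightarrow> \<exists>c\<in>C. \<exists>l\<in>L. x = c \<oplus>\<^bsub>U\<^esub> l"
proof -
  interpret k: field k by fact
  interpret U: module k U by fact
  let ?S = "{C. submodule C k U \<and> C \<inter> L = {\<zero>\<^bsub>U\<^esub>}}"
  have "submodule {\<zero>\<^bsub>U\<^esub>} k U" by (rule submoduleI'[OF U]) auto
  then have ne: "?S \<noteq> {}" using submodule_zero[OF L] by auto
  have ch: "\<Union>\<C> \<in> ?S" if "\<C> \<noteq> {}" "subset.chain ?S \<C>" for \<C>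
  proof -
    have tot: "P \<subseteq> Q \<or> Q \<subseteq> P" if "P \<in> \<C>" "Q \<in> \<C>" for P Q
      using \<open>subset.chain ?S \<C>\<close> that unfolding subset.chain_def by blast
    have sub: "submodule P k U" "P \<inter> L = {\<zero>\<^bsub>U\<^esub>}" if "P \<in> \<C>" for P
      using \<open>subset.chain ?S \<C>\<close> that unfolding subset.chain_def by blast+
    have "submodule (\<Union>\<C>) k U"
    proof (rule submoduleI'[OF U])
      show "\<Union>\<C> \<subseteq> carrier U" using submodule_subset[OF sub(1)] by auto
      show "\<zero>\<^bsub>U\<^esub> \<in> \<Union>\<C>" using submodule_zero[OF sub(1)] \<open>\<C> \<noteq> {}\<close> by auto
      fix x y assume "x \<in> \<Union>\<C>" "y \<in> \<Union>\<C>"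
      then obtain P Q where "P \<in> \<C>" "Q \<in> \<C>" "x \<in> P" "y \<in> Q" by blast
      then show "x \<oplus>\<^bsub>U\<^esub> y \<in> \<Union>\<C>" using tot[of P Q] submodule_add[OF sub(1)[of P], of x y]
          submodule_add[OF sub(1)[of Q], of x y] by auto
    next
      fix c x assume "c \<in> carrier k" "x \<in> \<Union>\<C>"
      then show "c \<odot>\<^bsub>U\<^esub> x \<in> \<Union>\<C>" using submodule_smult[OF sub(1)] by auto
    qed
    moreover have "\<Union>\<C> \<inter> L = {\<zero>\<^bsub>U\<^esub>}" using sub(2) \<open>\<C> \<noteq> {}\<close> by blast
    ultimately show ?thesis by blast
  qed
  obtain C where C: "submodule C k U" "C \<inter> L = {\<zero>\<^bsub>U\<^esub>}"
    and max: "\<And>D. D \<in> ?S \<Longrightarrow> C \<subseteq> D \<Longrightarrow> D = C"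
    using subset_Zorn_nonempty[OF ne ch] by (auto simp del: Int_iff)
  note clU = submodule_subset[OF C(1)] submodule_subset[OF L]
  have "\<exists>c\<in>C. \<exists>l\<in>L. x = c \<oplus>\<^bsub>U\<^esub> l" if x: "x \<in> carrier U" for x
  proof (rule ccontr)
    assume no: "\<not> ?thesis"
    define D where "D = {c \<oplus>\<^bsub>U\<^esub> a \<odot>\<^bsub>U\<^esub> x | c a. c \<in> C \<and> a \<in> carrier k}"
    have D: "submodule D k U"
    proof (rule submoduleI'[OF U])
      show "D \<subseteq> carrier U" using x clU by (auto simp: D_def)
      show "\<zero>\<^bsub>U\<^esub> \<in> D" unfolding D_def
        by (rule CollectI, rule exI[of _ "\<zero>\<^bsub>U\<^esub>"], rule exI[of _ "\<zero>\<^bsub>k\<^esub>"])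
            (simp add: x submodule_zero[OF C(1)])
      fix p q assume "p \<in> D" "q \<in> D"
      then obtain c a d b where *: "p = c \<oplus>\<^bsub>U\<^esub> a \<odot>\<^bsub>U\<^esub> x" "q = d \<oplus>\<^bsub>U\<^esub> b \<odot>\<^bsub>U\<^esub> x" "c \<in> C" "d \<in> C" "a
          \<in> carrier k" "b \<in> carrier k"
        unfolding D_def by blast
      then have "p \<oplus>\<^bsub>U\<^esub> q = (c \<oplus>\<^bsub>U\<^esub> d) \<oplus>\<^bsub>U\<^esub> (a \<oplus>\<^bsub>k\<^esub> b) \<odot>\<^bsub>U\<^esub> x"
        using x clU by (simp add: U.smult_l_distr U.a_ac)
      then show "p \<oplus>\<^bsub>U\<^esub> q \<in> D" unfolding D_def using * submodule_add[OF C(1)] by blast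
    next
      fix e p assume e: "e \<in> carrier k" and "p \<in> D"
      then obtain c a where *: "p = c \<oplus>\<^bsub>U\<^esub> a \<odot>\<^bsub>U\<^esub> x" "c \<in> C" "a \<in> carrier k"
        unfolding D_def by blast
      then have "e \<odot>\<^bsub>U\<^esub> p = e \<odot>\<^bsub>U\<^esub> c \<oplus>\<^bsub>U\<^esub> (e \<otimes>\<^bsub>k\<^esub> a) \<odot>\<^bsub>U\<^esub> x"
        using x clU e by (simp add: U.smult_r_distr U.smult_assoc1)
      then show "e \<odot>\<^bsub>U\<^esub> p \<in> D" unfolding D_def using * e submodule_smult[OF C(1)] by blast
    qed
    have CD: "C \<subseteq> D"
    proof
      fix c assume c: "c \<in> C"
      then have "c = c \<oplus>\<^bsub>U\<^esub> \<zero>\<^bsub>k\<^esub> \<odot>\<^bsub>U\<^esub> x" using x clU by simp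
      then show "c \<in> D" unfolding D_def using c by blast
    qed
    have "z = \<zero>\<^bsub>U\<^esub>" if "z \<in> L" and zD: "z \<in> D" for z
    proof -
      obtain c a where z: "z = c \<oplus>\<^bsub>U\<^esub> a \<odot>\<^bsub>U\<^esub> x" "c \<in> C" "a \<in> carrier k"
        using zD unfolding D_def by blast
      show ?thesis
      proof (cases "a = \<zero>\<^bsub>k\<^esub>")
        case True
        then show ?thesis using z x clU \<open>z \<in> L\<close> C(2) by auto
      next
        case False
        then have a: "a \<in> Units k" using z k.field_Units by auto
        let ?i = "inv\<^bsub>k\<^esub> a"
        have i: "?i \<in> carrier k" using a by (rule k.Units_inv_closed)
        have "a \<odot>\<^bsub>U\<^esub> x = \<ominus>\<^bsub>U\<^esub> c \<oplus>\<^bsub>U\<^esub> z"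
          using z clU x by (simp add: U.a_assoc[symmetric] U.l_neg)
        then have "?i \<odot>\<^bsub>U\<^esub> (a \<odot>\<^bsub>U\<^esub> x) = ?i \<odot>\<^bsub>U\<^esub> (\<ominus>\<^bsub>U\<^esub> c \<oplus>\<^bsub>U\<^esub> z)" by simp
        also have "\<dots> = ?i \<odot>\<^bsub>U\<^esub> (\<ominus>\<^bsub>U\<^esub> c) \<oplus>\<^bsub>U\<^esub> ?i \<odot>\<^bsub>U\<^esub> z"
          using clU(1)[OF z(2)] clU(2)[OF \<open>z \<in> L\<close>] by (intro U.smult_r_distr[OF i]) auto
        finally have "?i \<odot>\<^bsub>U\<^esub> (a \<odot>\<^bsub>U\<^esub> x) = ?i \<odot>\<^bsub>U\<^esub> (\<ominus>\<^bsub>U\<^esub> c) \<oplus>\<^bsub>U\<^esub> ?i \<odot>\<^bsub>U\<^esub> z" .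
        moreover have "?i \<odot>\<^bsub>U\<^esub> (a \<odot>\<^bsub>U\<^esub> x) = x"
          using a z x i by (simp add: U.smult_assoc1[symmetric])
        ultimately have "x = ?i \<odot>\<^bsub>U\<^esub> (\<ominus>\<^bsub>U\<^esub> c) \<oplus>\<^bsub>U\<^esub> ?i \<odot>\<^bsub>U\<^esub> z" by simp
        moreover have "?i \<odot>\<^bsub>U\<^esub> (\<ominus>\<^bsub>U\<^esub> c) \<in> C" "?i \<odot>\<^bsub>U\<^esub> z \<in> L"
          using submodule_closed[OF C(1)] submodule_closed[OF L] z i \<open>z \<in> L\<close> by auto
        ultimately show ?thesis using no by blast
      qed
    qed
    then have "D \<inter> L = {\<zero>\<^bsub>U\<^esub>}" using submodule_zero[OF D] submodule_zero[OF L] by blast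
    then have "D = C" using max[of D] D CD by blast
    moreover have "x = \<zero>\<^bsub>U\<^esub> \<oplus>\<^bsub>U\<^esub> \<one>\<^bsub>k\<^esub> \<odot>\<^bsub>U\<^esub> x" using x by simp
    then have "x \<in> D" unfolding D_def using submodule_zero[OF C(1)] by blast
    ultimately have "x \<in> C" by simp
    moreover have "x = x \<oplus>\<^bsub>U\<^esub> \<zero>\<^bsub>U\<^esub>" using x by simp
    ultimately show False using no submodule_zero[OF L] by blast
  qed
  then show thesis using that C by blast
qed

lemma retraction_exists:
  assumes k: "field k" and U: "module k U" and L: "submodule L k U"
  obtains p where "lin k U U p" "\<And>x. x \<in> carrier U \<Longrightarrow> p x \<in> L" "\<And>x. x \<in> L \<Longrightarrow> p x = x"
proof -
  interpret U: module k U by fact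
  obtain C where C: "submodule C k U" "C \<inter> L = {\<zero>\<^bsub>U\<^esub>}"
    and dec: "\<And>x. x \<in> carrier U \<Longrightarrow> \<exists>c\<in>C. \<exists>l\<in>L. x = c \<oplus>\<^bsub>U\<^esub> l"
    by (rule complement_exists[OF assms]) blast
  note clU = submodule_subset[OF C(1)] submodule_subset[OF L]
  define p where "p x = (THE l. l \<in> L \<and> x \<ominus>\<^bsub>U\<^esub> l \<in> C)" for x
  have p: "p x = l" if "x \<in> carrier U" "l \<in> L" "x \<ominus>\<^bsub>U\<^esub> l \<in> C" for x l
    unfolding p_def
  proof (rule the_equality)
    fix m assume m: "m \<in> L \<and> x \<ominus>\<^bsub>U\<^esub> m \<in> C"
    have "m \<ominus>\<^bsub>U\<^esub> l = (x \<ominus>\<^bsub>U\<^esub> l) \<ominus>\<^bsub>U\<^esub> (x \<ominus>\<^bsub>U\<^esub> m)"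
    proof -
      have "(x \<ominus>\<^bsub>U\<^esub> l) \<ominus>\<^bsub>U\<^esub> (x \<ominus>\<^bsub>U\<^esub> m) = (x \<oplus>\<^bsub>U\<^esub> \<ominus>\<^bsub>U\<^esub> x) \<oplus>\<^bsub>U\<^esub> (m \<oplus>\<^bsub>U\<^esub> \<ominus>\<^bsub>U\<^esub> l)"
        using that m clU by (simp add: a_minus_def U.minus_add U.a_ac)
      then show ?thesis using that m clU by (simp add: U.r_neg a_minus_def)
    qed
    then have "m \<ominus>\<^bsub>U\<^esub> l \<in> C \<inter> L" using that m submodule_diff[OF C(1), of "x \<ominus>\<^bsub>U\<^esub> l" "x \<ominus>\<^bsub>U\<^esub> m"]
        submodule_diff[OF L, of m l] by simp
    then show "m = l" using C(2) m that clU by (auto simp: U.diff_zero_iff)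
  qed (use that in auto)
  have ex: "\<exists>l\<in>L. x \<ominus>\<^bsub>U\<^esub> l \<in> C" if x: "x \<in> carrier U" for x
  proof -
    obtain c l where cl: "c \<in> C" "l \<in> L" "x = c \<oplus>\<^bsub>U\<^esub> l" using dec[OF x] by blast
    then have "x \<ominus>\<^bsub>U\<^esub> l = c" using clU by (simp add: a_minus_def U.a_assoc U.r_neg)
    then show ?thesis using cl by blast
  qed
  have pL: "p x \<in> L" "x \<ominus>\<^bsub>U\<^esub> p x \<in> C" if "x \<in> carrier U" for x
    using ex[OF that] p[OF that] by auto
  show thesis
  proof
    show "lin k U U p"
    proof (rule linI)
      fix x y assume xy: "x \<in> carrier U" "y \<in> carrier U"
      have "x \<oplus>\<^bsub>U\<^esub> y \<ominus>\<^bsub>U\<^esub> (p x \<oplus>\<^bsub>U\<^esub> p y) = (x \<ominus>\<^bsub>U\<^esub> p x) \<oplus>\<^bsub>U\<^esub> (y \<ominus>\<^bsub>U\<^esub> p y)"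
        using xy pL(1) clU by (simp add: a_minus_def U.minus_add U.a_ac)
      then show "p (x \<oplus>\<^bsub>U\<^esub> y) = p x \<oplus>\<^bsub>U\<^esub> p y"
        using xy pL submodule_closed[OF C(1)] submodule_closed[OF L] by (intro p) auto
    next
      fix c x assume cx: "c \<in> carrier k" "x \<in> carrier U"
      have "c \<odot>\<^bsub>U\<^esub> x \<ominus>\<^bsub>U\<^esub> c \<odot>\<^bsub>U\<^esub> p x = c \<odot>\<^bsub>U\<^esub> (x \<ominus>\<^bsub>U\<^esub> p x)"
        using cx pL(1) clU by (simp add: a_minus_def U.smult_r_distr U.smult_r_minus)
      then show "p (c \<odot>\<^bsub>U\<^esub> x) = c \<odot>\<^bsub>U\<^esub> p x"
        using cx pL submodule_closed[OF C(1)] submodule_closed[OF L] by (intro p) auto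
    qed (use pL clU in auto)
    show "p x \<in> L" if "x \<in> carrier U" for x using pL(1)[OF that] .
    show "p x = x" if "x \<in> L" for x
      using that clU submodule_zero[OF C(1)] by (intro p) (auto simp: a_minus_def U.r_neg)
  qed
qed

lemma functional_exists:
  assumes k: "field k" and U: "module k U" and L: "submodule L k U" and b: "b \<in> carrier U" "b \<notin> L"
  obtains f where "lin k U (self_module k) f" "f b = \<one>\<^bsub>k\<^esub>" "\<And>x. x \<in> L \<Longrightarrow> f x = \<zero>\<^bsub>k\<^esub>"
proof -
  interpret k: field k by fact
  interpret U: module k U by fact
  obtain p where p: "lin k U U p" "\<And>x. x \<in> carrier U \<Longrightarrow> p x \<in> L" "\<And>x. x \<in> L \<Longrightarrow> p x = x"
    by (rule retraction_exists[OF k U L]) blast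
  note clU = submodule_subset[OF L]
  define b' where "b' = b \<ominus>\<^bsub>U\<^esub> p b"
  have b': "b' \<in> carrier U" using b p clU by (auto simp: b'_def)
  have nz: "b' \<noteq> \<zero>\<^bsub>U\<^esub>"
    using b p(2)[OF b(1)] clU U.diff_zero_iff by (auto simp: b'_def)
  define D where "D = {c \<odot>\<^bsub>U\<^esub> b' | c. c \<in> carrier k}"
  have D: "submodule D k U"
  proof (rule submoduleI'[OF U])
    show "D \<subseteq> carrier U" using b' by (auto simp: D_def)
    show "\<zero>\<^bsub>U\<^esub> \<in> D" unfolding D_def using U.smult_l_null[OF b']
        by (metis (mono_tags, lifting) k.zero_closed mem_Collect_eq)
    fix x y assume "x \<in> D" "y \<in> D"
    then show "x \<oplus>\<^bsub>U\<^esub> y \<in> D" unfolding D_def using b'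
        by (auto simp: U.smult_l_distr[symmetric] intro: k.a_closed)
  next
    fix c x assume "c \<in> carrier k" "x \<in> D"
    then show "c \<odot>\<^bsub>U\<^esub> x \<in> D" unfolding D_def using b'
        by (auto simp: U.smult_assoc1[symmetric] intro: k.m_closed)
  qed
  obtain q where q: "lin k U U q" "\<And>x. x \<in> carrier U \<Longrightarrow> q x \<in> D" "\<And>x. x \<in> D \<Longrightarrow> q x = x"
    by (rule retraction_exists[OF k U D]) blast
  define f where "f x = (THE c. c \<in> carrier k \<and> q (x \<ominus>\<^bsub>U\<^esub> p x) = c \<odot>\<^bsub>U\<^esub> b')" for x
  have inj: "c = d" if cd: "c \<in> carrier k" "d \<in> carrier k" "c \<odot>\<^bsub>U\<^esub> b' = d \<odot>\<^bsub>U\<^esub> b'" for c d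
  proof (rule ccontr)
    assume "c \<noteq> d"
    then have "c \<ominus>\<^bsub>k\<^esub> d \<noteq> \<zero>\<^bsub>k\<^esub>" using cd by simp
    then have u: "c \<ominus>\<^bsub>k\<^esub> d \<in> Units k" using cd k.field_Units by auto
    have "(c \<ominus>\<^bsub>k\<^esub> d) \<odot>\<^bsub>U\<^esub> b' = \<zero>\<^bsub>U\<^esub>"
      using cd b' by (simp add: a_minus_def U.smult_l_distr U.smult_l_minus U.r_neg)
    then have "(inv\<^bsub>k\<^esub> (c \<ominus>\<^bsub>k\<^esub> d) \<otimes>\<^bsub>k\<^esub> (c \<ominus>\<^bsub>k\<^esub> d)) \<odot>\<^bsub>U\<^esub> b' = \<zero>\<^bsub>U\<^esub>"
      using U.smult_assoc1[of "inv\<^bsub>k\<^esub> (c \<ominus>\<^bsub>k\<^esub> d)" "c \<ominus>\<^bsub>k\<^esub> d" b'] u b' cd by (simp del: k.Units_l_inv)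
    then show False using u b' nz by simp
  qed
  have f: "f x = c" if "c \<in> carrier k" "q (x \<ominus>\<^bsub>U\<^esub> p x) = c \<odot>\<^bsub>U\<^esub> b'" for x c
    unfolding f_def using that inj by (intro the_equality) auto
  have e: "lin k U U (\<lambda>x. q (x \<ominus>\<^bsub>U\<^esub> p x))"
    by (rule lin_comp[OF lin_diff_fun[OF U lin_id p(1)] q(1)])
  have fx: "f x \<in> carrier k" "q (x \<ominus>\<^bsub>U\<^esub> p x) = f x \<odot>\<^bsub>U\<^esub> b'" if x: "x \<in> carrier U" for x
  proof -
    have "x \<ominus>\<^bsub>U\<^esub> p x \<in> carrier U" using x p clU by auto
    then obtain c where "c \<in> carrier k" "q (x \<ominus>\<^bsub>U\<^esub> p x) = c \<odot>\<^bsub>U\<^esub> b'" using q(2) D_def by blast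
    then show "f x \<in> carrier k" "q (x \<ominus>\<^bsub>U\<^esub> p x) = f x \<odot>\<^bsub>U\<^esub> b'" using f by auto
  qed
  show thesis
  proof
    show "lin k U (self_module k) f"
    proof (rule linI)
      fix x y assume xy: "x \<in> carrier U" "y \<in> carrier U"
      have "f (x \<oplus>\<^bsub>U\<^esub> y) = f x \<oplus>\<^bsub>k\<^esub> f y"
        using xy fx(1) by (intro f) (simp_all add: lin_add[OF e xy] fx(2)[OF xy(1)] fx(2)[OF xy(2)]
            U.smult_l_distr b')
      then show "f (x \<oplus>\<^bsub>U\<^esub> y) = f x \<oplus>\<^bsub>self_module k\<^esub> f y" by (simp add: self_module_def)
    next
      fix c x assume cx: "c \<in> carrier k" "x \<in> carrier U"
      have "f (c \<odot>\<^bsub>U\<^esub> x) = c \<otimes>\<^bsub>k\<^esub> f x"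
        using cx fx(1) by (intro f) (simp_all add: lin_smult[OF e cx] fx(2)[OF cx(2)]
            U.smult_assoc1 b')
      then show "f (c \<odot>\<^bsub>U\<^esub> x) = c \<odot>\<^bsub>self_module k\<^esub> f x" by (simp add: self_module_def)
    qed (simp add: self_module_def fx(1))
    have "b' = \<one>\<^bsub>k\<^esub> \<odot>\<^bsub>U\<^esub> b'" using b' by simp
    then have "b' \<in> D" unfolding D_def by blast
    then show "f b = \<one>\<^bsub>k\<^esub>" using b' q(3) by (intro f) (auto simp: b'_def[symmetric])
    show "f x = \<zero>\<^bsub>k\<^esub>" if "x \<in> L" for x
      using that clU b' lin_zero[OF q(1) U U] p(3) by (intro f) (auto simp: a_minus_def U.r_neg)
  qed
qed

fun span_list :: "('k, 'l) ring_scheme \<Rightarrow> ('k, 'b, 'n) module_scheme \<Rightarrow> 'b list \<Rightarrow> 'b set" where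
  "span_list k V [] = {\<zero>\<^bsub>V\<^esub>}"
| "span_list k V (b # bs) = {c \<odot>\<^bsub>V\<^esub> b \<oplus>\<^bsub>V\<^esub> w | c w. c \<in> carrier k \<and> w \<in> span_list k V bs}"

fun tensors_over :: "('k, 'l) ring_scheme \<Rightarrow> ('k, 'a, 'm) module_scheme \<Rightarrow> ('k, 'b, 'n) module_scheme
    \<Rightarrow> 'b list \<Rightarrow> ('a, 'b) tensor set" where
  "tensors_over k U V [] = {\<zero>\<^bsub>tensor_algebra k U V\<^esub>}"
| "tensors_over k U V (b # bs) =
     {tens k U V a b \<oplus>\<^bsub>tensor_algebra k U V\<^esub> s | a s. a \<in> carrier U \<and> s \<in> tensors_over k U V bs}"

context module_pair
begin

interpretation W: module k W by (rule module_W)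

lemma tens_zero: "x \<in> carrier U \<Longrightarrow> tens k U V x \<zero>\<^bsub>V\<^esub> = \<zero>\<^bsub>W\<^esub>" "y \<in> carrier V \<Longrightarrow> tens k U V \<zero>\<^bsub>U\<^esub> y = \<zero>\<^bsub>W\<^esub>"
  using lin_zero[OF bilinD1[OF bilin_tens] V.module_axioms module_W]
    lin_zero[OF bilinD2[OF bilin_tens] U.module_axioms module_W] by auto

lemma submodule_span_list: "set bs \<subseteq> carrier V \<Longrightarrow> submodule (span_list k V bs) k V"
proof (induction bs)
  case Nil
  show ?case by (rule submoduleI'[OF V.module_axioms]) auto
next
  case (Cons b bs)
  then have S: "submodule (span_list k V bs) k V" and b: "b \<in> carrier V" by auto
  note cl = submodule_subset[OF S]
  show ?case
  proof (rule submoduleI'[OF V.module_axioms])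
    show "span_list k V (b # bs) \<subseteq> carrier V" using cl b by auto
    have "\<zero>\<^bsub>V\<^esub> = \<zero>\<^bsub>k\<^esub> \<odot>\<^bsub>V\<^esub> b \<oplus>\<^bsub>V\<^esub> \<zero>\<^bsub>V\<^esub>" using b by simp
    then show "\<zero>\<^bsub>V\<^esub> \<in> span_list k V (b # bs)" using submodule_zero[OF S] by auto
    fix x y assume "x \<in> span_list k V (b # bs)" "y \<in> span_list k V (b # bs)"
    then obtain c w d v where *: "x = c \<odot>\<^bsub>V\<^esub> b \<oplus>\<^bsub>V\<^esub> w" "y = d \<odot>\<^bsub>V\<^esub> b \<oplus>\<^bsub>V\<^esub> v" "c \<in> carrier k" "d \<in> carrier k"
      "w \<in> span_list k V bs" "v \<in> span_list k V bs" by auto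
    then have "x \<oplus>\<^bsub>V\<^esub> y = (c \<oplus>\<^bsub>k\<^esub> d) \<odot>\<^bsub>V\<^esub> b \<oplus>\<^bsub>V\<^esub> (w \<oplus>\<^bsub>V\<^esub> v)"
      using b cl by (simp add: V.smult_l_distr V.a_ac)
    then show "x \<oplus>\<^bsub>V\<^esub> y \<in> span_list k V (b # bs)" using * submodule_add[OF S] by auto
  next
    fix e x assume e: "e \<in> carrier k" and "x \<in> span_list k V (b # bs)"
    then obtain c w where *: "x = c \<odot>\<^bsub>V\<^esub> b \<oplus>\<^bsub>V\<^esub> w" "c \<in> carrier k" "w \<in> span_list k V bs" by auto
    then have "e \<odot>\<^bsub>V\<^esub> x = (e \<otimes>\<^bsub>k\<^esub> c) \<odot>\<^bsub>V\<^esub> b \<oplus>\<^bsub>V\<^esub> e \<odot>\<^bsub>V\<^esub> w"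
      using b cl e by (simp add: V.smult_r_distr V.smult_assoc1)
    then show "e \<odot>\<^bsub>V\<^esub> x \<in> span_list k V (b # bs)" using * e submodule_smult[OF S] by auto
  qed
qed

lemma tensors_over_carrier: "set bs \<subseteq> carrier V \<Longrightarrow> t \<in> tensors_over k U V bs \<Longrightarrow> t \<in> carrier W"
  by (induction bs arbitrary: t) auto

lemma tensors_over_add: "\<lbrakk>set bs \<subseteq> carrier V; s \<in> tensors_over k U V bs; t \<in> tensors_over k U V bs\<rbrakk>
    \<Longrightarrow> s \<oplus>\<^bsub>W\<^esub> t \<in> tensors_over k U V bs"
proof (induction bs arbitrary: s t)
  case (Cons b bs)
  then obtain a s' a' t' where *: "s = tens k U V a b \<oplus>\<^bsub>W\<^esub> s'" "t = tens k U V a' b \<oplus>\<^bsub>W\<^esub> t'"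
    "a \<in> carrier U" "a' \<in> carrier U" "s' \<in> tensors_over k U V bs" "t' \<in> tensors_over k U V bs"
        by auto
  then have "s \<oplus>\<^bsub>W\<^esub> t = tens k U V (a \<oplus>\<^bsub>U\<^esub> a') b \<oplus>\<^bsub>W\<^esub> (s' \<oplus>\<^bsub>W\<^esub> t')"
    using Cons.prems tensors_over_carrier[of bs] by (simp add: tens_add_left W.a_ac)
  moreover have "s' \<oplus>\<^bsub>W\<^esub> t' \<in> tensors_over k U V bs" using * Cons.IH Cons.prems by simp
  moreover have "a \<oplus>\<^bsub>U\<^esub> a' \<in> carrier U" using * by simp
  ultimately show ?case unfolding tensors_over.simps by blast
qed auto

lemma tensors_over_tens: "\<lbrakk>set bs \<subseteq> carrier V; w \<in> span_list k V bs; a \<in> carrier U\<rbrakk>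
    \<Longrightarrow> tens k U V a w \<in> tensors_over k U V bs"
proof (induction bs arbitrary: w)
  case (Cons b bs)
  then obtain c v where *: "w = c \<odot>\<^bsub>V\<^esub> b \<oplus>\<^bsub>V\<^esub> v" "c \<in> carrier k" "v \<in> span_list k V bs" by auto
  then have "tens k U V a w = tens k U V (c \<odot>\<^bsub>U\<^esub> a) b \<oplus>\<^bsub>W\<^esub> tens k U V a v"
    using Cons.prems submodule_subset[OF submodule_span_list, of bs]
    by (simp add: tens_add_right tens_balance)
  then show ?case using * Cons by auto
qed (simp add: tens_zero)

lemma tensors_over_append:
  "\<lbrakk>set bs \<subseteq> carrier V; set bs' \<subseteq> carrier V; s \<in> tensors_over k U V bs; t \<in> tensors_over k U V bs'\<rbrakk>
    \<Longrightarrow> s \<oplus>\<^bsub>W\<^esub> t \<in> tensors_over k U V (bs @ bs')"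
proof (induction bs arbitrary: s)
  case Nil
  then show ?case using tensors_over_carrier[of bs' t] by auto
next
  case (Cons b bs)
  then obtain a s' where *: "s = tens k U V a b \<oplus>\<^bsub>W\<^esub> s'" "a \<in> carrier U" "s' \<in> tensors_over k U V bs"
      by auto
  then have "s \<oplus>\<^bsub>W\<^esub> t = tens k U V a b \<oplus>\<^bsub>W\<^esub> (s' \<oplus>\<^bsub>W\<^esub> t)"
    using Cons.prems tensors_over_carrier[of bs s'] tensors_over_carrier[of bs' t]
        by (simp add: W.a_assoc)
  then show ?case using * Cons by auto
qed

lemma tensors_over_exhaust:
  assumes "t \<in> carrier W"
  obtains bs where "set bs \<subseteq> carrier V" "t \<in> tensors_over k U V bs"
proof -
  have "\<exists>bs. set bs \<subseteq> carrier V \<and> t \<in> tensors_over k U V bs"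
    using assms
  proof (induction t rule: tensor_induct)
    case (pure x y)
    then show ?case by (intro exI[of _ "[y]"]) (auto intro!: exI[of _ x])
  next
    case (add s t)
    then obtain bs bs' where "set bs \<subseteq> carrier V" "s \<in> tensors_over k U V bs" "set bs' \<subseteq> carrier V"
        "t \<in> tensors_over k U V bs'"
      by blast
    then show ?case using tensors_over_append by (intro exI[of _ "bs @ bs'"]) auto
  qed
  then show thesis using that by blast
qed

lemma bilin_slice:
  assumes "lin k V (self_module k) f"
  shows "bilin k U V U (\<lambda>a b. f b \<odot>\<^bsub>U\<^esub> a)"
  by (rule bilin_comp[OF bilin_flip[OF bilin_smult[OF U.module_axioms]] lin_id assms])

lemma slices_separate:
  assumes k: "field k" and t: "t \<in> carrier W"
    and sl: "\<And>f. lin k V (self_module k) f \<Longrightarrow> tsum U (\<lambda>a b. f b \<odot>\<^bsub>U\<^esub> a) t = \<zero>\<^bsub>U\<^esub>"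
  shows "t = \<zero>\<^bsub>W\<^esub>"
proof -
  obtain bs where "set bs \<subseteq> carrier V" "t \<in> tensors_over k U V bs"
    using tensors_over_exhaust[OF t] by blast
  then show ?thesis using sl
  proof (induction bs arbitrary: t)
    case (Cons b bs)
    then have bs: "set bs \<subseteq> carrier V" and b: "b \<in> carrier V" by auto
    from Cons.prems obtain a s where t: "t = tens k U V a b \<oplus>\<^bsub>W\<^esub> s" and a: "a \<in> carrier U"
      and s: "s \<in> tensors_over k U V bs" by auto
    have sW: "s \<in> carrier W" by (rule tensors_over_carrier[OF bs s])
    have "t \<in> tensors_over k U V bs"
    proof (cases "b \<in> span_list k V bs")
      case True
      then show ?thesis unfolding t by (intro tensors_over_add tensors_over_tens bs a s)
    next
      case False
      obtain f where f: "lin k V (self_module k) f" "f b = \<one>\<^bsub>k\<^esub>" "\<And>x. x \<in> span_list k V bs \<Longrightarrow> f x = \<zero>\<^bsub>k\<^esub>"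
        by (rule functional_exists[OF k V.module_axioms submodule_span_list[OF bs] b False]) blast
      note bl = bilin_slice[OF f(1)]
      note ad = lin_add[OF tsum_lin[OF U.module_axioms bl]]
      have van: "tsum U (\<lambda>a b. f b \<odot>\<^bsub>U\<^esub> a) s = \<zero>\<^bsub>U\<^esub>"
        if "set cs \<subseteq> span_list k V bs" "s \<in> tensors_over k U V cs" for s cs
        using that
      proof (induction cs arbitrary: s)
        case Nil
        then show ?case using lin_zero[OF tsum_lin[OF U.module_axioms bl] module_W U.module_axioms]
            by simp
      next
        case (Cons c cs)
        have cV: "set (c # cs) \<subseteq> carrier V"
          using Cons.prems submodule_subset[OF submodule_span_list[OF bs]] by blast
        from Cons.prems obtain a s' where "s = tens k U V a c \<oplus>\<^bsub>W\<^esub> s'" "a \<in> carrier U" "s'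
            \<in> tensors_over k U V cs" by auto
        then show ?case
          using Cons cV f(3)[of c] tensors_over_carrier[of cs s']
              tsum_tens[OF U.module_axioms bl, of a c]
          by (simp add: ad)
      qed
      have in_span: "set bs \<subseteq> span_list k V bs" using bs
      proof (induction bs)
        case (Cons b bs)
        then have S: "submodule (span_list k V bs) k V" using submodule_span_list by auto
        have "b = \<one>\<^bsub>k\<^esub> \<odot>\<^bsub>V\<^esub> b \<oplus>\<^bsub>V\<^esub> \<zero>\<^bsub>V\<^esub>" using Cons by simp
        then have "b \<in> span_list k V (b # bs)" using submodule_zero[OF S] by auto
        moreover have "w \<in> span_list k V (b # bs)" if "w \<in> span_list k V bs" for w
        proof -
          have "w = \<zero>\<^bsub>k\<^esub> \<odot>\<^bsub>V\<^esub> b \<oplus>\<^bsub>V\<^esub> w" using Cons submodule_subset[OF S that] by simp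
          then show ?thesis using that by auto
        qed
        ultimately show ?case using Cons by auto
      qed simp
      have "tsum U (\<lambda>a b. f b \<odot>\<^bsub>U\<^esub> a) t = a"
        using a b sW van[OF in_span s] tsum_tens[OF U.module_axioms bl a b] f(2) unfolding t
        by (simp add: ad)
      then have "a = \<zero>\<^bsub>U\<^esub>" using Cons.prems(3)[OF f(1)] by simp
      then have "t = s" using t b sW by (simp add: tens_zero)
      then show ?thesis using s by simp
    qed
    then show ?case using Cons.IH bs Cons.prems(3) by blast
  qed simp
qed

lemma retract_left_of_slices:
  assumes k: "field k" and t: "t \<in> carrier W"
    and p: "lin k U U p" "\<And>x. x \<in> I \<Longrightarrow> p x = x"
    and sl: "\<And>f. lin k V (self_module k) f \<Longrightarrow> tsum U (\<lambda>a b. f b \<odot>\<^bsub>U\<^esub> a) t \<in> I"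
  shows "tensor_map k U V p (\<lambda>y. y) t = t"
proof -
  note mU = U.module_axioms and mV = V.module_axioms
  let ?t = "tensor_map k U V p (\<lambda>y. y) t"
  note l = lin_tensor_map[OF mU mV mU mV p(1) lin_id]
  have t': "?t \<in> carrier W" by (rule lin_closed[OF l t])
  have "?t \<ominus>\<^bsub>W\<^esub> t = \<zero>\<^bsub>W\<^esub>"
  proof (rule slices_separate[OF k])
    show "?t \<ominus>\<^bsub>W\<^esub> t \<in> carrier W" using t t' by simp
    fix f assume f: "lin k V (self_module k) f"
    note bl = bilin_slice[OF f]
    let ?s = "tsum U (\<lambda>a b. f b \<odot>\<^bsub>U\<^esub> a)"
    have f': "f y \<in> carrier k" if "y \<in> carrier V" for y using lin_closed[OF f that]
        by (simp add: self_module_def)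
    have "?s ?t = tsum U (\<lambda>a b. f b \<odot>\<^bsub>U\<^esub> p a) t"
      by (rule tsum_tensor_map[OF mU mV mU mV mU p(1) lin_id bl t])
    also have "\<dots> = tsum U (\<lambda>a b. p (f b \<odot>\<^bsub>U\<^esub> a)) t"
      by (rule tsum_cong[OF mU mV mU bilin_comp[OF bl p(1) lin_id] t])
          (simp add: lin_smult[OF p(1)] f')
    also have "\<dots> = p (?s t)" by (rule tsum_apply[OF mU mV mU mU p(1) bl t, symmetric])
    also have "\<dots> = ?s t" by (rule p(2)[OF sl[OF f]])
    finally show "?s (?t \<ominus>\<^bsub>W\<^esub> t) = \<zero>\<^bsub>U\<^esub>"
      using lin_minus[OF tsum_lin[OF mU bl] module_W mU t' t] lin_closed[OF tsum_lin[OF mU bl] t]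
      by (simp add: a_minus_def U.r_neg)
  qed
  then show ?thesis using t t' W.diff_zero_iff by blast
qed

end

section \<open>Sweedler calculus\<close>

lemma lin_counit_smult:
  "\<lbrakk>module k M; lin k A (self_module k) f; lin k Y A g; v \<in> carrier M\<rbrakk>
      \<Longrightarrow> lin k Y M (\<lambda>x. f (g x) \<odot>\<^bsub>M\<^esub> v)"
  by (rule lin_smult_left[OF _ lin_comp])

lemma lin_apply: "\<lbrakk>lin k A B g; lin k Y A f\<rbrakk> \<Longrightarrow> lin k Y B (\<lambda>x. g (f x))"
  by (rule lin_comp)

lemma trilin_tsum:
  assumes "module k A" "module k U" "module k V" "module k M"
    and "\<And>a. a \<in> carrier A \<Longrightarrow> bilin k U V M (F a)"
    and "\<And>b c. \<lbrakk>b \<in> carrier U; c \<in> carrier V\<rbrakk> \<Longrightarrow> lin k A M (\<lambda>a. F a b c)"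
  shows "bilin k A (tensor_algebra k U V) M (\<lambda>a u. tsum M (F a) u)"
  by (intro bilinI tsum_lin[OF assms(2-5)] lin_tsum_param[OF assms(2-4) _ assms(6,5,1)])

lemma tsum_mult:
  assumes U: "k_algebra k U" and V: "k_algebra k V" and M: "module k M" and F: "bilin k U V M F"
    and s: "s \<in> carrier (tensor_algebra k U V)" and t: "t \<in> carrier (tensor_algebra k U V)"
  shows "tsum M F (s \<otimes>\<^bsub>tensor_algebra k U V\<^esub> t)
    = tsum M (\<lambda>a b. tsum M (\<lambda>c d. F (a \<otimes>\<^bsub>U\<^esub> c) (b \<otimes>\<^bsub>V\<^esub> d)) t) s"
proof -
  note mU = k_algebra_module[OF U] and mV = k_algebra_module[OF V]
  note kW = k_algebra_tensor[OF U V]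
  note mW = k_algebra_module[OF kW]
  interpret U: k_algebra k U by fact
  interpret V: k_algebra k V by fact
  have i1: "bilin k U V M (\<lambda>c d. F (a \<otimes>\<^bsub>U\<^esub> c) (b \<otimes>\<^bsub>V\<^esub> d))" if "a \<in> carrier U" "b \<in> carrier V" for a b
    by (rule bilin_comp[OF F bilinD1[OF bilin_mult[OF U] that(1)]
        bilinD1[OF bilin_mult[OF V] that(2)]])
  have i2: "bilin k U V M (\<lambda>a b. F (a \<otimes>\<^bsub>U\<^esub> c) (b \<otimes>\<^bsub>V\<^esub> d))" if "c \<in> carrier U" "d \<in> carrier V" for c d
    by (rule bilin_comp[OF F bilinD2[OF bilin_mult[OF U] that(1)]
        bilinD2[OF bilin_mult[OF V] that(2)]])
  have o: "bilin k U V M (\<lambda>a b. tsum M (\<lambda>c d. F (a \<otimes>\<^bsub>U\<^esub> c) (b \<otimes>\<^bsub>V\<^esub> d)) t)"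
      if "t \<in> carrier (tensor_algebra k U V)" for t
    by (rule bilin_tsum_param[OF mU mV M mU mV that i2 i1])
  note l = tsum_lin[OF mU mV M F]
  show ?thesis
  proof (rule tensor_ext[OF mU mV lin_comp[OF bilinD2[OF bilin_mult[OF kW] t] l]
      tsum_lin[OF mU mV M o[OF t]] _ s])
    fix a b assume ab: "a \<in> carrier U" "b \<in> carrier V"
    note ct = tens_closed[OF mU mV ab]
    have "tsum M F (tens k U V a b \<otimes>\<^bsub>tensor_algebra k U V\<^esub> t) = tsum M (\<lambda>c d. F (a \<otimes>\<^bsub>U\<^esub> c) (b \<otimes>\<^bsub>V\<^esub> d)) t"
      by (rule tensor_ext[OF mU mV lin_comp[OF bilinD1[OF bilin_mult[OF kW] ct] l]
          tsum_lin[OF mU mV M i1[OF ab]] _ t])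
         (simp add: ab mult_tens[OF U V] tsum_tens[OF mU mV M F] tsum_tens[OF mU mV M i1[OF ab]])
    then show "tsum M F (tens k U V a b \<otimes>\<^bsub>tensor_algebra k U V\<^esub> t)
       = tsum M (\<lambda>a b. tsum M (\<lambda>c d. F (a \<otimes>\<^bsub>U\<^esub> c) (b \<otimes>\<^bsub>V\<^esub> d)) t) (tens k U V a b)"
      using ab by (simp add: tsum_tens[OF mU mV M o[OF t]])
  qed
qed

lemma tsum_tens_self:
  assumes "module k U" "module k V" "t \<in> carrier (tensor_algebra k U V)"
  shows "tsum (tensor_algebra k U V) (tens k U V) t = t"
  by (rule tensor_ext[OF assms(1,2) tsum_lin[OF assms(1,2) module_tensor[OF assms(1,2)]
      bilin_tens[OF assms(1,2)]] lin_id _ assms(3)])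
     (rule tsum_tens[OF assms(1,2) module_tensor[OF assms(1,2)] bilin_tens[OF assms(1,2)]])

context hopf_algebra
begin

abbreviation "AA \<equiv> tensor_algebra k A A"
abbreviation "AAA \<equiv> tensor_algebra k A AA"

lemmas ka1 = k_algebra_axioms
lemmas ka2 = k_algebra_tensor[OF ka1 ka1]
lemmas ka3 = k_algebra_tensor[OF ka1 ka2]
lemmas m1 = module_axioms
lemmas m2 = module_tensor[OF m1 m1]
lemmas m3 = module_tensor[OF m1 m2]

sublocale AA: k_algebra k AA by (rule ka2)

lemma lin_comult: "lin k A AA (comult A)"
  using comult_hom unfolding alg_hom_def ring_hom_def lin_def by auto

lemma comult_closed [simp, intro]: "x \<in> carrier A \<Longrightarrow> comult A x \<in> carrier AA"
  by (rule lin_closed[OF lin_comult])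

lemma comult_mult: "\<lbrakk>x \<in> carrier A; y \<in> carrier A\<rbrakk> \<Longrightarrow> comult A (x \<otimes> y) = comult A x \<otimes>\<^bsub>AA\<^esub> comult A y"
  and comult_one: "comult A \<one> = \<one>\<^bsub>AA\<^esub>"
  using comult_hom unfolding alg_hom_def ring_hom_def by auto

lemma lin_counit: "lin k A (self_module k) (counit A)"
  using counit_hom counit_smult unfolding ring_hom_def lin_def self_module_def by auto

lemma counit_closed [simp, intro]: "x \<in> carrier A \<Longrightarrow> counit A x \<in> carrier k"
  using lin_closed[OF lin_counit] by (simp add: self_module_def)

lemma counit_mult: "\<lbrakk>x \<in> carrier A; y \<in> carrier A\<rbrakk> \<Longrightarrow> counit A (x \<otimes> y) = counit A x \<otimes>\<^bsub>k\<^esub> counit A y"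
  and counit_one [simp]: "counit A \<one> = \<one>\<^bsub>k\<^esub>"
  using counit_hom unfolding ring_hom_def by auto

lemma lin_antipode: "lin k A A (antipode A)"
  using antipode_closed antipode_add antipode_smult unfolding lin_def by auto

lemma antipode_in [simp, intro]: "x \<in> carrier A \<Longrightarrow> antipode A x \<in> carrier A"
  using antipode_closed by auto

lemmas lin_rules = bilinI lin_id lin_mult_left[OF ka1] lin_mult_right[OF ka1]
  lin_tens_left[OF m1 m1] lin_tens_right[OF m1 m1] lin_tens_left[OF m1 m2] lin_tens_right[OF m1 m2]
  lin_apply[OF lin_antipode] lin_apply[OF lin_comult] lin_mult_left[OF ka2] lin_mult_right[OF ka2]
  lin_mult_left[OF ka3] lin_mult_right[OF ka3]
  lin_smult_const lin_counit_smult[OF _ lin_counit] lin_tsum_arg[OF m1 m1] lin_tsum_param[OF m1 m1]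

lemmas cl_rules = tens_closed[OF m1 m1] tens_closed[OF m1 m2] tsum_closed[OF m1 m1] m1 m2 m3
  monoid.m_closed[OF ring.is_monoid[OF k_algebra.axioms(3)[OF ka2]]]
  monoid.m_closed[OF ring.is_monoid[OF k_algebra.axioms(3)[OF ka3]]]
  module.smult_closed[OF m2] module.smult_closed[OF m3]

lemmas lins = lin_rules cl_rules

lemma sw_apply:
  assumes "module k M" "module k N" "lin k M N g" "bilin k A A M F" "x \<in> carrier A"
  shows "g (tsum M F (comult A x)) = tsum N (\<lambda>a b. g (F a b)) (comult A x)"
  using tsum_apply[OF m1 m1 assms(1-4) comult_closed[OF assms(5)]] .

lemma tsum_comult_left:
  assumes M: "module k M" and F1: "\<And>a. a \<in> carrier A \<Longrightarrow> bilin k A A M (F a)"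
    and F2: "\<And>b c. \<lbrakk>b \<in> carrier A; c \<in> carrier A\<rbrakk> \<Longrightarrow> lin k A M (\<lambda>a. F a b c)"
    and t: "t \<in> carrier AA"
  shows "tsum M (\<lambda>a u. tsum M (F a) u)
      (tsum AAA (\<lambda>a b. tsum AAA (\<lambda>c d. tens k A AA c (tens k A A d b)) (comult A a)) t)
    = tsum M (\<lambda>a b. tsum M (\<lambda>c d. F c d b) (comult A a)) t"
proof -
  define g where "g = tsum M (\<lambda>a u. tsum M (F a) u)"
  note b = trilin_tsum[OF m1 m1 m1 M F1 F2]
  have g: "lin k AAA M g" unfolding g_def by (rule tsum_lin[OF m1 m2 M b])
  have gt: "g (tens k A AA a (tens k A A b c)) = F a b c"
    if "a \<in> carrier A" "b \<in> carrier A" "c \<in> carrier A" for a b c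
    unfolding g_def using that
    by (simp add: tsum_tens[OF m1 m2 M b] tsum_tens[OF m1 m1 M F1] cl_rules)
  have b3: "bilin k A A AAA (\<lambda>c d. tens k A AA c (tens k A A d b))" if "b \<in> carrier A" for b
    using that by (auto intro!: lins)
  have b2: "bilin k A A AAA (\<lambda>a b. tsum AAA (\<lambda>c d. tens k A AA c (tens k A A d b)) (comult A a))"
    by (auto intro!: lins)
  have "g (tsum AAA (\<lambda>a b. tsum AAA (\<lambda>c d. tens k A AA c (tens k A A d b)) (comult A a)) t)
     = tsum M (\<lambda>a b. g (tsum AAA (\<lambda>c d. tens k A AA c (tens k A A d b)) (comult A a))) t"
    by (rule tsum_apply[OF m1 m1 m3 M g b2 t])
  also have "\<dots> = tsum M (\<lambda>a b. tsum M (\<lambda>c d. F c d b) (comult A a)) t"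
  proof (rule tsum_cong[OF m1 m1 M lin_comp_bilin[OF g b2] t])
    fix a b assume ab: "a \<in> carrier A" "b \<in> carrier A"
    have "g (tsum AAA (\<lambda>c d. tens k A AA c (tens k A A d b)) (comult A a))
      = tsum M (\<lambda>c d. g (tens k A AA c (tens k A A d b))) (comult A a)"
      by (rule sw_apply[OF m3 M g b3[OF ab(2)] ab(1)])
    also have "\<dots> = tsum M (\<lambda>c d. F c d b) (comult A a)"
      by (rule tsum_cong[OF m1 m1 M lin_comp_bilin[OF g b3[OF ab(2)]] comult_closed[OF ab(1)]])
         (simp add: gt ab)
    finally show "g (tsum AAA (\<lambda>c d. tens k A AA c (tens k A A d b)) (comult A a))
        = tsum M (\<lambda>c d. F c d b) (comult A a)" .
  qed
  finally show ?thesis unfolding g_def .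
qed

lemma sw_coassoc:
  assumes M: "module k M" and F1: "\<And>a. a \<in> carrier A \<Longrightarrow> bilin k A A M (F a)"
    and F2: "\<And>b c. \<lbrakk>b \<in> carrier A; c \<in> carrier A\<rbrakk> \<Longrightarrow> lin k A M (\<lambda>a. F a b c)"
    and x: "x \<in> carrier A"
  shows "tsum M (\<lambda>a b. tsum M (\<lambda>c d. F c d b) (comult A a)) (comult A x)
    = tsum M (\<lambda>a b. tsum M (\<lambda>c d. F a c d) (comult A b)) (comult A x)"
proof -
  let ?g = "tsum M (\<lambda>a u. tsum M (F a) u)"
  note b = trilin_tsum[OF m1 m1 m1 M F1 F2]
  have g: "lin k AAA M ?g" by (rule tsum_lin[OF m1 m2 M b])
  have b4: "bilin k A A AAA (\<lambda>a b. tens k A AA a (comult A b))"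
    by (auto intro!: lins)
  have "?g (tsum AAA (\<lambda>a b. tens k A AA a (comult A b)) (comult A x))
     = tsum M (\<lambda>a b. ?g (tens k A AA a (comult A b))) (comult A x)"
    by (rule sw_apply[OF m3 M g b4 x])
  also have "\<dots> = tsum M (\<lambda>a b. tsum M (\<lambda>c d. F a c d) (comult A b)) (comult A x)"
    by (rule tsum_cong[OF m1 m1 M lin_comp_bilin[OF g b4] comult_closed[OF x]])
       (simp add: tsum_tens[OF m1 m2 M b])
  finally show ?thesis
    using coassoc[OF x] tsum_comult_left[OF M F1 F2 comult_closed[OF x]]
    unfolding tensor_lift_tens_grp tensor_map_tsum by simp
qed

lemma sw_counit_left: "x \<in> carrier A \<Longrightarrow> tsum A (\<lambda>a b. counit A a \<odot> b) (comult A x) = x"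
  and sw_counit_right: "x \<in> carrier A \<Longrightarrow> tsum A (\<lambda>a b. counit A b \<odot> a) (comult A x) = x"
  and sw_antipode_left: "x \<in> carrier A \<Longrightarrow> tsum A (\<lambda>a b. antipode A a \<otimes> b) (comult A x)
      = counit A x \<odot> \<one>"
  and sw_antipode_right: "x \<in> carrier A \<Longrightarrow> tsum A (\<lambda>a b. a \<otimes> antipode A b) (comult A x)
      = counit A x \<odot> \<one>"
  unfolding tsum_def by (rule counit_left counit_right antipode_left antipode_right; assumption)+

lemma bilin_counit_left: "module k M \<Longrightarrow> lin k A M f \<Longrightarrow> bilin k A A M (\<lambda>a b. counit A a \<odot>\<^bsub>M\<^esub> f b)"
  by (rule bilin_comp[OF bilin_smult lin_counit])

lemma bilin_counit_right: "module k M \<Longrightarrow> lin k A M f \<Longrightarrow> bilin k A A M (\<lambda>a b. counit A b \<odot>\<^bsub>M\<^esub> f a)"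
  by (rule bilin_flip[OF bilin_counit_left])

lemma sw_counit_left':
  assumes "module k M" "lin k A M f" "x \<in> carrier A"
  shows "tsum M (\<lambda>a b. counit A a \<odot>\<^bsub>M\<^esub> f b) (comult A x) = f x"
proof -
  have "f (tsum A (\<lambda>a b. counit A a \<odot> b) (comult A x))
      = tsum M (\<lambda>a b. f (counit A a \<odot> b)) (comult A x)"
    by (rule sw_apply[OF m1 assms(1,2) bilin_counit_left[OF m1 lin_id] assms(3)])
  also have "\<dots> = tsum M (\<lambda>a b. counit A a \<odot>\<^bsub>M\<^esub> f b) (comult A x)"
    by (rule tsum_cong[OF m1 m1 assms(1)
        lin_comp_bilin[OF assms(2) bilin_counit_left[OF m1 lin_id]] comult_closed[OF assms(3)]])
       (simp add: lin_smult[OF assms(2)])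
  finally show ?thesis using sw_counit_left[OF assms(3)] by simp
qed

lemma sw_counit_right':
  assumes "module k M" "lin k A M f" "x \<in> carrier A"
  shows "tsum M (\<lambda>a b. counit A b \<odot>\<^bsub>M\<^esub> f a) (comult A x) = f x"
proof -
  have "f (tsum A (\<lambda>a b. counit A b \<odot> a) (comult A x))
      = tsum M (\<lambda>a b. f (counit A b \<odot> a)) (comult A x)"
    by (rule sw_apply[OF m1 assms(1,2) bilin_counit_right[OF m1 lin_id] assms(3)])
  also have "\<dots> = tsum M (\<lambda>a b. counit A b \<odot>\<^bsub>M\<^esub> f a) (comult A x)"
    by (rule tsum_cong[OF m1 m1 assms(1)
        lin_comp_bilin[OF assms(2) bilin_counit_right[OF m1 lin_id]] comult_closed[OF assms(3)]])
       (simp add: lin_smult[OF assms(2)])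
  finally show ?thesis using sw_counit_right[OF assms(3)] by simp
qed

lemma conv_inverse_unique:
  assumes M: "k_algebra k M" and f: "lin k A M f" and g: "lin k A M g" and h: "lin k A M h"
    and fg: "\<And>x. x \<in> carrier A \<Longrightarrow> tsum M (\<lambda>a b. f a \<otimes>\<^bsub>M\<^esub> g b) (comult A x) = counit A x \<odot>\<^bsub>M\<^esub> \<one>\<^bsub>M\<^esub>"
    and gh: "\<And>x. x \<in> carrier A \<Longrightarrow> tsum M (\<lambda>a b. g a \<otimes>\<^bsub>M\<^esub> h b) (comult A x) = counit A x \<odot>\<^bsub>M\<^esub> \<one>\<^bsub>M\<^esub>"
    and x: "x \<in> carrier A"
  shows "f x = h x"
proof -
  interpret M: k_algebra k M by fact
  note mM = M.module_axioms
  note fc = lin_closed[OF f] and gc = lin_closed[OF g] and hc = lin_closed[OF h]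
  note bm = bilin_mult[OF M]
  note bgh = bilin_comp[OF bm g h] and bfg = bilin_comp[OF bm f g]
  have *: "bilin k A A M (\<lambda>b c. f a \<otimes>\<^bsub>M\<^esub> (g b \<otimes>\<^bsub>M\<^esub> h c))" if "a \<in> carrier A" for a
    by (rule lin_comp_bilin[OF bilinD1[OF bm fc[OF that]] bgh])
  have **: "lin k A M (\<lambda>a. f a \<otimes>\<^bsub>M\<^esub> (g b \<otimes>\<^bsub>M\<^esub> h c))" if "b \<in> carrier A" "c \<in> carrier A" for b c
    by (rule lin_bilin_left[OF bm f]) (simp add: that gc hc)
  have "f x = tsum M (\<lambda>a b. counit A b \<odot>\<^bsub>M\<^esub> f a) (comult A x)"
    by (rule sw_counit_right'[OF mM f x, symmetric])
  also have "\<dots> = tsum M (\<lambda>a b. tsum M (\<lambda>c d. f a \<otimes>\<^bsub>M\<^esub> (g c \<otimes>\<^bsub>M\<^esub> h d)) (comult A b)) (comult A x)"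
  proof (rule tsum_cong[OF m1 m1 mM bilin_counit_right[OF mM f] comult_closed[OF x]])
    fix a b assume ab: "a \<in> carrier A" "b \<in> carrier A"
    have "tsum M (\<lambda>c d. f a \<otimes>\<^bsub>M\<^esub> (g c \<otimes>\<^bsub>M\<^esub> h d)) (comult A b)
        = f a \<otimes>\<^bsub>M\<^esub> tsum M (\<lambda>c d. g c \<otimes>\<^bsub>M\<^esub> h d) (comult A b)"
      by (rule sw_apply[OF mM mM bilinD1[OF bm fc[OF ab(1)]] bgh ab(2), symmetric])
    then show "counit A b \<odot>\<^bsub>M\<^esub> f a = tsum M (\<lambda>c d. f a \<otimes>\<^bsub>M\<^esub> (g c \<otimes>\<^bsub>M\<^esub> h d)) (comult A b)"
      using ab by (simp add: gh fc M.smult_mult_right)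
  qed
  also have "\<dots> = tsum M (\<lambda>a b. tsum M (\<lambda>c d. f c \<otimes>\<^bsub>M\<^esub> (g d \<otimes>\<^bsub>M\<^esub> h b)) (comult A a)) (comult A x)"
    by (rule sw_coassoc[OF mM * ** x, symmetric])
  also have "\<dots> = tsum M (\<lambda>a b. counit A a \<odot>\<^bsub>M\<^esub> h b) (comult A x)"
  proof (rule tsum_cong[OF m1 m1 mM bilin_counit_left[OF mM h] comult_closed[OF x], symmetric])
    fix a b assume ab: "a \<in> carrier A" "b \<in> carrier A"
    have "tsum M (\<lambda>c d. f c \<otimes>\<^bsub>M\<^esub> (g d \<otimes>\<^bsub>M\<^esub> h b)) (comult A a)
        = tsum M (\<lambda>c d. f c \<otimes>\<^bsub>M\<^esub> g d \<otimes>\<^bsub>M\<^esub> h b) (comult A a)"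
      by (rule tsum_cong[OF m1 m1 mM lin_comp_bilin[OF bilinD2[OF bm hc[OF ab(2)]] bfg]
          comult_closed[OF ab(1)], symmetric])
         (simp add: M.m_assoc fc gc hc ab)
    also have "\<dots> = tsum M (\<lambda>c d. f c \<otimes>\<^bsub>M\<^esub> g d) (comult A a) \<otimes>\<^bsub>M\<^esub> h b"
      by (rule sw_apply[OF mM mM bilinD2[OF bm hc[OF ab(2)]] bfg ab(1), symmetric])
    finally show "counit A a \<odot>\<^bsub>M\<^esub> h b = tsum M (\<lambda>c d. f c \<otimes>\<^bsub>M\<^esub> (g d \<otimes>\<^bsub>M\<^esub> h b)) (comult A a)"
      using ab by (simp add: fg hc M.smult_mult_left)
  qed
  also have "\<dots> = h x" by (rule sw_counit_left'[OF mM h x])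
  finally show ?thesis .
qed

lemma antipode_one: "antipode A \<one> = \<one>"
proof -
  have b: "bilin k A A A (\<lambda>a b. antipode A a \<otimes> b)" by (auto intro!: lins)
  show ?thesis
    using sw_antipode_left[of \<one>] tsum_tens[OF m1 m1 m1 b, of \<one> \<one>]
    by (simp add: comult_one tensor_algebra_simps)
qed

lemmas sw_cong = tsum_cong[OF m1 m1]
lemmas sw_swap = tsum_swap[OF m1 m1 _ m1 m1]

lemma sw_mult:
  assumes "module k M" "bilin k A A M F" "x \<in> carrier A" "y \<in> carrier A"
  shows "tsum M F (comult A (x \<otimes> y)) = tsum M (\<lambda>a b. tsum M (\<lambda>c d. F (a \<otimes> c) (b \<otimes> d)) (comult A y))
      (comult A x)"
  unfolding comult_mult[OF assms(3,4)]
  by (rule tsum_mult[OF ka1 ka1 assms(1,2) comult_closed[OF assms(3)] comult_closed[OF assms(4)]])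

lemma antipode_mult:
  assumes x: "x \<in> carrier A" and y: "y \<in> carrier A"
  shows "antipode A (x \<otimes> y) = antipode A y \<otimes> antipode A x"
proof -
  let ?S = "antipode A" and ?D = "comult A" and ?e = "counit A"
  have K: "tsum A (\<lambda>p q. tsum A (\<lambda>r s. (p \<otimes> r) \<otimes> (?S s \<otimes> ?S q)) (?D d)) (?D b) = ?e b \<odot> (?e d \<odot> \<one>)"
    if b: "b \<in> carrier A" and d: "d \<in> carrier A" for b d
  proof -
    have "tsum A (\<lambda>p q. tsum A (\<lambda>r s. (p \<otimes> r) \<otimes> (?S s \<otimes> ?S q)) (?D d)) (?D b)
        = tsum A (\<lambda>p q. ?e d \<odot> (p \<otimes> ?S q)) (?D b)"
    proof (rule sw_cong[OF m1 _ comult_closed[OF b], symmetric])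
      fix p q assume pq: "p \<in> carrier A" "q \<in> carrier A"
      have "tsum A (\<lambda>r s. (p \<otimes> r) \<otimes> (?S s \<otimes> ?S q)) (?D d)
          = tsum A (\<lambda>r s. p \<otimes> (r \<otimes> ?S s) \<otimes> ?S q) (?D d)"
        by (rule sw_cong[OF m1 _ comult_closed[OF d]]) (use pq in \<open>auto intro!: lins simp: m_assoc\<close>)
      also have "\<dots> = p \<otimes> tsum A (\<lambda>r s. r \<otimes> ?S s) (?D d) \<otimes> ?S q"
        by (rule sw_apply[OF m1 m1 _ _ d, symmetric]) (use pq in \<open>auto intro!: lins\<close>)
      finally show "?e d \<odot> (p \<otimes> ?S q) = tsum A (\<lambda>r s. (p \<otimes> r) \<otimes> (?S s \<otimes> ?S q)) (?D d)"
        using pq d by (simp add: sw_antipode_right smult_mult_left smult_mult_right)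
    qed (use d in \<open>auto intro!: lins\<close>)
    also have "\<dots> = ?e d \<odot> tsum A (\<lambda>p q. p \<otimes> ?S q) (?D b)"
      by (rule sw_apply[OF m1 m1 _ _ b, symmetric]) (use d in \<open>auto intro!: lins\<close>)
    also have "\<dots> = ?e b \<odot> (?e d \<odot> \<one>)"
      using b d by (simp add: sw_antipode_right k.m_comm flip: smult_assoc1)
    finally show ?thesis .
  qed
  let ?G = "\<lambda>a p q c r s. ?S (a \<otimes> c) \<otimes> ((p \<otimes> r) \<otimes> (?S s \<otimes> ?S q))"
  have "?S (x \<otimes> y) = tsum A (\<lambda>a b. ?e b \<odot> ?S (a \<otimes> y)) (?D x)"
    by (rule sw_counit_right'[OF m1 _ x, symmetric]) (use y in \<open>auto intro!: lins\<close>)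
  also have "\<dots> = tsum A (\<lambda>a b. tsum A (\<lambda>c d. tsum A (\<lambda>p q. tsum A (\<lambda>r s. ?G a p q c r s) (?D d))
      (?D b)) (?D y)) (?D x)"
  proof (rule sw_cong[OF m1 _ comult_closed[OF x]])
    fix a b assume ab: "a \<in> carrier A" "b \<in> carrier A"
    have "?e b \<odot> ?S (a \<otimes> y) = tsum A (\<lambda>c d. ?e d \<odot> (?e b \<odot> ?S (a \<otimes> c))) (?D y)"
      by (rule sw_counit_right'[OF m1 _ y, symmetric]) (use ab in \<open>auto intro!: lins\<close>)
    also have "\<dots> = tsum A (\<lambda>c d. tsum A (\<lambda>p q. tsum A (\<lambda>r s. ?G a p q c r s) (?D d)) (?D b)) (?D y)"
    proof (rule sw_cong[OF m1 _ comult_closed[OF y]])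
      fix c d assume cd: "c \<in> carrier A" "d \<in> carrier A"
      have "tsum A (\<lambda>p q. tsum A (\<lambda>r s. ?G a p q c r s) (?D d)) (?D b)
          = tsum A (\<lambda>p q. ?S (a \<otimes> c) \<otimes> tsum A (\<lambda>r s. (p \<otimes> r) \<otimes> (?S s \<otimes> ?S q)) (?D d)) (?D b)"
        by (rule sw_cong[OF m1 _ comult_closed[OF ab(2)]], use ab cd in \<open>auto intro!: lins\<close>)
           (rule sw_apply[OF m1 m1 _ _ cd(2), symmetric], use ab cd in \<open>auto intro!: lins\<close>)
      also have "\<dots> = ?S (a \<otimes> c) \<otimes> tsum A (\<lambda>p q. tsum A (\<lambda>r s. (p \<otimes> r) \<otimes> (?S s \<otimes> ?S q)) (?D d))
          (?D b)"
        by (rule sw_apply[OF m1 m1 _ _ ab(2), symmetric], use ab cd in \<open>auto intro!: lins\<close>)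
      finally show "?e d \<odot> (?e b \<odot> ?S (a \<otimes> c))
          = tsum A (\<lambda>p q. tsum A (\<lambda>r s. ?G a p q c r s) (?D d)) (?D b)"
        using ab cd by (simp add: K smult_mult_right k.m_comm flip: smult_assoc1)
    qed (use ab in \<open>auto intro!: lins\<close>)
    finally show "?e b \<odot> ?S (a \<otimes> y) = tsum A
        (\<lambda>c d. tsum A (\<lambda>p q. tsum A (\<lambda>r s. ?G a p q c r s) (?D d)) (?D b)) (?D y)" .
  qed (use y in \<open>auto intro!: lins\<close>)
  also have "\<dots> = tsum A (\<lambda>a b. tsum A (\<lambda>p q. tsum A (\<lambda>c d. tsum A (\<lambda>r s. ?G a p q r s d) (?D c))
      (?D y)) (?D b)) (?D x)"
  proof (rule sw_cong[OF m1 _ comult_closed[OF x]])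
    fix a b assume ab: "a \<in> carrier A" "b \<in> carrier A"
    have "tsum A (\<lambda>c d. tsum A (\<lambda>p q. tsum A (\<lambda>r s. ?G a p q c r s) (?D d)) (?D b)) (?D y)
        = tsum A (\<lambda>p q. tsum A (\<lambda>c d. tsum A (\<lambda>r s. ?G a p q c r s) (?D d)) (?D y)) (?D b)"
      by (rule sw_swap[OF m1]) (use ab y in \<open>auto intro!: lins\<close>)
    also have "\<dots> = tsum A (\<lambda>p q. tsum A (\<lambda>c d. tsum A (\<lambda>r s. ?G a p q r s d) (?D c)) (?D y)) (?D b)"
    proof (rule sw_cong[OF m1 _ comult_closed[OF ab(2)]])
      fix p q assume pq: "p \<in> carrier A" "q \<in> carrier A"
      show "tsum A (\<lambda>c d. tsum A (\<lambda>r s. ?G a p q c r s) (?D d)) (?D y)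
          = tsum A (\<lambda>c d. tsum A (\<lambda>r s. ?G a p q r s d) (?D c)) (?D y)"
        by (rule sw_coassoc[OF m1 _ _ y, symmetric]) (use ab pq in \<open>auto intro!: lins\<close>)
    qed (use ab y in \<open>auto intro!: lins\<close>)
    finally show "tsum A (\<lambda>c d. tsum A (\<lambda>p q. tsum A (\<lambda>r s. ?G a p q c r s) (?D d)) (?D b)) (?D y)
      = tsum A (\<lambda>p q. tsum A (\<lambda>c d. tsum A (\<lambda>r s. ?G a p q r s d) (?D c)) (?D y)) (?D b)" .
  qed (use y in \<open>auto intro!: lins\<close>)
  also have "\<dots> = tsum A (\<lambda>a b. tsum A (\<lambda>p q. tsum A (\<lambda>c d. tsum A (\<lambda>r s. ?G p q b r s d) (?D c))
      (?D y)) (?D a)) (?D x)"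
    by (rule sw_coassoc[OF m1 _ _ x, symmetric]) (use y in \<open>auto intro!: lins\<close>)
  also have "\<dots> = tsum A (\<lambda>a b. ?e a \<odot> (?S y \<otimes> ?S b)) (?D x)"
  proof (rule sw_cong[OF m1 _ comult_closed[OF x]])
    fix a b assume ab: "a \<in> carrier A" "b \<in> carrier A"
    have "tsum A (\<lambda>p q. tsum A (\<lambda>c d. tsum A (\<lambda>r s. ?G p q b r s d) (?D c)) (?D y)) (?D a)
        = tsum A (\<lambda>c d. tsum A (\<lambda>p q. tsum A (\<lambda>r s. ?G p q b r s d) (?D c)) (?D a)) (?D y)"
      by (rule sw_swap[OF m1]) (use ab y in \<open>auto intro!: lins\<close>)
    also have "\<dots> = tsum A (\<lambda>c d. ?e c \<odot> (?e a \<odot> (?S d \<otimes> ?S b))) (?D y)"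
    proof (rule sw_cong[OF m1 _ comult_closed[OF y]])
      fix c d assume cd: "c \<in> carrier A" "d \<in> carrier A"
      have "tsum A (\<lambda>p q. tsum A (\<lambda>r s. ?G p q b r s d) (?D c)) (?D a)
          = tsum A (\<lambda>u v. ?S u \<otimes> (v \<otimes> (?S d \<otimes> ?S b))) (?D (a \<otimes> c))"
        by (rule sw_mult[OF m1 _ ab(1) cd(1), symmetric]) (use ab cd in \<open>auto intro!: lins\<close>)
      also have "\<dots> = tsum A (\<lambda>u v. ?S u \<otimes> v \<otimes> (?S d \<otimes> ?S b)) (?D (a \<otimes> c))"
        by (rule sw_cong[OF m1]) (use ab cd in \<open>auto intro!: lins simp: m_assoc\<close>)
      also have "\<dots> = tsum A (\<lambda>u v. ?S u \<otimes> v) (?D (a \<otimes> c)) \<otimes> (?S d \<otimes> ?S b)"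
        by (rule sw_apply[OF m1 m1, symmetric]) (use ab cd in \<open>auto intro!: lins\<close>)
      also have "\<dots> = ?e c \<odot> (?e a \<odot> (?S d \<otimes> ?S b))"
        using ab cd by (simp add: sw_antipode_left counit_mult smult_mult_left k.m_comm flip:
            smult_assoc1)
      finally show "tsum A (\<lambda>p q. tsum A (\<lambda>r s. ?G p q b r s d) (?D c)) (?D a)
          = ?e c \<odot> (?e a \<odot> (?S d \<otimes> ?S b))" .
    qed (use ab in \<open>auto intro!: lins\<close>)
    also have "\<dots> = ?e a \<odot> (?S y \<otimes> ?S b)"
      by (rule sw_counit_left'[OF m1 _ y]) (use ab in \<open>auto intro!: lins\<close>)
    finally show "tsum A (\<lambda>p q. tsum A (\<lambda>c d. tsum A (\<lambda>r s. ?G p q b r s d) (?D c)) (?D y)) (?D a)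
       = ?e a \<odot> (?S y \<otimes> ?S b)" .
  qed (use y in \<open>auto intro!: lins\<close>)
  also have "\<dots> = ?S y \<otimes> ?S x"
    by (rule sw_counit_left'[OF m1 _ x]) (use y in \<open>auto intro!: lins\<close>)
  finally show ?thesis .
qed

lemma sw_antipode_telescope:
  assumes g: "lin k A A g" and x: "x \<in> carrier A"
    and gS: "\<And>x. x \<in> carrier A \<Longrightarrow> tsum A (\<lambda>a b. g a \<otimes> antipode A (g b)) (comult A x)
        = counit A x \<odot> \<one>"
  shows "tsum AA (\<lambda>a b. tsum AA (\<lambda>p q. tens k A A p (g q)) (comult A a) \<otimes>\<^bsub>AA\<^esub>
      tsum AA (\<lambda>c d. tens k A A (antipode A (g d)) (antipode A (g c))) (comult A b)) (comult A x)
    = tens k A A (tsum A (\<lambda>a b. a \<otimes> antipode A (g b)) (comult A x)) \<one>"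
proof -
  let ?S = "antipode A" and ?D = "comult A" and ?e = "counit A"
  note lr = lin_rules lin_apply[OF g]
  note gc = lin_closed[OF g]
  let ?s = "\<lambda>a. tsum AA (\<lambda>p q. tens k A A p (g q)) (?D a)"
  let ?t = "\<lambda>b. tsum AA (\<lambda>c d. tens k A A (?S (g d)) (?S (g c))) (?D b)"
  have "tsum AA (\<lambda>a b. ?s a \<otimes>\<^bsub>AA\<^esub> ?t b) (?D x)
     = tsum AA (\<lambda>a b. tsum AA (\<lambda>p q. tsum AA (\<lambda>c d.
         tens k A A (p \<otimes> ?S (g d)) (g q \<otimes> ?S (g c))) (?D b)) (?D a)) (?D x)"
  proof (rule sw_cong[OF m2 _ comult_closed[OF x]])
    fix a b assume ab: "a \<in> carrier A" "b \<in> carrier A"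
    have "?s a \<otimes>\<^bsub>AA\<^esub> ?t b = tsum AA (\<lambda>p q. tens k A A p (g q) \<otimes>\<^bsub>AA\<^esub> ?t b) (?D a)"
      by (rule sw_apply[OF m2 m2 _ _ ab(1)]) (use ab in \<open>auto intro!: lr cl_rules simp: gc\<close>)
    also have "\<dots> = tsum AA (\<lambda>p q. tsum AA (\<lambda>c d.
        tens k A A (p \<otimes> ?S (g d)) (g q \<otimes> ?S (g c))) (?D b)) (?D a)"
    proof (rule sw_cong[OF m2 _ comult_closed[OF ab(1)]])
      fix p q assume pq: "p \<in> carrier A" "q \<in> carrier A"
      have "tens k A A p (g q) \<otimes>\<^bsub>AA\<^esub> ?t b
          = tsum AA (\<lambda>c d. tens k A A p (g q) \<otimes>\<^bsub>AA\<^esub> tens k A A (?S (g d)) (?S (g c))) (?D b)"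
        by (rule sw_apply[OF m2 m2 _ _ ab(2)]) (use ab pq in \<open>auto intro!: lr cl_rules simp: gc\<close>)
      also have "\<dots> = tsum AA (\<lambda>c d. tens k A A (p \<otimes> ?S (g d)) (g q \<otimes> ?S (g c))) (?D b)"
        by (rule sw_cong[OF m2 _ comult_closed[OF ab(2)]])
           (use ab pq in \<open>auto intro!: lr cl_rules simp: gc mult_tens[OF ka1 ka1]\<close>)
      finally show "tens k A A p (g q) \<otimes>\<^bsub>AA\<^esub> ?t b
          = tsum AA (\<lambda>c d. tens k A A (p \<otimes> ?S (g d)) (g q \<otimes> ?S (g c))) (?D b)" .
    qed (use ab in \<open>auto intro!: lr cl_rules simp: gc\<close>)
    finally show "?s a \<otimes>\<^bsub>AA\<^esub> ?t b = tsum AA (\<lambda>p q. tsum AA (\<lambda>c d.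
        tens k A A (p \<otimes> ?S (g d)) (g q \<otimes> ?S (g c))) (?D b)) (?D a)" .
  qed (auto intro!: lr cl_rules simp: gc)
  also have "\<dots> = tsum AA (\<lambda>a b. tsum AA (\<lambda>p q. tsum AA (\<lambda>c d.
      tens k A A (a \<otimes> ?S (g d)) (g p \<otimes> ?S (g c))) (?D q)) (?D b)) (?D x)"
    by (rule sw_coassoc[OF m2 _ _ x]) (auto intro!: lr cl_rules simp: gc)
  also have "\<dots> = tsum AA (\<lambda>a b. tens k A A (a \<otimes> ?S (g b)) \<one>) (?D x)"
  proof (rule sw_cong[OF m2 _ comult_closed[OF x]])
    fix a b assume ab: "a \<in> carrier A" "b \<in> carrier A"
    have "tsum AA (\<lambda>p q. tsum AA (\<lambda>c d. tens k A A (a \<otimes> ?S (g d)) (g p \<otimes> ?S (g c))) (?D q)) (?D b)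
        = tsum AA (\<lambda>p q. tsum AA (\<lambda>c d. tens k A A (a \<otimes> ?S (g q)) (g c \<otimes> ?S (g d))) (?D p)) (?D b)"
      by (rule sw_coassoc[OF m2 _ _ ab(2), symmetric])
          (use ab in \<open>auto intro!: lr cl_rules simp: gc\<close>)
    also have "\<dots> = tsum AA (\<lambda>p q. ?e p \<odot>\<^bsub>AA\<^esub> tens k A A (a \<otimes> ?S (g q)) \<one>) (?D b)"
    proof (rule sw_cong[OF m2 _ comult_closed[OF ab(2)]])
      fix p q assume pq: "p \<in> carrier A" "q \<in> carrier A"
      have "tsum AA (\<lambda>c d. tens k A A (a \<otimes> ?S (g q)) (g c \<otimes> ?S (g d))) (?D p)
          = tens k A A (a \<otimes> ?S (g q)) (tsum A (\<lambda>c d. g c \<otimes> ?S (g d)) (?D p))"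
        by (rule sw_apply[OF m1 m2 _ _ pq(1), symmetric])
            (use ab pq in \<open>auto intro!: lr cl_rules simp: gc\<close>)
      then show "tsum AA (\<lambda>c d. tens k A A (a \<otimes> ?S (g q)) (g c \<otimes> ?S (g d))) (?D p)
          = ?e p \<odot>\<^bsub>AA\<^esub> tens k A A (a \<otimes> ?S (g q)) \<one>"
        using ab pq by (simp add: gS gc lin_smult[OF bilinD1[OF bilin_tens[OF m1 m1]]])
    qed (use ab in \<open>auto intro!: lr cl_rules simp: gc\<close>)
    also have "\<dots> = tens k A A (a \<otimes> ?S (g b)) \<one>"
      by (rule sw_counit_left'[OF m2 _ ab(2)]) (use ab in \<open>auto intro!: lr cl_rules simp: gc\<close>)
    finally show "tsum AA (\<lambda>p q. tsum AA (\<lambda>c d.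
        tens k A A (a \<otimes> ?S (g d)) (g p \<otimes> ?S (g c))) (?D q)) (?D b) = tens k A A (a \<otimes> ?S (g b)) \<one>" .
  qed (auto intro!: lr cl_rules simp: gc)
  also have "\<dots> = tens k A A (tsum A (\<lambda>a b. a \<otimes> ?S (g b)) (?D x)) \<one>"
    by (rule sw_apply[OF m1 m2 _ _ x, symmetric]) (auto intro!: lr cl_rules simp: gc)
  finally show ?thesis .
qed

lemma comult_antipode:
  assumes x: "x \<in> carrier A"
  shows "comult A (antipode A x) = tsum AA (\<lambda>a b. tens k A A (antipode A b) (antipode A a))
      (comult A x)"
proof (rule conv_inverse_unique[OF ka2 lin_apply[OF lin_comult lin_antipode] lin_comult _ _ _ x])
  let ?S = "antipode A" and ?D = "comult A" and ?e = "counit A"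
  show "lin k A AA (\<lambda>x. tsum AA (\<lambda>a b. tens k A A (?S b) (?S a)) (?D x))"
    by (auto intro!: lins)
  fix x assume x: "x \<in> carrier A"
  have "tsum AA (\<lambda>a b. ?D (?S a) \<otimes>\<^bsub>AA\<^esub> ?D b) (?D x) = tsum AA (\<lambda>a b. ?D (?S a \<otimes> b)) (?D x)"
    by (rule sw_cong[OF m2]) (use x in \<open>auto intro!: lins simp: comult_mult\<close>)
  also have "\<dots> = ?D (tsum A (\<lambda>a b. ?S a \<otimes> b) (?D x))"
    by (rule sw_apply[OF m1 m2 _ _ x, symmetric]) (auto intro!: lins)
  finally show "tsum AA (\<lambda>a b. ?D (?S a) \<otimes>\<^bsub>AA\<^esub> ?D b) (?D x) = ?e x \<odot>\<^bsub>AA\<^esub> \<one>\<^bsub>AA\<^esub>"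
    using x by (simp add: sw_antipode_left lin_smult[OF lin_comult] comult_one)
  let ?t = "\<lambda>b. tsum AA (\<lambda>c d. tens k A A (?S d) (?S c)) (?D b)"
  have "tsum AA (\<lambda>a b. ?D a \<otimes>\<^bsub>AA\<^esub> ?t b) (?D x)
     = tsum AA (\<lambda>a b. tsum AA (tens k A A) (?D a) \<otimes>\<^bsub>AA\<^esub> ?t b) (?D x)"
    by (rule sw_cong[OF m2 _ comult_closed[OF x]])
       ((auto intro!: lins)[1], simp add: tsum_tens_self[OF m1 m1])
  also have "\<dots> = tens k A A (tsum A (\<lambda>a b. a \<otimes> ?S b) (?D x)) \<one>"
    by (rule sw_antipode_telescope[OF lin_id x sw_antipode_right])
  finally show "tsum AA (\<lambda>a b. ?D a \<otimes>\<^bsub>AA\<^esub> ?t b) (?D x) = ?e x \<odot>\<^bsub>AA\<^esub> \<one>\<^bsub>AA\<^esub>"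
    using x by (simp add: sw_antipode_right lin_smult[OF bilinD2[OF bilin_tens[OF m1 m1]]]
        tensor_algebra_simps)
qed

end

section \<open>The universal R-matrix\<close>

context qt_hopf_algebra
begin

lemma rmat_closed [simp, intro]: "rmat A \<in> carrier AA"
  using rmat_unit by (rule AA.Units_closed)

lemma sw_rmat_comult:
  assumes M: "module k M" and F1: "\<And>a. a \<in> carrier A \<Longrightarrow> bilin k A A M (F a)"
    and F2: "\<And>b c. \<lbrakk>b \<in> carrier A; c \<in> carrier A\<rbrakk> \<Longrightarrow> lin k A M (\<lambda>a. F a b c)"
  shows "tsum M (\<lambda>x y. tsum M (\<lambda>a b. F a b y) (comult A x)) (rmat A)
    = tsum M (\<lambda>x y. tsum M (\<lambda>a b. F x a (y \<otimes> b)) (rmat A)) (rmat A)"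
proof -
  define g where "g = tsum M (\<lambda>a u. tsum M (F a) u)"
  note b = trilin_tsum[OF m1 m1 m1 M F1 F2]
  have b5: "bilin k A AA M (\<lambda>a u. tsum M (F a) (u \<otimes>\<^bsub>AA\<^esub> rmat A))"
    by (rule bilin_comp[OF b lin_id lin_mult_left[OF ka2 lin_id rmat_closed]])
  have b6: "bilin k A A AAA (\<lambda>x y. tens k A AA x (tens k A A \<one> y))"
    by (auto intro!: lins)
  have R13: "R13 k A = tsum AAA (\<lambda>x y. tens k A AA x (tens k A A \<one> y)) (rmat A)"
    unfolding R13_def tensor_lift_tens_grp ..
  have R13c: "R13 k A \<in> carrier AAA"
    unfolding R13 by (rule tsum_closed[OF m1 m1 m3 b6 rmat_closed])
  have R23c: "R23 k A \<in> carrier AAA"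
    unfolding R23_def by (simp add: cl_rules)
  have in1: "bilin k A AA M (\<lambda>c v. tsum M (F (a \<otimes> c)) (u \<otimes>\<^bsub>AA\<^esub> v))"
      if "a \<in> carrier A" "u \<in> carrier AA" for a u
    by (rule bilin_comp[OF b lin_mult_right[OF ka1 lin_id that(1)]
        lin_mult_right[OF ka2 lin_id that(2)]])
  have "g (R13 k A \<otimes>\<^bsub>AAA\<^esub> R23 k A) = tsum M
      (\<lambda>a u. tsum M (\<lambda>c v. tsum M (F (a \<otimes> c)) (u \<otimes>\<^bsub>AA\<^esub> v)) (R23 k A)) (R13 k A)"
    unfolding g_def by (rule tsum_mult[OF ka1 ka2 M b R13c R23c])
  also have "\<dots> = tsum M (\<lambda>a u. tsum M (F a) (u \<otimes>\<^bsub>AA\<^esub> rmat A)) (R13 k A)"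
    by (rule tsum_cong[OF m1 m2 M b5 R13c, symmetric])
       (simp add: R23_def tsum_tens[OF m1 m2 M in1])
  also have "\<dots> = tsum M (\<lambda>x y. tsum M (\<lambda>a u. tsum M (F a) (u \<otimes>\<^bsub>AA\<^esub> rmat A))
      (tens k A AA x (tens k A A \<one> y))) (rmat A)"
    unfolding R13 by (rule tsum_apply[OF m1 m1 m3 M tsum_lin[OF m1 m2 M b5] b6 rmat_closed])
  also have "\<dots> = tsum M (\<lambda>x y. tsum M (\<lambda>a b. F x a (y \<otimes> b)) (rmat A)) (rmat A)"
  proof (rule sw_cong[OF M lin_comp_bilin[OF tsum_lin[OF m1 m2 M b5] b6] rmat_closed])
    fix x y assume xy: "x \<in> carrier A" "y \<in> carrier A"
    have i: "bilin k A A M (\<lambda>c d. F x (a \<otimes> c) (b \<otimes> d))" if "a \<in> carrier A" "b \<in> carrier A" for a b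
      by (rule bilin_comp[OF F1[OF xy(1)] lin_mult_right[OF ka1 lin_id that(1)]
          lin_mult_right[OF ka1 lin_id that(2)]])
    have i': "bilin k A A M (\<lambda>a b. F x (a \<otimes> c) (b \<otimes> d))" if "c \<in> carrier A" "d \<in> carrier A" for c d
      by (rule bilin_comp[OF F1[OF xy(1)] lin_mult_left[OF ka1 lin_id that(1)]
          lin_mult_left[OF ka1 lin_id that(2)]])
    have ii: "bilin k A A M (\<lambda>a b. tsum M (\<lambda>c d. F x (a \<otimes> c) (b \<otimes> d)) (rmat A))"
      by (rule bilin_tsum_param[OF m1 m1 M m1 m1 rmat_closed i' i])
    have "tsum M (\<lambda>a u. tsum M (F a) (u \<otimes>\<^bsub>AA\<^esub> rmat A)) (tens k A AA x (tens k A A \<one> y))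
       = tsum M (F x) (tens k A A \<one> y \<otimes>\<^bsub>AA\<^esub> rmat A)"
      using xy by (simp add: tsum_tens[OF m1 m2 M b5] cl_rules)
    also have "\<dots> = tsum M (\<lambda>a b. tsum M (\<lambda>c d. F x (a \<otimes> c) (b \<otimes> d)) (rmat A)) (tens k A A \<one> y)"
      by (rule tsum_mult[OF ka1 ka1 M F1[OF xy(1)] _ rmat_closed]) (simp add: cl_rules xy)
    also have "\<dots> = tsum M (\<lambda>c d. F x (\<one> \<otimes> c) (y \<otimes> d)) (rmat A)"
      using xy by (simp add: tsum_tens[OF m1 m1 M ii])
    also have "\<dots> = tsum M (\<lambda>a b. F x a (y \<otimes> b)) (rmat A)"
      by (rule sw_cong[OF M i rmat_closed]) (simp_all add: xy)
    finally show "tsum M (\<lambda>a u. tsum M (F a) (u \<otimes>\<^bsub>AA\<^esub> rmat A)) (tens k A AA x (tens k A A \<one> y))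
      = tsum M (\<lambda>a b. F x a (y \<otimes> b)) (rmat A)" .
  qed
  finally have 2: "g (R13 k A \<otimes>\<^bsub>AAA\<^esub> R23 k A) = tsum M (\<lambda>x y. tsum M (\<lambda>a b. F x a (y \<otimes> b)) (rmat A))
      (rmat A)" .
  show ?thesis
    using rmat_comult_id tsum_comult_left[OF M F1 F2 rmat_closed] 2
    unfolding tensor_lift_tens_grp g_def by simp
qed

lemma rmat_counit_left: "tsum A (\<lambda>x y. counit A x \<odot> y) (rmat A) = \<one>"
proof -
  let ?R = "rmat A" and ?e = "counit A"
  let ?u = "tsum A (\<lambda>x y. ?e x \<odot> y) ?R"
  have bu: "bilin k A A A (\<lambda>x y. ?e x \<odot> y)" by (rule bilin_counit_left[OF m1 lin_id])
  have u: "?u \<in> carrier A" by (rule tsum_closed[OF m1 m1 m1 bu rmat_closed])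
  have "?R = tsum AA (\<lambda>x y. tens k A A x y) ?R"
    by (simp add: tsum_tens_self[OF m1 m1])
  also have "\<dots> = tsum AA (\<lambda>x y. tsum AA (\<lambda>a b. ?e a \<odot>\<^bsub>AA\<^esub> tens k A A b y) (comult A x)) ?R"
    by (rule sw_cong[OF m2 bilin_tens[OF m1 m1] rmat_closed])
       (rule sw_counit_left'[OF m2, symmetric], auto intro!: lins)
  also have "\<dots> = tsum AA (\<lambda>x y. tsum AA (\<lambda>a b. ?e x \<odot>\<^bsub>AA\<^esub> tens k A A a (y \<otimes> b)) ?R) ?R"
    by (rule sw_rmat_comult[OF m2]) (auto intro!: lins)
  also have "\<dots> = tsum AA (\<lambda>x y. tens k A A \<one> (?e x \<odot> y) \<otimes>\<^bsub>AA\<^esub> ?R) ?R"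
  proof (rule sw_cong[OF m2 _ rmat_closed, symmetric])
    show "bilin k A A AA (\<lambda>x y. tens k A A \<one> (?e x \<odot> y) \<otimes>\<^bsub>AA\<^esub> ?R)"
      by (rule lin_comp_bilin[OF _ bu]) (auto intro!: lins)
    fix x y assume xy: "x \<in> carrier A" "y \<in> carrier A"
    have "tens k A A \<one> (?e x \<odot> y) \<otimes>\<^bsub>AA\<^esub> ?R = tens k A A \<one> (?e x \<odot> y) \<otimes>\<^bsub>AA\<^esub> tsum AA (tens k A A) ?R"
      by (simp add: tsum_tens_self[OF m1 m1])
    also have "\<dots> = tsum AA (\<lambda>a b. tens k A A \<one> (?e x \<odot> y) \<otimes>\<^bsub>AA\<^esub> tens k A A a b) ?R"
      by (rule tsum_apply[OF m1 m1 m2 m2 _ bilin_tens[OF m1 m1] rmat_closed])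
          (use xy in \<open>auto intro!: lins\<close>)
    also have "\<dots> = tsum AA (\<lambda>a b. ?e x \<odot>\<^bsub>AA\<^esub> tens k A A a (y \<otimes> b)) ?R"
      by (rule sw_cong[OF m2 _ rmat_closed])
        (use xy in \<open>auto intro!: lins simp: mult_tens[OF ka1 ka1] AA.smult_mult_left
            tens_closed[OF m1 m1]
           lin_smult[OF bilinD1[OF bilin_tens[OF m1 m1]]]\<close>)
    finally show "tens k A A \<one> (?e x \<odot> y) \<otimes>\<^bsub>AA\<^esub> ?R
        = tsum AA (\<lambda>a b. ?e x \<odot>\<^bsub>AA\<^esub> tens k A A a (y \<otimes> b)) ?R" .
  qed
  also have "\<dots> = tens k A A \<one> ?u \<otimes>\<^bsub>AA\<^esub> ?R"
    by (rule tsum_apply[OF m1 m1 m1 m2 _ bu rmat_closed, symmetric]) (auto intro!: lins)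
  finally have "\<one>\<^bsub>AA\<^esub> \<otimes>\<^bsub>AA\<^esub> ?R = tens k A A \<one> ?u \<otimes>\<^bsub>AA\<^esub> ?R" by simp
  then have "\<one>\<^bsub>AA\<^esub> \<otimes>\<^bsub>AA\<^esub> ?R \<otimes>\<^bsub>AA\<^esub> inv\<^bsub>AA\<^esub> ?R = tens k A A \<one> ?u \<otimes>\<^bsub>AA\<^esub> ?R \<otimes>\<^bsub>AA\<^esub> inv\<^bsub>AA\<^esub> ?R" by simp
  then have "\<one>\<^bsub>AA\<^esub> = tens k A A \<one> ?u"
    using rmat_unit u by (simp add: AA.m_assoc tens_closed[OF m1 m1])
  then have "tsum A (\<lambda>x y. ?e x \<odot> y) (tens k A A \<one> \<one>) = tsum A (\<lambda>x y. ?e x \<odot> y) (tens k A A \<one> ?u)"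
    by (simp add: tensor_algebra_simps)
  then show ?thesis using u by (simp add: tsum_tens[OF m1 m1 m1 bu])
qed

definition rmat_inv :: "('a, 'a) tensor" where
  "rmat_inv = tensor_map k A A (antipode A) (\<lambda>y. y) (rmat A)"

lemma rmat_inv_closed: "rmat_inv \<in> carrier AA"
  unfolding rmat_inv_def by (rule lin_closed[OF lin_tensor_map[OF m1 m1 m1 m1 lin_antipode lin_id]
      rmat_closed])

lemma rmat_mult_inv: "rmat A \<otimes>\<^bsub>AA\<^esub> rmat_inv = \<one>\<^bsub>AA\<^esub>"
proof -
  let ?R = "rmat A" and ?e = "counit A" and ?S = "antipode A"
  have bu: "bilin k A A A (\<lambda>x y. ?e x \<odot> y)" by (rule bilin_counit_left[OF m1 lin_id])
  have bb: "bilin k A A AA (\<lambda>x y. tens k A A (?e x \<odot> \<one>) y)" by (auto intro!: lins)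
  have "rmat A \<otimes>\<^bsub>AA\<^esub> rmat_inv = tsum AA (\<lambda>x y. tens k A A x y) ?R \<otimes>\<^bsub>AA\<^esub> rmat_inv"
    by (simp add: tsum_tens_self[OF m1 m1])
  also have "\<dots> = tsum AA (\<lambda>x y. tens k A A x y \<otimes>\<^bsub>AA\<^esub> rmat_inv) ?R"
    by (rule tsum_apply[OF m1 m1 m2 m2 _ bilin_tens[OF m1 m1] rmat_closed])
        (auto intro!: lins rmat_inv_closed)
  also have "\<dots> = tsum AA (\<lambda>x y. tsum AA (\<lambda>a b. tens k A A (x \<otimes> ?S a) (y \<otimes> b)) ?R) ?R"
  proof (rule sw_cong[OF m2 _ rmat_closed])
    fix x y assume xy: "x \<in> carrier A" "y \<in> carrier A"
    have "tens k A A x y \<otimes>\<^bsub>AA\<^esub> rmat_inv = tsum AA (\<lambda>a b. tens k A A x y \<otimes>\<^bsub>AA\<^esub> tens k A A (?S a) b) ?R"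
      unfolding rmat_inv_def tensor_map_tsum
      by (rule tsum_apply[OF m1 m1 m2 m2 _ _ rmat_closed]) (use xy in \<open>auto intro!: lins\<close>)
    also have "\<dots> = tsum AA (\<lambda>a b. tens k A A (x \<otimes> ?S a) (y \<otimes> b)) ?R"
      by (rule sw_cong[OF m2 _ rmat_closed])
         (use xy in \<open>auto intro!: lins simp: mult_tens[OF ka1 ka1]\<close>)
    finally show "tens k A A x y \<otimes>\<^bsub>AA\<^esub> rmat_inv = tsum AA (\<lambda>a b. tens k A A (x \<otimes> ?S a) (y \<otimes> b)) ?R" .
  qed (auto intro!: lins rmat_inv_closed)
  also have "\<dots> = tsum AA (\<lambda>x y. tsum AA (\<lambda>a b. tens k A A (a \<otimes> ?S b) y) (comult A x)) ?R"
    by (rule sw_rmat_comult[OF m2, symmetric]) (auto intro!: lins)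
  also have "\<dots> = tsum AA (\<lambda>x y. tens k A A (?e x \<odot> \<one>) y) ?R"
  proof (rule sw_cong[OF m2 bb rmat_closed, symmetric])
    fix x y assume xy: "x \<in> carrier A" "y \<in> carrier A"
    have "tsum AA (\<lambda>a b. tens k A A (a \<otimes> ?S b) y) (comult A x)
        = tens k A A (tsum A (\<lambda>a b. a \<otimes> ?S b) (comult A x)) y"
      by (rule sw_apply[OF m1 m2 _ _ xy(1), symmetric]) (use xy in \<open>auto intro!: lins\<close>)
    then show "tens k A A (?e x \<odot> \<one>) y = tsum AA (\<lambda>a b. tens k A A (a \<otimes> ?S b) y) (comult A x)"
      using xy by (simp add: sw_antipode_right)
  qed
  also have "\<dots> = tsum AA (\<lambda>x y. tens k A A \<one> (?e x \<odot> y)) ?R"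
    by (rule sw_cong[OF m2 bb rmat_closed])
       (simp add: lin_smult[OF bilinD2[OF bilin_tens[OF m1 m1]]]
           lin_smult[OF bilinD1[OF bilin_tens[OF m1 m1]]])
  also have "\<dots> = tens k A A \<one> (tsum A (\<lambda>x y. ?e x \<odot> y) ?R)"
    by (rule tsum_apply[OF m1 m1 m1 m2 _ bu rmat_closed, symmetric]) (auto intro!: lins)
  finally show ?thesis by (simp add: rmat_counit_left tensor_algebra_simps)
qed

lemma inv_rmat: "inv\<^bsub>AA\<^esub> (rmat A) = rmat_inv"
  using AA.inv_unique[OF AA.Units_l_inv[OF rmat_unit] rmat_mult_inv rmat_closed
      AA.Units_inv_closed[OF rmat_unit] rmat_inv_closed] .

end

section \<open>Restriction to subspaces\<close>

lemma tsum_natural: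
  assumes "module k C" "module k D" "module k U" "module k V" "module k M" "module k N"
    and "lin k C U j" "lin k D V l" "lin k M N g" "bilin k C D M F" "bilin k U V N G"
    and t: "t \<in> carrier (tensor_algebra k C D)"
    and eq: "\<And>a b. \<lbrakk>a \<in> carrier C; b \<in> carrier D\<rbrakk> \<Longrightarrow> g (F a b) = G (j a) (l b)"
  shows "g (tsum M F t) = tsum N G (tensor_map k U V j l t)"
proof -
  have "g (tsum M F t) = tsum N (\<lambda>a b. g (F a b)) t"
    by (rule tsum_apply[OF assms(1,2,5,6,9,10) t])
  also have "\<dots> = tsum N (\<lambda>a b. G (j a) (l b)) t"
    by (rule tsum_cong[OF assms(1,2,6) lin_comp_bilin[OF assms(9,10)] t eq])
  also have "\<dots> = tsum N G (tensor_map k U V j l t)"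
    by (rule tsum_tensor_map[OF assms(1-4,6,7,8,11) t, symmetric])
  finally show ?thesis .
qed

lemma tsum_in_submodule:
  assumes "module k U" "module k V" "module k M" "bilin k U V M F" "submodule L k M"
    and t: "t \<in> carrier (tensor_algebra k U V)"
    and "\<And>a b. \<lbrakk>a \<in> carrier U; b \<in> carrier V\<rbrakk> \<Longrightarrow> F a b \<in> L"
  shows "tsum M F t \<in> L"
  using t by (induction t rule: tensor_induct[OF assms(1,2), consumes 1, case_names pure add])
    (simp_all add: tsum_tens[OF assms(1-4)] assms(7) lin_add[OF tsum_lin[OF assms(1-4)]]
        submodule_add[OF assms(5)])

locale subspace = U: module k U for k :: "('k, 'l) ring_scheme" and U ::
    "('k, 'a, 'm) module_scheme" +
  fixes L :: "'a set"
  assumes kf: "field k" and L: "submodule L k U"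
begin

abbreviation "UL \<equiv> U\<lparr>carrier := L\<rparr>"
abbreviation "W \<equiv> tensor_algebra k U U"
abbreviation "WL \<equiv> tensor_algebra k UL UL"

lemmas mU = U.module_axioms
lemmas mL = module_sub[OF mU L]
lemmas mW = module_tensor[OF mU mU]
lemmas mWL = module_tensor[OF mL mL]
lemmas lin_incl = lin_sub_incl[OF L]

lemma lin_tensor_incl: "lin k WL W (tensor_incl k U)"
  unfolding tensor_incl_def by (rule lin_tensor_map[OF mL mL mU mU lin_incl lin_incl])

lemma tensor_incl_tens: "\<lbrakk>x \<in> L; y \<in> L\<rbrakk> \<Longrightarrow> tensor_incl k U (tens k UL UL x y) = tens k U U x y"
  unfolding tensor_incl_def by (rule tensor_map_tens[OF mL mL mU mU lin_incl lin_incl]) simp_all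

lemma sub_tensors_eq: "sub_tensors k U L = tensor_incl k U ` carrier WL"
  unfolding sub_tensors_def tensor_algebra_simps ..

lemma sub_tensors_carrier: "t \<in> sub_tensors k U L \<Longrightarrow> t \<in> carrier W"
  unfolding sub_tensors_eq using lin_closed[OF lin_tensor_incl] by auto

lemma sub_tensors_tens: "\<lbrakk>x \<in> L; y \<in> L\<rbrakk> \<Longrightarrow> tens k U U x y \<in> sub_tensors k U L"
  unfolding sub_tensors_eq
  by (rule image_eqI[of _ _ "tens k UL UL x y"])
      (simp_all add: tensor_incl_tens tens_closed[OF mL mL])

lemma submodule_sub_tensors: "submodule (sub_tensors k U L) k W"
proof -
  interpret WL: module k WL by (rule mWL)
  show ?thesis
  proof (rule submoduleI'[OF mW])
    show "sub_tensors k U L \<subseteq> carrier W" using sub_tensors_carrier by blast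
    show "\<zero>\<^bsub>W\<^esub> \<in> sub_tensors k U L"
      unfolding sub_tensors_eq using lin_zero[OF lin_tensor_incl mWL mW]
          by (metis WL.zero_closed image_eqI)
    fix s t assume "s \<in> sub_tensors k U L" "t \<in> sub_tensors k U L"
    then show "s \<oplus>\<^bsub>W\<^esub> t \<in> sub_tensors k U L"
      unfolding sub_tensors_eq by (auto simp flip: lin_add[OF lin_tensor_incl])
  next
    fix c t assume "c \<in> carrier k" "t \<in> sub_tensors k U L"
    then show "c \<odot>\<^bsub>W\<^esub> t \<in> sub_tensors k U L"
      unfolding sub_tensors_eq by (auto simp flip: lin_smult[OF lin_tensor_incl])
  qed
qed

lemma sub_tensors_induct [consumes 1, case_names pure add]:
  assumes "t \<in> sub_tensors k U L"
    and pure: "\<And>x y. \<lbrakk>x \<in> L; y \<in> L\<rbrakk> \<Longrightarrow> P (tens k U U x y)"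
    and add: "\<And>s t. \<lbrakk>s \<in> sub_tensors k U L; t \<in> sub_tensors k U L; P s; P t\<rbrakk> \<Longrightarrow> P (s \<oplus>\<^bsub>W\<^esub> t)"
  shows "P t"
proof -
  obtain t' where t': "t' \<in> carrier WL" "t = tensor_incl k U t'"
    using assms(1) unfolding sub_tensors_eq by blast
  from t'(1) have "P (tensor_incl k U t')"
  proof (induction t' rule: tensor_induct[OF mL mL, consumes 1, case_names pure add])
    case (pure x y)
    then show ?case using assms(2) by (simp add: tensor_incl_tens)
  next
    case (add s t)
    then show ?case using assms(3) unfolding sub_tensors_eq
        by (simp add: lin_add[OF lin_tensor_incl])
  qed
  then show ?thesis using t'(2) by simp
qed

lemma tensor_map_in_sub:
  assumes "module k C" "module k D" "lin k C U f" "lin k D U g" "t \<in> carrier (tensor_algebra k C D)"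
    and "\<And>x. x \<in> carrier C \<Longrightarrow> f x \<in> L" "\<And>x. x \<in> carrier D \<Longrightarrow> g x \<in> L"
  shows "tensor_map k U U f g t \<in> sub_tensors k U L"
  unfolding tensor_map_tsum
  by (rule tsum_in_submodule[OF assms(1,2) mW bilin_comp[OF bilin_tens[OF mU mU] assms(3,4)]
      submodule_sub_tensors assms(5)])
     (simp add: sub_tensors_tens assms(6,7))

lemma tsum_sub_in_submodule:
  assumes "module k M" "bilin k U U M F" "submodule N k M" "t \<in> sub_tensors k U L"
    and "\<And>a b. \<lbrakk>a \<in> L; b \<in> L\<rbrakk> \<Longrightarrow> F a b \<in> N"
  shows "tsum M F t \<in> N"
  using assms(4)
proof (induction t rule: sub_tensors_induct)
  case (pure x y)
  then show ?case using submodule_subset[OF L]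
      by (simp add: tsum_tens[OF mU mU assms(1,2)] assms(5))
next
  case (add s t)
  then show ?case
    using sub_tensors_carrier by (simp add: lin_add[OF tsum_lin[OF mU mU assms(1,2)]]
        submodule_add[OF assms(3)])
qed

lemma restrict_closed: "t \<in> sub_tensors k U L \<Longrightarrow> restrict_tensor k U L t \<in> carrier WL"
  and incl_restrict: "t \<in> sub_tensors k U L \<Longrightarrow> tensor_incl k U (restrict_tensor k U L t) = t"
  unfolding sub_tensors_eq restrict_tensor_def tensor_algebra_simps
  by (rule inv_into_into f_inv_into_f; assumption)+

lemma retract_sub_tensors:
  assumes "lin k U U p" "\<And>x. x \<in> L \<Longrightarrow> p x = x" "lin k U U q" "\<And>x. x \<in> L \<Longrightarrow> q x = x" "t
      \<in> sub_tensors k U L"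
  shows "tensor_map k U U p q t = t"
  using assms(5)
proof (induction t rule: sub_tensors_induct)
  case (pure x y)
  then show ?case using submodule_subset[OF L]
      by (simp add: tensor_map_tens[OF mU mU mU mU assms(1,3)] assms(2,4))
next
  case (add s t)
  then show ?case
    using sub_tensors_carrier by (simp add: lin_add[OF lin_tensor_map[OF mU mU mU mU assms(1,3)]])
qed

end

lemma sub_tensors_Inter:
  assumes k: "field k" and U: "module k U" and ne: "\<L> \<noteq> {}"
    and sub: "\<And>L. L \<in> \<L> \<Longrightarrow> submodule L k U" and t: "\<And>L. L \<in> \<L> \<Longrightarrow> t \<in> sub_tensors k U L"
  shows "t \<in> sub_tensors k U (\<Inter>\<L>)"
proof -
  have I: "submodule (\<Inter>\<L>) k U" by (rule submodule_Inter[OF U ne sub])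
  interpret I: subspace k U "\<Inter>\<L>" by (intro subspace.intro subspace_axioms.intro U k I)
  interpret UU: module_pair k U U by (intro module_pair.intro U)
  have S: "subspace k U L" if "L \<in> \<L>" for L
      by (intro subspace.intro subspace_axioms.intro U k sub[OF that])
  obtain p where p: "lin k U U p" "\<And>x. x \<in> carrier U \<Longrightarrow> p x \<in> \<Inter>\<L>" "\<And>x. x \<in> \<Inter>\<L> \<Longrightarrow> p x = x"
    by (rule retraction_exists[OF k U I]) blast
  have left: "tensor_map k U U p (\<lambda>y. y) s = s" if s: "\<And>L. L \<in> \<L> \<Longrightarrow> s \<in> sub_tensors k U L" for s
  proof (rule UU.retract_left_of_slices[OF k _ p(1,3)])
    obtain L where "L \<in> \<L>" using ne by blast
    then show "s \<in> carrier UU.W" using subspace.sub_tensors_carrier[OF S s] by blast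
    fix f assume f: "lin k U (self_module k) f"
    have "tsum U (\<lambda>a b. f b \<odot>\<^bsub>U\<^esub> a) s \<in> L" if "L \<in> \<L>" for L
    proof (rule subspace.tsum_sub_in_submodule[OF S[OF that] U UU.bilin_slice[OF f] sub[OF that]
        s[OF that]])
      fix a b assume "a \<in> L" "b \<in> L"
      then show "f b \<odot>\<^bsub>U\<^esub> a \<in> L"
        using submodule_smult[OF sub[OF that]] lin_closed[OF f] submodule_subset[OF sub[OF that]]
        by (simp add: self_module_def)
    qed
    then show "tsum U (\<lambda>a b. f b \<odot>\<^bsub>U\<^esub> a) s \<in> \<Inter>\<L>" by blast
  qed
  have bf: "bilin k U U UU.W (\<lambda>x y. tens k U U y x)" by (rule bilin_flip[OF bilin_tens[OF U U]])
  note fl = tsum_lin[OF U U I.mW bf] and ft = tsum_tens[OF U U I.mW bf]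
  let ?f = "tsum UU.W (\<lambda>x y. tens k U U y x)"
  have ft2: "?f s \<in> sub_tensors k U L" if "L \<in> \<L>" "s \<in> sub_tensors k U L" for s L
    by (rule subspace.tsum_sub_in_submodule[OF S[OF that(1)] I.mW bf
        subspace.submodule_sub_tensors[OF S[OF that(1)]] that(2)])
       (rule subspace.sub_tensors_tens[OF S[OF that(1)]])
  have tW: "t \<in> carrier UU.W" using ne subspace.sub_tensors_carrier[OF S t] by blast
  have pL: "p x \<in> carrier U" if "x \<in> carrier U" for x by (rule lin_closed[OF p(1) that])
  note l1 = lin_tensor_map[OF U U U U p(1) lin_id] and l2 = lin_tensor_map[OF U U U U lin_id p(1)]
  have "tensor_map k U U (\<lambda>x. x) p t = ?f (tensor_map k U U p (\<lambda>x. x) (?f t))"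
    by (rule tensor_ext[OF U U l2 lin_comp[OF lin_comp[OF fl l1] fl] _ tW])
       (simp add: ft tensor_map_tens[OF U U U U p(1) lin_id]
           tensor_map_tens[OF U U U U lin_id p(1)] pL)
  also have "\<dots> = ?f (?f t)" by (simp add: left ft2 t)
  also have "\<dots> = t"
    by (rule tensor_ext[OF U U lin_comp[OF fl fl] lin_id _ tW]) (simp add: ft)
  finally have "tensor_map k U U p (\<lambda>y. y) (tensor_map k U U (\<lambda>x. x) p t) = t" using left[OF t]
      by simp
  then have "tensor_map k U U p p t = t"
    by (simp add: tensor_map_comp[OF U U U U U U lin_id p(1) p(1) lin_id tW])
  moreover have "tensor_map k U U p p t \<in> sub_tensors k U (\<Inter>\<L>)"
    by (rule I.tensor_map_in_sub[OF U U p(1) p(1) tW p(2) p(2)])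
  ultimately show ?thesis by simp
qed

section \<open>Transport of structure along an embedding\<close>

lemma k_algebra_pullback:
  assumes "k_algebra k A"
    and cl: "\<zero>\<^bsub>U\<^esub> \<in> carrier U" "\<one>\<^bsub>U\<^esub> \<in> carrier U"
      "\<And>x y. \<lbrakk>x \<in> carrier U; y \<in> carrier U\<rbrakk> \<Longrightarrow> x \<oplus>\<^bsub>U\<^esub> y \<in> carrier U"
      "\<And>x y. \<lbrakk>x \<in> carrier U; y \<in> carrier U\<rbrakk> \<Longrightarrow> x \<otimes>\<^bsub>U\<^esub> y \<in> carrier U"
      "\<And>c x. \<lbrakk>c \<in> carrier k; x \<in> carrier U\<rbrakk> \<Longrightarrow> c \<odot>\<^bsub>U\<^esub> x \<in> carrier U"
    and j: "\<And>x. x \<in> carrier U \<Longrightarrow> j x \<in> carrier A"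
      "j \<zero>\<^bsub>U\<^esub> = \<zero>\<^bsub>A\<^esub>" "j \<one>\<^bsub>U\<^esub> = \<one>\<^bsub>A\<^esub>"
      "\<And>x y. \<lbrakk>x \<in> carrier U; y \<in> carrier U\<rbrakk> \<Longrightarrow> j (x \<oplus>\<^bsub>U\<^esub> y) = j x \<oplus>\<^bsub>A\<^esub> j y"
      "\<And>x y. \<lbrakk>x \<in> carrier U; y \<in> carrier U\<rbrakk> \<Longrightarrow> j (x \<otimes>\<^bsub>U\<^esub> y) = j x \<otimes>\<^bsub>A\<^esub> j y"
      "\<And>c x. \<lbrakk>c \<in> carrier k; x \<in> carrier U\<rbrakk> \<Longrightarrow> j (c \<odot>\<^bsub>U\<^esub> x) = c \<odot>\<^bsub>A\<^esub> j x"
    and inj: "inj_on j (carrier U)"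
  shows "k_algebra k U"
proof -
  interpret A: k_algebra k A by fact
  note e = inj_onD[OF inj]
  note s = cl j
  have ab: "abelian_group U"
  proof (rule abelian_groupI)
    fix x assume x: "x \<in> carrier U"
    have "(\<ominus>\<^bsub>k\<^esub> \<one>\<^bsub>k\<^esub>) \<odot>\<^bsub>U\<^esub> x \<oplus>\<^bsub>U\<^esub> x = \<zero>\<^bsub>U\<^esub>"
      by (rule e) (use x in \<open>simp_all add: s A.smult_l_minus A.l_neg\<close>)
    then show "\<exists>y\<in>carrier U. y \<oplus>\<^bsub>U\<^esub> x = \<zero>\<^bsub>U\<^esub>" using x s(5) by blast
  qed (auto intro!: e simp: s A.a_ac)
  have mon: "monoid U"
    by (rule monoidI) (auto intro!: e simp: s A.m_assoc)
  have "ring U"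
    by (rule ringI[OF ab mon]) (auto intro!: e simp: s A.l_distr A.r_distr)
  moreover have "module k U"
    by (rule moduleI[OF A.k.cring_axioms ab])
        (auto intro!: e simp: s A.smult_l_distr A.smult_r_distr A.smult_assoc1)
  ultimately show ?thesis
    by (intro k_algebra.intro k_algebra_axioms.intro A.k.field_axioms)
       (auto intro!: e simp: s A.smult_mult_left A.smult_mult_right)
qed

locale qt_embedding = A: qt_hopf_algebra k A
  for k :: "('k, 'l) ring_scheme" and A :: "('k, 'a, 'm) qt_hopf_scheme" +
  fixes U :: "('k, 'b, 'n) qt_hopf_scheme" and j :: "'b \<Rightarrow> 'a" and q :: "'a \<Rightarrow> 'b"
  assumes U: "k_algebra k U"
    and j: "lin k U A j" and q: "lin k A U q" and qj: "x \<in> carrier U \<Longrightarrow> q (j x) = x"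
    and j_one: "j \<one>\<^bsub>U\<^esub> = \<one>\<^bsub>A\<^esub>"
    and j_mult: "\<lbrakk>x \<in> carrier U; y \<in> carrier U\<rbrakk> \<Longrightarrow> j (x \<otimes>\<^bsub>U\<^esub> y) = j x \<otimes>\<^bsub>A\<^esub> j y"
    and comult_in: "x \<in> carrier U \<Longrightarrow> comult U x \<in> carrier (tensor_algebra k U U)"
    and j_comult: "x \<in> carrier U \<Longrightarrow> tensor_map k A A j j (comult U x) = comult A (j x)"
    and j_counit: "x \<in> carrier U \<Longrightarrow> counit U x = counit A (j x)"
    and antipode_U: "x \<in> carrier U \<Longrightarrow> antipode U x \<in> carrier U"
    and j_antipode: "x \<in> carrier U \<Longrightarrow> j (antipode U x) = antipode A (j x)"
    and rmat_in: "rmat U \<in> carrier (tensor_algebra k U U)"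
    and j_rmat: "tensor_map k A A j j (rmat U) = rmat A"
begin

interpretation U: k_algebra k U by (rule U)

abbreviation "UU \<equiv> tensor_algebra k U U"
abbreviation "UUU \<equiv> tensor_algebra k U UU"
abbreviation "J \<equiv> tensor_map k A A j j"
abbreviation "JJ \<equiv> tensor_map k A A.AA j J"

lemmas U2 = k_algebra_tensor[OF U U]
lemmas U3 = k_algebra_tensor[OF U U2]
lemmas mU = U.module_axioms
lemmas mU2 = k_algebra_module[OF U2]
lemmas mU3 = k_algebra_module[OF U3]
lemmas A1 = A.m1 and A2 = A.m2 and A3 = A.m3

lemma lin_J: "lin k UU A.AA J"
  by (rule lin_tensor_map[OF mU mU A1 A1 j j])

lemma lin_JJ: "lin k UUU A.AAA JJ"
  by (rule lin_tensor_map[OF mU mU2 A1 A2 j lin_J])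

lemma j_closed: "x \<in> carrier U \<Longrightarrow> j x \<in> carrier A"
  by (rule lin_closed[OF j])

lemma j_inj: "\<lbrakk>j x = j y; x \<in> carrier U; y \<in> carrier U\<rbrakk> \<Longrightarrow> x = y"
  using qj by metis

lemma J_retract: "t \<in> carrier UU \<Longrightarrow> tensor_map k U U q q (J t) = t"
  by (rule tensor_map_retract[OF mU mU A1 A1 j j q q qj qj])

lemma J_inj: "\<lbrakk>J s = J t; s \<in> carrier UU; t \<in> carrier UU\<rbrakk> \<Longrightarrow> s = t"
  using J_retract by metis

lemma JJ_retract: "t \<in> carrier UUU \<Longrightarrow> tensor_map k U UU q (tensor_map k U U q q) (JJ t) = t"
  by (rule tensor_map_retract[OF mU mU2 A1 A2 j lin_J q lin_tensor_map[OF A1 A1 mU mU q q] qj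
      J_retract])

lemma JJ_inj: "\<lbrakk>JJ s = JJ t; s \<in> carrier UUU; t \<in> carrier UUU\<rbrakk> \<Longrightarrow> s = t"
  using JJ_retract by metis

lemma J_tens: "\<lbrakk>x \<in> carrier U; y \<in> carrier U\<rbrakk> \<Longrightarrow> J (tens k U U x y) = tens k A A (j x) (j y)"
  by (rule tensor_map_tens[OF mU mU A1 A1 j j])

lemma JJ_tens: "\<lbrakk>x \<in> carrier U; u \<in> carrier UU\<rbrakk> \<Longrightarrow> JJ (tens k U UU x u) = tens k A A.AA (j x) (J u)"
  by (rule tensor_map_tens[OF mU mU2 A1 A2 j lin_J])

lemma J_mult: "\<lbrakk>s \<in> carrier UU; t \<in> carrier UU\<rbrakk> \<Longrightarrow> J (s \<otimes>\<^bsub>UU\<^esub> t) = J s \<otimes>\<^bsub>A.AA\<^esub> J t"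
  by (rule tensor_map_mult[OF U U A.ka1 A.ka1 j j j_mult j_mult])

lemma JJ_mult: "\<lbrakk>s \<in> carrier UUU; t \<in> carrier UUU\<rbrakk> \<Longrightarrow> JJ (s \<otimes>\<^bsub>UUU\<^esub> t) = JJ s \<otimes>\<^bsub>A.AAA\<^esub> JJ t"
  by (rule tensor_map_mult[OF U U2 A.ka1 A.ka2 j lin_J j_mult J_mult])

lemma J_one: "J \<one>\<^bsub>UU\<^esub> = \<one>\<^bsub>A.AA\<^esub>"
  by (simp add: tensor_algebra_simps J_tens j_one)

lemmas natural = tsum_natural[OF mU mU A1 A1 _ _ j j]

lemma lin_comult_U: "lin k U UU (comult U)"
proof (rule linI)
  interpret UU: module k UU by (rule mU2)
  fix x y assume "x \<in> carrier U" "y \<in> carrier U"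
  then show "comult U (x \<oplus>\<^bsub>U\<^esub> y) = comult U x \<oplus>\<^bsub>UU\<^esub> comult U y"
    by (intro J_inj) (simp_all add: comult_in j_comult lin_add[OF lin_J] lin_add[OF j]
        lin_add[OF A.lin_comult] j_closed)
next
  interpret UU: module k UU by (rule mU2)
  fix c x assume "c \<in> carrier k" "x \<in> carrier U"
  then show "comult U (c \<odot>\<^bsub>U\<^esub> x) = c \<odot>\<^bsub>UU\<^esub> comult U x"
    by (intro J_inj) (simp_all add: comult_in j_comult lin_smult[OF lin_J] lin_smult[OF j]
        lin_smult[OF A.lin_comult] j_closed)
qed (rule comult_in)

lemma lin_counit_U: "lin k U (self_module k) (counit U)"
  by (rule lin_cong[OF lin_comp[OF j A.lin_counit] mU]) (simp add: j_counit)

lemma lin_antipode_U: "lin k U U (antipode U)"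
proof (rule linI)
  fix x y assume "x \<in> carrier U" "y \<in> carrier U"
  then show "antipode U (x \<oplus>\<^bsub>U\<^esub> y) = antipode U x \<oplus>\<^bsub>U\<^esub> antipode U y"
    by (intro j_inj) (simp_all add: antipode_U j_antipode lin_add[OF j] lin_add[OF A.lin_antipode]
        j_closed)
next
  fix c x assume "c \<in> carrier k" "x \<in> carrier U"
  then show "antipode U (c \<odot>\<^bsub>U\<^esub> x) = c \<odot>\<^bsub>U\<^esub> antipode U x"
    by (intro j_inj) (simp_all add: antipode_U j_antipode lin_smult[OF j]
        lin_smult[OF A.lin_antipode] j_closed)
qed (rule antipode_U)

lemma bilin_comult_tens:
  "bilin k U U UUU (\<lambda>x y. tsum UUU (\<lambda>a b. tens k U UU a (tens k U U b y)) (comult U x))"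
  "y \<in> carrier U \<Longrightarrow> bilin k U U UUU (\<lambda>a b. tens k U UU a (tens k U U b y))"
proof -
  note l = lin_tens_left[OF mU mU] lin_tens_right[OF mU mU] lin_tens_left[OF mU mU2]
      lin_tens_right[OF mU mU2]
  show *: "bilin k U U UUU (\<lambda>a b. tens k U UU a (tens k U U b y))" if "y \<in> carrier U" for y
    using that by (auto intro!: bilinI l lin_id tens_closed[OF mU mU])
  show "bilin k U U UUU (\<lambda>x y. tsum UUU (\<lambda>a b. tens k U UU a (tens k U U b y)) (comult U x))"
    by (rule bilinI, rule lin_tsum_param[OF mU mU mU3 comult_in _ * mU], assumption,
        (auto intro!: l lin_id)[1], assumption, rule lin_tsum_arg[OF mU mU mU3 * lin_comult_U])
qed

lemma JJ_comult_left:
  assumes t: "t \<in> carrier UU"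
  shows "JJ (tsum UUU (\<lambda>x y. tsum UUU (\<lambda>a b. tens k U UU a (tens k U U b y)) (comult U x)) t)
   = tsum A.AAA (\<lambda>x y. tsum A.AAA (\<lambda>a b. tens k A A.AA a (tens k A A b y)) (comult A x)) (J t)"
proof (rule natural[OF mU3 A3 lin_JJ bilin_comult_tens(1) _ t])
  show "bilin k A A A.AAA (\<lambda>x y. tsum A.AAA (\<lambda>a b. tens k A A.AA a (tens k A A b y)) (comult A x))"
    by (auto intro!: A.lins)
  fix x y assume xy: "x \<in> carrier U" "y \<in> carrier U"
  have "JJ (tsum UUU (\<lambda>a b. tens k U UU a (tens k U U b y)) (comult U x))
     = tsum A.AAA (\<lambda>a b. tens k A A.AA a (tens k A A b (j y))) (J (comult U x))"
    by (rule natural[OF mU3 A3 lin_JJ bilin_comult_tens(2)[OF xy(2)] _ comult_in[OF xy(1)]])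
       ((use j_closed[OF xy(2)] in \<open>auto intro!: A.lins\<close>)[1], simp add: JJ_tens J_tens xy
           tens_closed[OF mU mU])
  then show "JJ (tsum UUU (\<lambda>a b. tens k U UU a (tens k U U b y)) (comult U x))
     = tsum A.AAA (\<lambda>a b. tens k A A.AA a (tens k A A b (j y))) (comult A (j x))"
    by (simp add: j_comult xy)
qed

lemma JJ_comult_right:
  assumes t: "t \<in> carrier UU"
  shows "JJ (tensor_map k U UU (\<lambda>y. y) (comult U) t) = tensor_map k A A.AA (\<lambda>y. y) (comult A) (J t)"
  unfolding tensor_map_tsum[of k U UU] tensor_map_tsum[of k A A.AA "\<lambda>y. y"]
  by (rule natural[OF mU3 A3 lin_JJ bilin_comp[OF bilin_tens[OF mU mU2] lin_id lin_comult_U]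
        bilin_comp[OF bilin_tens[OF A1 A2] lin_id A.lin_comult] t])
     (simp add: JJ_tens comult_in j_comult)

lemma hopf_U: "hopf_algebra k U"
proof (intro hopf_algebra.intro U hopf_algebra_axioms.intro)
  show "comult U \<in> alg_hom k U UU"
  proof -
    have "comult U (x \<otimes>\<^bsub>U\<^esub> y) = comult U x \<otimes>\<^bsub>UU\<^esub> comult U y" if "x \<in> carrier U" "y \<in> carrier U" for x y
      by (rule J_inj) (use that bilin_closed[OF bilin_mult[OF U2]] in
          \<open>simp_all add: comult_in j_comult J_mult j_mult A.comult_mult j_closed\<close>)
    moreover have "comult U \<one>\<^bsub>U\<^esub> = \<one>\<^bsub>UU\<^esub>"
      by (rule J_inj) (use J_one k_algebra.axioms(3)[OF U2] ring.is_monoid monoid.one_closed in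
          \<open>simp_all add: comult_in j_comult j_one A.comult_one\<close>, blast)
    ultimately show ?thesis
      unfolding alg_hom_def ring_hom_def using lin_comult_U by (simp add: lin_def)
  qed
  show "counit U \<in> ring_hom U k"
    unfolding ring_hom_def using lin_counit_U
    by (simp add: j_counit j_mult j_closed A.counit_mult j_one lin_def self_module_def)
  show "counit U (c \<odot>\<^bsub>U\<^esub> x) = c \<otimes>\<^bsub>k\<^esub> counit U x" if "c \<in> carrier k" "x \<in> carrier U" for c x
    using lin_smult[OF lin_counit_U that] by (simp add: self_module_def)
next
  fix x assume x: "x \<in> carrier U"
  show "tensor_lift (tens_grp k U UU) (\<lambda>x1 x2. tensor_lift (tens_grp k U UU)
      (\<lambda>x11 x12. tens k U UU x11 (tens k U U x12 x2)) (comult U x1)) (comult U x)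
    = tensor_map k U UU (\<lambda>y. y) (comult U) (comult U x)"
    unfolding tensor_lift_tens_grp
  proof (rule JJ_inj)
    show "JJ (tsum UUU (\<lambda>x y. tsum UUU (\<lambda>a b. tens k U UU a (tens k U U b y)) (comult U x))
        (comult U x))
      = JJ (tensor_map k U UU (\<lambda>y. y) (comult U) (comult U x))"
      using A.coassoc[OF j_closed[OF x]]
      by (simp add: JJ_comult_left JJ_comult_right comult_in j_comult x tensor_lift_tens_grp)
    show "tsum UUU (\<lambda>x y. tsum UUU (\<lambda>a b. tens k U UU a (tens k U U b y)) (comult U x))
        (comult U x) \<in> carrier UUU"
      by (rule tsum_closed[OF mU mU mU3 bilin_comult_tens(1) comult_in[OF x]])
    show "tensor_map k U UU (\<lambda>y. y) (comult U) (comult U x) \<in> carrier UUU"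
      by (rule lin_closed[OF lin_tensor_map[OF mU mU mU mU2 lin_id lin_comult_U] comult_in[OF x]])
  qed
  have b1: "bilin k U U U (\<lambda>a b. counit U a \<odot>\<^bsub>U\<^esub> b)"
    by (rule bilin_comp[OF bilin_smult[OF mU] lin_counit_U lin_id])
  have "j (tsum U (\<lambda>a b. counit U a \<odot>\<^bsub>U\<^esub> b) (comult U x))
      = tsum A (\<lambda>a b. counit A a \<odot>\<^bsub>A\<^esub> b) (J (comult U x))"
    by (rule natural[OF mU A1 j b1 A.bilin_counit_left[OF A1 lin_id] comult_in[OF x]])
       (simp add: j_counit lin_smult[OF j] j_closed)
  then show "tensor_lift (add_monoid U) (\<lambda>a b. counit U a \<odot>\<^bsub>U\<^esub> b) (comult U x) = x"
    unfolding tsum_def[symmetric]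
    by (intro j_inj) (use x in \<open>simp_all add: j_comult A.sw_counit_left j_closed
        tsum_closed[OF mU mU mU b1] comult_in\<close>)
  have b2: "bilin k U U U (\<lambda>a b. counit U b \<odot>\<^bsub>U\<^esub> a)"
    by (rule bilin_flip[OF b1])
  have "j (tsum U (\<lambda>a b. counit U b \<odot>\<^bsub>U\<^esub> a) (comult U x))
      = tsum A (\<lambda>a b. counit A b \<odot>\<^bsub>A\<^esub> a) (J (comult U x))"
    by (rule natural[OF mU A1 j b2 A.bilin_counit_right[OF A1 lin_id] comult_in[OF x]])
       (simp add: j_counit lin_smult[OF j] j_closed)
  then show "tensor_lift (add_monoid U) (\<lambda>a b. counit U b \<odot>\<^bsub>U\<^esub> a) (comult U x) = x"
    unfolding tsum_def[symmetric]
    by (intro j_inj) (use x in \<open>simp_all add: j_comult A.sw_counit_right j_closed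
        tsum_closed[OF mU mU mU b2] comult_in\<close>)
  have b3: "bilin k U U U (\<lambda>a b. antipode U a \<otimes>\<^bsub>U\<^esub> b)"
    by (rule bilin_comp[OF bilin_mult[OF U] lin_antipode_U lin_id])
  have "j (tsum U (\<lambda>a b. antipode U a \<otimes>\<^bsub>U\<^esub> b) (comult U x))
      = tsum A (\<lambda>a b. antipode A a \<otimes>\<^bsub>A\<^esub> b) (J (comult U x))"
    by (rule natural[OF mU A1 j b3 bilin_comp[OF bilin_mult[OF A.ka1] A.lin_antipode lin_id]
        comult_in[OF x]])
       (simp add: j_mult antipode_U j_antipode)
  then show "tensor_lift (add_monoid U) (\<lambda>a b. antipode U a \<otimes>\<^bsub>U\<^esub> b) (comult U x) = counit U x \<odot>\<^bsub>U\<^esub> \<one>\<^bsub>U\<^esub>"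
    unfolding tsum_def[symmetric]
    by (intro j_inj) (use x in \<open>simp_all add: j_comult A.sw_antipode_left j_closed
        tsum_closed[OF mU mU mU b3] comult_in
         j_counit lin_smult[OF j] j_one\<close>)
  have b4: "bilin k U U U (\<lambda>a b. a \<otimes>\<^bsub>U\<^esub> antipode U b)"
    by (rule bilin_comp[OF bilin_mult[OF U] lin_id lin_antipode_U])
  have "j (tsum U (\<lambda>a b. a \<otimes>\<^bsub>U\<^esub> antipode U b) (comult U x))
      = tsum A (\<lambda>a b. a \<otimes>\<^bsub>A\<^esub> antipode A b) (J (comult U x))"
    by (rule natural[OF mU A1 j b4 bilin_comp[OF bilin_mult[OF A.ka1] lin_id A.lin_antipode]
        comult_in[OF x]])
       (simp add: j_mult antipode_U j_antipode)
  then show "tensor_lift (add_monoid U) (\<lambda>a b. a \<otimes>\<^bsub>U\<^esub> antipode U b) (comult U x) = counit U x \<odot>\<^bsub>U\<^esub> \<one>\<^bsub>U\<^esub>"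
    unfolding tsum_def[symmetric]
    by (intro j_inj) (use x in \<open>simp_all add: j_comult A.sw_antipode_right j_closed
        tsum_closed[OF mU mU mU b4] comult_in
         j_counit lin_smult[OF j] j_one\<close>)
qed (use lin_antipode_U in \<open>auto simp: lin_def\<close>)

theorem qt_hopf_U: "qt_hopf_algebra k U"
proof (intro qt_hopf_algebra.intro hopf_U qt_hopf_algebra_axioms.intro)
  interpret UU: k_algebra k UU by (rule U2)
  interpret UUU: k_algebra k UUU by (rule U3)
  define Ri where "Ri = tensor_map k U U (antipode U) (\<lambda>y. y) (rmat U)"
  have Ri: "Ri \<in> carrier UU"
    unfolding Ri_def by (rule lin_closed[OF lin_tensor_map[OF mU mU mU mU lin_antipode_U lin_id]
        rmat_in])
  have "J Ri = tsum A.AA (\<lambda>x y. tens k A A (antipode A x) y) (J (rmat U))"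
    unfolding Ri_def tensor_map_tsum[of k U U]
    by (rule natural[OF mU2 A2 lin_J bilin_comp[OF bilin_tens[OF mU mU] lin_antipode_U lin_id]
         bilin_comp[OF bilin_tens[OF A1 A1] A.lin_antipode lin_id] rmat_in])
       (simp add: J_tens antipode_U j_antipode)
  then have JRi: "J Ri = inv\<^bsub>A.AA\<^esub> (rmat A)"
    unfolding A.inv_rmat A.rmat_inv_def tensor_map_tsum[of k A A "antipode A"] j_rmat .
  have l: "rmat U \<otimes>\<^bsub>UU\<^esub> Ri = \<one>\<^bsub>UU\<^esub>"
    by (rule J_inj) (use Ri rmat_in A.rmat_unit in \<open>simp_all add: J_mult JRi j_rmat J_one\<close>)
  have r: "Ri \<otimes>\<^bsub>UU\<^esub> rmat U = \<one>\<^bsub>UU\<^esub>"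
    by (rule J_inj) (use Ri rmat_in A.rmat_unit in \<open>simp_all add: J_mult JRi j_rmat J_one\<close>)
  show unit: "rmat U \<in> Units UU"
    unfolding Units_def using l r Ri rmat_in by blast
  have inv: "inv\<^bsub>UU\<^esub> (rmat U) = Ri"
    using UU.inv_unique[OF UU.Units_l_inv[OF unit] l rmat_in UU.Units_inv_closed[OF unit] Ri] .
  show "comult_op k U x = rmat U \<otimes>\<^bsub>UU\<^esub> comult U x \<otimes>\<^bsub>UU\<^esub> inv\<^bsub>UU\<^esub> (rmat U)" if x: "x \<in> carrier U" for x
  proof (rule J_inj)
    have b: "bilin k U U UU (\<lambda>a b. tens k U U b a)" by (rule bilin_flip[OF bilin_tens[OF mU mU]])
    show "comult_op k U x \<in> carrier UU"
      unfolding comult_op_def tensor_lift_tens_grp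
          by (rule tsum_closed[OF mU mU mU2 b comult_in[OF x]])
    show "rmat U \<otimes>\<^bsub>UU\<^esub> comult U x \<otimes>\<^bsub>UU\<^esub> inv\<^bsub>UU\<^esub> (rmat U) \<in> carrier UU"
      unfolding inv by (simp add: Ri rmat_in comult_in x)
    have "J (comult_op k U x) = tsum A.AA (\<lambda>a b. tens k A A b a) (J (comult U x))"
      unfolding comult_op_def tensor_lift_tens_grp
      by (rule natural[OF mU2 A2 lin_J b bilin_flip[OF bilin_tens[OF A1 A1]] comult_in[OF x]])
          (simp add: J_tens)
    also have "\<dots> = comult_op k A (j x)"
      by (simp add: j_comult x comult_op_def tensor_lift_tens_grp)
    finally show "J (comult_op k U x) = J (rmat U \<otimes>\<^bsub>UU\<^esub> comult U x \<otimes>\<^bsub>UU\<^esub> inv\<^bsub>UU\<^esub> (rmat U))"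
      using x by (simp add: A.rmat_comult_op j_closed inv J_mult JRi j_rmat j_comult Ri rmat_in
          comult_in)
  qed
  have b12: "bilin k U U UUU (\<lambda>x y. tens k U UU x (tens k U U y \<one>\<^bsub>U\<^esub>))"
    by (rule bilin_comp[OF bilin_tens[OF mU mU2] lin_id lin_tens_left[OF mU mU lin_id]]) simp
  have R12c: "R12 k U \<in> carrier UUU"
    unfolding R12_def tensor_lift_tens_grp by (rule tsum_closed[OF mU mU mU3 b12 rmat_in])
  have "JJ (R12 k U) = tsum A.AAA (\<lambda>x y. tens k A A.AA x (tens k A A y \<one>\<^bsub>A\<^esub>)) (J (rmat U))"
    unfolding R12_def tensor_lift_tens_grp
    by (rule natural[OF mU3 A3 lin_JJ b12 _ rmat_in])
       ((auto intro!: A.lins)[1], simp add: JJ_tens J_tens tens_closed[OF mU mU] j_one)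
  then have R12: "JJ (R12 k U) = R12 k A" by (simp add: j_rmat R12_def tensor_lift_tens_grp)
  have b13: "bilin k U U UUU (\<lambda>x y. tens k U UU x (tens k U U \<one>\<^bsub>U\<^esub> y))"
    by (rule bilin_comp[OF bilin_tens[OF mU mU2] lin_id lin_tens_right[OF mU mU lin_id]]) simp
  have R13c: "R13 k U \<in> carrier UUU"
    unfolding R13_def tensor_lift_tens_grp by (rule tsum_closed[OF mU mU mU3 b13 rmat_in])
  have "JJ (R13 k U) = tsum A.AAA (\<lambda>x y. tens k A A.AA x (tens k A A \<one>\<^bsub>A\<^esub> y)) (J (rmat U))"
    unfolding R13_def tensor_lift_tens_grp
    by (rule natural[OF mU3 A3 lin_JJ b13 _ rmat_in])
       ((auto intro!: A.lins)[1], simp add: JJ_tens J_tens tens_closed[OF mU mU] j_one)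
  then have R13: "JJ (R13 k U) = R13 k A" by (simp add: j_rmat R13_def tensor_lift_tens_grp)
  have R23c: "R23 k U \<in> carrier UUU"
    unfolding R23_def by (simp add: tens_closed[OF mU mU2] rmat_in)
  have R23: "JJ (R23 k U) = R23 k A"
    unfolding R23_def by (simp add: JJ_tens rmat_in j_rmat j_one)
  show "tensor_map k U UU (\<lambda>y. y) (comult U) (rmat U) = R13 k U \<otimes>\<^bsub>UUU\<^esub> R12 k U"
    by (rule JJ_inj)
      (simp_all add: JJ_comult_right rmat_in j_rmat JJ_mult R12c R13c R12 R13 A.rmat_id_comult
         lin_closed[OF lin_tensor_map[OF mU mU mU mU2 lin_id lin_comult_U]])
  show "tensor_lift (tens_grp k U UU) (\<lambda>x y. tensor_lift (tens_grp k U UU)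
      (\<lambda>x1 x2. tens k U UU x1 (tens k U U x2 y)) (comult U x)) (rmat U)
    = R13 k U \<otimes>\<^bsub>UUU\<^esub> R23 k U"
    unfolding tensor_lift_tens_grp
    by (rule JJ_inj)
      (use A.rmat_comult_id in \<open>simp_all add: JJ_comult_left rmat_in j_rmat JJ_mult R23c R13c R23
          R13
         tensor_lift_tens_grp tsum_closed[OF mU mU mU3 bilin_comult_tens(1)]\<close>)
qed

end

section \<open>Hopf subalgebras\<close>

lemma tens_grp_cong:
  assumes "carrier U = carrier U'" "add U = add U'" "smult U = smult U'"
    "carrier V = carrier V'" "add V = add V'" "smult V = smult V'"
  shows "tens_grp k U V = tens_grp k U' V'" "tens k U V = tens k U' V'"
  using assms
  unfolding tens_grp_def tens_def tensor_group_def tensor_kernel_def tensor_relators_def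
      pure_tensor_def by simp_all

lemma tensor_algebra_cong:
  assumes "carrier U = carrier U'" "add U = add U'" "smult U = smult U'"
    "carrier V = carrier V'" "add V = add V'" "smult V = smult V'"
    "monoid.mult U = monoid.mult U'" "one U = one U'" "monoid.mult V = monoid.mult V'" "one V
        = one V'"
  shows "tensor_algebra k U V = tensor_algebra k U' V'"
  using assms(3,7-10) unfolding tensor_algebra_def tens_grp_cong[OF assms(1-6)] by simp

lemma tensor_map_cong_target:
  assumes "carrier U = carrier U'" "add U = add U'" "smult U = smult U'"
    "carrier V = carrier V'" "add V = add V'" "smult V = smult V'"
  shows "tensor_map k U V f g = tensor_map k U' V' f g"
  unfolding tensor_map_def tens_grp_cong[OF assms] by simp

lemma sub_qt_simps [simp]:
  "carrier (sub_qt k A L) = L" "add (sub_qt k A L) = add A" "ring.zero (sub_qt k A L) = \<zero>\<^bsub>A\<^esub>"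
  "monoid.mult (sub_qt k A L) = monoid.mult A" "one (sub_qt k A L) = \<one>\<^bsub>A\<^esub>" "smult (sub_qt k A L)
      = smult A"
  "comult (sub_qt k A L) = (\<lambda>x. restrict_tensor k A L (comult A x))" "counit (sub_qt k A L)
      = counit A"
  "antipode (sub_qt k A L) = antipode A" "rmat (sub_qt k A L) = restrict_tensor k A L (rmat A)"
  by (simp_all add: sub_qt_def sub_hopf_def)

lemma sub_hopf_simps [simp]:
  "carrier (sub_hopf k A L) = L" "add (sub_hopf k A L) = add A" "ring.zero (sub_hopf k A L) = \<zero>\<^bsub>A\<^esub>"
  "monoid.mult (sub_hopf k A L) = monoid.mult A" "one (sub_hopf k A L)
      = \<one>\<^bsub>A\<^esub>" "smult (sub_hopf k A L) = smult A"
  "comult (sub_hopf k A L) = (\<lambda>x. restrict_tensor k A L (comult A x))" "counit (sub_hopf k A L)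
      = counit A"
  "antipode (sub_hopf k A L) = antipode A"
  by (simp_all add: sub_hopf_def)

lemma tensor_algebra_sub:
  "tensor_algebra k (sub_qt k A L) (sub_qt k A L)
      = tensor_algebra k (A\<lparr>carrier := L\<rparr>) (A\<lparr>carrier := L\<rparr>)"
  "tensor_algebra k (sub_hopf k A L) (sub_hopf k A L)
      = tensor_algebra k (A\<lparr>carrier := L\<rparr>) (A\<lparr>carrier := L\<rparr>)"
  by (rule tensor_algebra_cong; simp)+

lemma tens_sub: "tens k (sub_qt k A L) (sub_qt k A L) = tens k (A\<lparr>carrier := L\<rparr>) (A\<lparr>carrier := L\<rparr>)"
  by (rule tens_grp_cong; simp)

lemma module_eq_ops:
  assumes "module k U" "carrier U = carrier U'" "add U = add U'" "smult U = smult U'" "ring.zero U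
      = ring.zero U'"
  shows "module k U'"
proof -
  interpret module k U by fact
  have "abelian_group U'"
    by (rule abelian_groupI)
       (use assms(2-5) a_closed zero_closed a_assoc a_comm l_zero in \<open>simp_all\<close>, metis
           abelian_group.minus_closed a_inv_closed l_neg)
  then show ?thesis
    using assms(2-5) smult_closed smult_l_distr smult_r_distr smult_assoc1 smult_one
    by (intro moduleI R.cring_axioms) auto
qed

lemma module_sub_qt: "\<lbrakk>module k A; submodule L k A\<rbrakk> \<Longrightarrow> module k (sub_qt k A L)"
  by (rule module_eq_ops[OF module_sub]) simp_all

lemma module_sub_hopf: "\<lbrakk>module k A; submodule L k A\<rbrakk> \<Longrightarrow> module k (sub_hopf k A L)"
  by (rule module_eq_ops[OF module_sub]) simp_all

lemma submodule_of_sub: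
  assumes "module k A" "submodule H k A" "submodule L k (sub_qt k A H)"
  shows "submodule L k A" "L \<subseteq> H"
proof -
  show LH: "L \<subseteq> H" using submodule_subset[OF assms(3)] by auto
  show "submodule L k A"
    by (rule submoduleI'[OF assms(1)])
       (use LH submodule_subset[OF assms(2)] submodule_closed[OF assms(3)] in auto)
qed

lemma (in hopf_algebra) hopf_subalgebraI:
  assumes "submodule L k A" "\<one> \<in> L" "\<And>x y. \<lbrakk>x \<in> L; y \<in> L\<rbrakk> \<Longrightarrow> x \<otimes> y \<in> L"
    "\<And>x. x \<in> L \<Longrightarrow> comult A x \<in> sub_tensors k A L" "\<And>x. x \<in> L \<Longrightarrow> antipode A x \<in> L"
  shows "hopf_subalgebra k A L"
proof -
  have "subring L A"
    by (rule subringI) (use assms submodule_closed[OF assms(1)] submodule_subset[OF assms(1)] in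
        auto)
  then show ?thesis using assms unfolding hopf_subalgebra_def by blast
qed

lemma hopf_subalgebraD:
  assumes "hopf_subalgebra k A L"
  shows "submodule L k A" "\<one>\<^bsub>A\<^esub> \<in> L" "\<And>x y. \<lbrakk>x \<in> L; y \<in> L\<rbrakk> \<Longrightarrow> x \<otimes>\<^bsub>A\<^esub> y \<in> L"
    "\<And>x. x \<in> L \<Longrightarrow> comult A x \<in> sub_tensors k A L" "\<And>x. x \<in> L \<Longrightarrow> antipode A x \<in> L"
  using assms subringE[of L A] unfolding hopf_subalgebra_def by blast+

context qt_hopf_algebra
begin

lemma subspaceI: "submodule L k A \<Longrightarrow> subspace k A L"
  by (intro subspace.intro subspace_axioms.intro m1 k.field_axioms)

lemma sub_qt_hopf_algebra:
  assumes L: "hopf_subalgebra k A L" and R: "rmat A \<in> sub_tensors k A L"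
  shows "qt_hopf_algebra k (sub_qt k A L)"
proof -
  note D = hopf_subalgebraD[OF L]
  interpret S: subspace k A L by (rule subspaceI[OF D(1)])
  obtain p where p: "lin k A A p" "\<And>x. x \<in> carrier A \<Longrightarrow> p x \<in> L" "\<And>x. x \<in> L \<Longrightarrow> p x = x"
    by (rule retraction_exists[OF k.field_axioms m1 D(1)]) blast
  have LA: "x \<in> carrier A" if "x \<in> L" for x by (rule submodule_subset[OF D(1) that])
  have "qt_embedding k A (sub_qt k A L) (\<lambda>x. x) p"
  proof (intro qt_embedding.intro qt_hopf_algebra_axioms qt_embedding_axioms.intro)
    show "k_algebra k (sub_qt k A L)"
      by (rule k_algebra_pullback[OF ka1, where j = "\<lambda>x. x"])
         (use D(1-3) submodule_closed[OF D(1)] LA in auto)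
    show "lin k (sub_qt k A L) A (\<lambda>x. x)" by (rule linI) (use LA in auto)
    show "lin k A (sub_qt k A L) p" using p(1,2) by (auto simp: lin_def)
  qed (use D p R in \<open>auto simp: tensor_algebra_sub S.restrict_closed
      S.incl_restrict[unfolded tensor_incl_def]\<close>)
  then show ?thesis by (rule qt_embedding.qt_hopf_U)
qed

lemma qt_hopf_subalgebraI:
  "\<lbrakk>hopf_subalgebra k A L; rmat A \<in> sub_tensors k A L\<rbrakk> \<Longrightarrow> qt_hopf_subalgebra k A L"
  unfolding qt_hopf_subalgebra_def using sub_qt_hopf_algebra by blast

lemma tensor_incl_self: "t \<in> carrier AA \<Longrightarrow> tensor_incl k A t = t"
  unfolding tensor_incl_def by (simp add: tensor_map_ident[OF m1 m1])

lemma minimal_qt_subalgebra: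
  "hopf_subalgebra k A (minimal_qt k A)" "rmat A \<in> sub_tensors k A (minimal_qt k A)"
proof -
  let ?F = "{L. hopf_subalgebra k A L \<and> rmat A \<in> sub_tensors k A L}"
  have cA: "submodule (carrier A) k A" by (rule carrier_is_submodule)
  have st: "sub_tensors k A (carrier A) = carrier AA"
    using tensor_incl_self unfolding sub_tensors_def by (simp add: tensor_algebra_simps image_def)
  have "hopf_subalgebra k A (carrier A)"
    by (rule hopf_subalgebraI[OF cA]) (auto simp: st)
  then have ne: "?F \<noteq> {}" using st by auto
  have sub: "submodule L k A" if "L \<in> ?F" for L using that hopf_subalgebraD(1) by blast
  have I: "hopf_subalgebra k A (\<Inter>?F)"
  proof (rule hopf_subalgebraI)
    show "submodule (\<Inter>?F) k A" by (rule submodule_Inter[OF m1 ne sub])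
    fix x assume x: "x \<in> \<Inter>?F"
    show "comult A x \<in> sub_tensors k A (\<Inter>?F)"
    proof (rule sub_tensors_Inter[OF k.field_axioms m1 ne sub])
      fix L assume "L \<in> ?F"
      then show "comult A x \<in> sub_tensors k A L" using x hopf_subalgebraD(4)[of k A L x] by blast
    qed
  qed (use hopf_subalgebraD(2,3,5)[of k A] in blast)+
  have R: "rmat A \<in> sub_tensors k A (\<Inter>?F)"
    by (rule sub_tensors_Inter[OF k.field_axioms m1 ne sub]) simp_all
  have "minimal_qt k A = \<Inter>?F"
    unfolding minimal_qt_def by (rule Least_equality, intro conjI I R) (rule Inter_lower, simp)
  then show "hopf_subalgebra k A (minimal_qt k A)" "rmat A \<in> sub_tensors k A (minimal_qt k A)"
    using I R by simp_all
qed

lemma hopf_subalgebra_trans: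
  assumes H: "hopf_subalgebra k A H" and R: "rmat A \<in> sub_tensors k A H"
    and B: "hopf_subalgebra k (sub_qt k A H) B" and RB: "rmat (sub_qt k A H)
        \<in> sub_tensors k (sub_qt k A H) B"
  shows "hopf_subalgebra k A B" "B \<subseteq> H" "rmat A \<in> sub_tensors k A B"
proof -
  note DH = hopf_subalgebraD[OF H]
  note DB = hopf_subalgebraD[OF B]
  let ?H = "sub_qt k A H"
  have mH: "module k ?H" by (rule module_sub_qt[OF m1 DH(1)])
  note sB = submodule_of_sub[OF m1 DH(1) DB(1)]
  show "B \<subseteq> H" by (rule sB(2))
  interpret S: subspace k A H by (rule subspaceI[OF DH(1)])
  interpret SB: subspace k A B by (rule subspaceI[OF sB(1)])
  interpret T: subspace k ?H B by (intro subspace.intro subspace_axioms.intro mH k.field_axioms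
      DB(1))
  have *: "tensor_incl k A t \<in> sub_tensors k A B" if "t \<in> sub_tensors k ?H B" for t
    using that
  proof (induction t rule: T.sub_tensors_induct)
    case (pure x y)
    then show ?case using sB(2) by (simp add: tens_sub S.tensor_incl_tens subset_iff
        SB.sub_tensors_tens)
  next
    case (add s t)
    then show ?case
      using T.sub_tensors_carrier submodule_add[OF SB.submodule_sub_tensors]
      by (simp add: tensor_algebra_sub lin_add[OF S.lin_tensor_incl])
  qed
  show "rmat A \<in> sub_tensors k A B"
    using *[OF RB] R by (simp add: S.incl_restrict)
  show "hopf_subalgebra k A B"
  proof (rule hopf_subalgebraI[OF sB(1)])
    fix x assume x: "x \<in> B"
    then show "comult A x \<in> sub_tensors k A B"
      using *[OF DB(4)[OF x]] DH(4) sB(2) by (auto simp: S.incl_restrict)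
  qed (use DB(2,3,5) in auto)
qed

end

section \<open>Hopf algebras with a projection\<close>

locale hopf_proj = qt_hopf_algebra k A
  for k :: "('k, 'l) ring_scheme" and A :: "('k, 'a, 'm) qt_hopf_scheme" (structure) +
  fixes \<pi> :: "'a \<Rightarrow> 'a" and B :: "'a set"
  assumes lin_pi: "lin k A A \<pi>"
    and pi_mult: "\<lbrakk>x \<in> carrier A; y \<in> carrier A\<rbrakk> \<Longrightarrow> \<pi> (x \<otimes> y) = \<pi> x \<otimes> \<pi> y"
    and pi_one: "\<pi> \<one> = \<one>"
    and pi_counit: "x \<in> carrier A \<Longrightarrow> counit A (\<pi> x) = counit A x"
    and pi_comult: "x \<in> carrier A \<Longrightarrow> comult A (\<pi> x) = tensor_map k A A \<pi> \<pi> (comult A x)"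
    and pi_antipode: "x \<in> carrier A \<Longrightarrow> \<pi> (antipode A x) = antipode A (\<pi> x)"
    and pi_idem: "x \<in> carrier A \<Longrightarrow> \<pi> (\<pi> x) = \<pi> x"
    and hopf_B: "hopf_subalgebra k A B"
    and pi_B: "b \<in> B \<Longrightarrow> \<pi> b = b"
    and rmat_B: "rmat A \<in> sub_tensors k A B"
begin

lemmas B_submodule = hopf_subalgebraD(1)[OF hopf_B]
lemmas B_closed = hopf_subalgebraD(2-5)[OF hopf_B] submodule_closed[OF B_submodule]
lemmas B_carrier = submodule_subset[OF B_submodule]

sublocale SB: subspace k A B by (rule subspaceI[OF B_submodule])

lemma pi_closed [simp, intro]: "x \<in> carrier A \<Longrightarrow> \<pi> x \<in> carrier A"
  by (rule lin_closed[OF lin_pi])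

definition coR :: "'a set" where
  "coR = {r \<in> carrier A. tensor_map k A A (\<lambda>x. x) \<pi> (comult A r) = tens k A A r \<one>}"

definition Pi' :: "'a \<Rightarrow> 'a" where
  "Pi' x = tsum A (\<lambda>a b. a \<otimes> antipode A (\<pi> b)) (comult A x)"

lemmas lrules = lin_rules lin_apply[OF lin_pi]

lemma lin_Pi: "lin k A A Pi'"
  unfolding Pi'_def[abs_def] by (auto intro!: lrules cl_rules)

lemma Pi_closed [simp, intro]: "x \<in> carrier A \<Longrightarrow> Pi' x \<in> carrier A"
  by (rule lin_closed[OF lin_Pi])

lemmas lrules' = lrules lin_apply[OF lin_Pi]
lemmas lins' = lrules' cl_rules

lemma sw_pi:
  assumes "module k M" "bilin k A A M F" "x \<in> carrier A"
  shows "tsum M (\<lambda>a b. F (\<pi> a) (\<pi> b)) (comult A x) = tsum M F (comult A (\<pi> x))"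
  unfolding pi_comult[OF assms(3)]
  by (rule tsum_tensor_map[OF m1 m1 m1 m1 assms(1) lin_pi lin_pi assms(2)
      comult_closed[OF assms(3)], symmetric])

lemma sw_Pi_pi: "x \<in> carrier A \<Longrightarrow> tsum A (\<lambda>a b. Pi' a \<otimes> \<pi> b) (comult A x) = x"
proof -
  let ?S = "antipode A" and ?D = "comult A" and ?e = "counit A"
  assume x: "x \<in> carrier A"
  have "tsum A (\<lambda>a b. Pi' a \<otimes> \<pi> b) (?D x)
      = tsum A (\<lambda>a b. tsum A (\<lambda>c d. c \<otimes> (?S (\<pi> d) \<otimes> \<pi> b)) (?D a)) (?D x)"
  proof (rule sw_cong[OF m1 _ comult_closed[OF x]])
    fix a b assume ab: "a \<in> carrier A" "b \<in> carrier A"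
    have "Pi' a \<otimes> \<pi> b = tsum A (\<lambda>c d. c \<otimes> ?S (\<pi> d) \<otimes> \<pi> b) (?D a)"
      unfolding Pi'_def by (rule sw_apply[OF m1 m1 _ _ ab(1)]) (use ab in \<open>auto intro!: lins'\<close>)
    also have "\<dots> = tsum A (\<lambda>c d. c \<otimes> (?S (\<pi> d) \<otimes> \<pi> b)) (?D a)"
      by (rule sw_cong[OF m1 _ comult_closed[OF ab(1)]])
          (use ab in \<open>auto intro!: lins' simp: m_assoc\<close>)
    finally show "Pi' a \<otimes> \<pi> b = tsum A (\<lambda>c d. c \<otimes> (?S (\<pi> d) \<otimes> \<pi> b)) (?D a)" .
  qed (auto intro!: lins')
  also have "\<dots> = tsum A (\<lambda>a b. tsum A (\<lambda>c d. a \<otimes> (?S (\<pi> c) \<otimes> \<pi> d)) (?D b)) (?D x)"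
    by (rule sw_coassoc[OF m1 _ _ x]) (auto intro!: lins')
  also have "\<dots> = tsum A (\<lambda>a b. ?e b \<odot> a) (?D x)"
  proof (rule sw_cong[OF m1 _ comult_closed[OF x]])
    fix a b assume ab: "a \<in> carrier A" "b \<in> carrier A"
    have "tsum A (\<lambda>c d. a \<otimes> (?S (\<pi> c) \<otimes> \<pi> d)) (?D b) = a \<otimes> tsum A (\<lambda>c d. ?S (\<pi> c) \<otimes> \<pi> d) (?D b)"
      by (rule sw_apply[OF m1 m1 _ _ ab(2), symmetric]) (use ab in \<open>auto intro!: lins'\<close>)
    also have "tsum A (\<lambda>c d. ?S (\<pi> c) \<otimes> \<pi> d) (?D b) = tsum A (\<lambda>c d. ?S c \<otimes> d) (?D (\<pi> b))"
      by (rule sw_pi[OF m1 _ ab(2)]) (auto intro!: lins')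
    finally show "tsum A (\<lambda>c d. a \<otimes> (?S (\<pi> c) \<otimes> \<pi> d)) (?D b) = ?e b \<odot> a"
      using ab by (simp add: sw_antipode_left pi_counit smult_mult_right)
  qed (auto intro!: lins')
  finally show ?thesis using x by (simp add: sw_counit_right)
qed

lemma coR_carrier: "r \<in> coR \<Longrightarrow> r \<in> carrier A"
  by (simp add: coR_def)

lemma sw_coR:
  assumes "module k M" "bilin k A A M F" "r \<in> coR"
  shows "tsum M (\<lambda>a b. F a (\<pi> b)) (comult A r) = F r \<one>"
proof -
  have r: "r \<in> carrier A" by (rule coR_carrier[OF assms(3)])
  have "tsum M (\<lambda>a b. F a (\<pi> b)) (comult A r) = tsum M F (tensor_map k A A (\<lambda>x. x) \<pi> (comult A r))"
    by (rule tsum_tensor_map[OF m1 m1 m1 m1 assms(1) lin_id lin_pi assms(2) comult_closed[OF r],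
        symmetric])
  also have "\<dots> = F r \<one>" using assms(3) r by (simp add: coR_def tsum_tens[OF m1 m1 assms(1,2)])
  finally show ?thesis .
qed

lemma Pi_coR: "r \<in> coR \<Longrightarrow> Pi' r = r"
  unfolding Pi'_def
  by (subst sw_coR[OF m1, of "\<lambda>a b. a \<otimes> antipode A b"])
      (auto intro!: lins' simp: antipode_one coR_carrier)

lemma Pi_in_coR:
  assumes x: "x \<in> carrier A"
  shows "Pi' x \<in> coR"
proof -
  let ?S = "antipode A" and ?D = "comult A" and ?e = "counit A"
  let ?J = "tensor_map k A A (\<lambda>x. x) \<pi>"
  have lJ: "lin k AA AA ?J" by (rule lin_tensor_map[OF m1 m1 m1 m1 lin_id lin_pi])
  have Jm: "?J (s \<otimes>\<^bsub>AA\<^esub> t) = ?J s \<otimes>\<^bsub>AA\<^esub> ?J t" if "s \<in> carrier AA" "t \<in> carrier AA" for s t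
    by (rule tensor_map_mult[OF ka1 ka1 ka1 ka1 lin_id lin_pi _ pi_mult that]) simp_all
  have JD: "?J (?D a) = tsum AA (\<lambda>p q. tens k A A p (\<pi> q)) (?D a)" for a
    unfolding tensor_map_tsum ..
  let ?t = "\<lambda>b. tsum AA (\<lambda>c d. tens k A A (?S (\<pi> d)) (?S (\<pi> c))) (?D b)"
  have JS: "?J (?D (?S (\<pi> b))) = ?t b" if b: "b \<in> carrier A" for b
  proof -
    have "?J (?D (?S (\<pi> b))) = ?J (tsum AA (\<lambda>c d. tens k A A (?S d) (?S c)) (?D (\<pi> b)))"
      using b by (simp add: comult_antipode)
    also have "\<dots> = tsum AA (\<lambda>c d. ?J (tens k A A (?S d) (?S c))) (?D (\<pi> b))"
      by (rule sw_apply[OF m2 m2 lJ]) (use b in \<open>auto intro!: lins'\<close>)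
    also have "\<dots> = tsum AA (\<lambda>c d. tens k A A (?S d) (\<pi> (?S c))) (?D (\<pi> b))"
      by (rule sw_cong[OF m2]) (use b in
          \<open>auto intro!: lins' lin_apply[OF lJ] simp: tensor_map_tens[OF m1 m1 m1 m1 lin_id lin_pi]\<close>)
    also have "\<dots> = tsum AA (\<lambda>c d. tens k A A (?S (\<pi> d)) (\<pi> (?S (\<pi> c)))) (?D b)"
      by (rule sw_pi[OF m2 _ b, symmetric]) (auto intro!: lins')
    also have "\<dots> = ?t b"
      by (rule sw_cong[OF m2]) (use b in \<open>auto intro!: lins' simp: pi_antipode pi_idem\<close>)
    finally show ?thesis .
  qed
  have "?J (?D (Pi' x)) = tsum AA (\<lambda>a b. ?J (?D (a \<otimes> ?S (\<pi> b)))) (?D x)"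
    unfolding Pi'_def by (rule sw_apply[OF m1 m2 _ _ x]) (auto intro!: lins' lin_apply[OF lJ])
  also have "\<dots> = tsum AA (\<lambda>a b. tsum AA (\<lambda>p q. tens k A A p (\<pi> q)) (?D a) \<otimes>\<^bsub>AA\<^esub> ?t b) (?D x)"
  proof (rule sw_cong[OF m2 _ comult_closed[OF x]])
    fix a b assume ab: "a \<in> carrier A" "b \<in> carrier A"
    show "?J (?D (a \<otimes> ?S (\<pi> b))) = tsum AA (\<lambda>p q. tens k A A p (\<pi> q)) (?D a) \<otimes>\<^bsub>AA\<^esub> ?t b"
      using ab JD[of a] by (simp add: comult_mult Jm JS)
  qed (auto intro!: lins' lin_apply[OF lJ])
  also have "\<dots> = tens k A A (Pi' x) \<one>"
    unfolding Pi'_def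
  proof (rule sw_antipode_telescope[OF lin_pi x])
    fix y assume y: "y \<in> carrier A"
    have "tsum A (\<lambda>a b. \<pi> a \<otimes> ?S (\<pi> b)) (?D y) = tsum A (\<lambda>a b. a \<otimes> ?S b) (?D (\<pi> y))"
      by (rule sw_pi[OF m1 _ y]) (auto intro!: lins')
    then show "tsum A (\<lambda>a b. \<pi> a \<otimes> ?S (\<pi> b)) (?D y) = ?e y \<odot> \<one>"
      using y by (simp add: sw_antipode_right pi_counit)
  qed
  finally show ?thesis using x by (simp add: coR_def)
qed

lemma coR_one: "\<one> \<in> coR"
  by (simp add: coR_def comult_one tensor_algebra_simps
      tensor_map_tens[OF m1 m1 m1 m1 lin_id lin_pi] pi_one)

lemma coR_mult:
  assumes "r \<in> coR" "s \<in> coR" shows "r \<otimes> s \<in> coR"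
proof -
  have "tensor_map k A A (\<lambda>x. x) \<pi> (comult A r \<otimes>\<^bsub>AA\<^esub> comult A s)
     = tensor_map k A A (\<lambda>x. x) \<pi> (comult A r) \<otimes>\<^bsub>AA\<^esub> tensor_map k A A (\<lambda>x. x) \<pi> (comult A s)"
    by (rule tensor_map_mult[OF ka1 ka1 ka1 ka1 lin_id lin_pi _ pi_mult])
        (use assms in \<open>auto simp: coR_def\<close>)
  then show ?thesis using assms by (simp add: coR_def comult_mult mult_tens[OF ka1 ka1])
qed

lemma mult_coR:
  assumes h: "h \<in> carrier A" and r: "r \<in> coR"
  shows "h \<otimes> r = tsum A (\<lambda>a b. Pi' (a \<otimes> r) \<otimes> \<pi> b) (comult A h)"
proof -
  let ?D = "comult A"
  have rA: "r \<in> carrier A" by (rule coR_carrier[OF r])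
  have "h \<otimes> r = tsum A (\<lambda>a b. Pi' a \<otimes> \<pi> b) (?D (h \<otimes> r))"
    using h rA by (simp add: sw_Pi_pi)
  also have "\<dots> = tsum A (\<lambda>a b. tsum A (\<lambda>c d. Pi' (a \<otimes> c) \<otimes> \<pi> (b \<otimes> d)) (?D r)) (?D h)"
    by (rule sw_mult[OF m1 _ h rA]) (auto intro!: lins')
  also have "\<dots> = tsum A (\<lambda>a b. Pi' (a \<otimes> r) \<otimes> \<pi> b) (?D h)"
  proof (rule sw_cong[OF m1 _ comult_closed[OF h]])
    fix a b assume ab: "a \<in> carrier A" "b \<in> carrier A"
    have "tsum A (\<lambda>c d. Pi' (a \<otimes> c) \<otimes> \<pi> (b \<otimes> d)) (?D r)
        = tsum A (\<lambda>c d. Pi' (a \<otimes> c) \<otimes> (\<pi> b \<otimes> \<pi> d)) (?D r)"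
      by (rule sw_cong[OF m1]) (use ab rA in \<open>auto intro!: lins' simp: pi_mult\<close>)
    also have "\<dots> = Pi' (a \<otimes> r) \<otimes> (\<pi> b \<otimes> \<one>)"
      by (rule sw_coR[OF m1 _ r, of "\<lambda>c d. Pi' (a \<otimes> c) \<otimes> (\<pi> b \<otimes> d)"])
          (use ab in \<open>auto intro!: lins'\<close>)
    finally show "tsum A (\<lambda>c d. Pi' (a \<otimes> c) \<otimes> \<pi> (b \<otimes> d)) (?D r) = Pi' (a \<otimes> r) \<otimes> \<pi> b"
      using ab by simp
  qed (use rA in \<open>auto intro!: lins'\<close>)
  finally show ?thesis .
qed

text \<open>The Sweedler form of \<open>\<Delta>(R) \<subseteq> A \<otimes> R\<close>.\<close>

lemma sw_coR_right:
  assumes M: "module k M" and F: "bilin k A A M F" and r: "r \<in> coR"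
  shows "tsum M F (comult A r) = tsum M (\<lambda>a b. F a (Pi' b)) (comult A r)"
proof -
  let ?D = "comult A" and ?S = "antipode A"
  have rA: "r \<in> carrier A" by (rule coR_carrier[OF r])
  note F1 = lin_apply[OF bilinD1[OF F]] and F2 = lin_apply[OF bilinD2[OF F]]
  have F': "bilin k A A M (\<lambda>c d. F a (c \<otimes> ?S (\<pi> d)))" if "a \<in> carrier A" for a
    by (rule lin_comp_bilin[OF bilinD1[OF F that]]) (auto intro!: lins')
  have F'': "lin k A M (\<lambda>a. F a (c \<otimes> ?S (\<pi> d)))" if "c \<in> carrier A" "d \<in> carrier A" for c d
    by (rule bilinD2[OF F]) (use that in auto)
  have "tsum M (\<lambda>a b. F a (Pi' b)) (?D r) = tsum M (\<lambda>a b. tsum M (\<lambda>c d. F a (c \<otimes> ?S (\<pi> d))) (?D b))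
      (?D r)"
  proof (rule sw_cong[OF M bilin_comp[OF F lin_id lin_Pi] comult_closed[OF rA]])
    fix a b assume ab: "a \<in> carrier A" "b \<in> carrier A"
    show "F a (Pi' b) = tsum M (\<lambda>c d. F a (c \<otimes> ?S (\<pi> d))) (?D b)"
      unfolding Pi'_def by (rule sw_apply[OF m1 M bilinD1[OF F ab(1)] _ ab(2)]) (auto intro!: lins')
  qed
  also have "\<dots> = tsum M (\<lambda>a b. tsum M (\<lambda>c d. F c (d \<otimes> ?S (\<pi> b))) (?D a)) (?D r)"
    by (rule sw_coassoc[OF M F' F'' rA, symmetric])
  also have "\<dots> = tsum M (\<lambda>c d. F c (d \<otimes> ?S \<one>)) (?D r)"
  proof (rule sw_coR[OF M _ r, of "\<lambda>a b. tsum M (\<lambda>c d. F c (d \<otimes> ?S b)) (?D a)"], rule bilinI)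
    have i: "bilin k A A M (\<lambda>c d. F c (d \<otimes> ?S b))" if "b \<in> carrier A" for b
      by (rule bilin_comp[OF F lin_id lin_mult_left[OF ka1 lin_id]]) (use that in auto)
    show "lin k A M (\<lambda>b. tsum M (\<lambda>c d. F c (d \<otimes> ?S b)) (?D a))" if "a \<in> carrier A" for a
      by (rule lin_tsum_param[OF m1 m1 M comult_closed[OF that] _ i m1])
         (auto intro!: F1 lins')
    show "lin k A M (\<lambda>a. tsum M (\<lambda>c d. F c (d \<otimes> ?S b)) (?D a))" if "b \<in> carrier A" for b
      by (rule lin_tsum_arg[OF m1 m1 M i[OF that] lin_comult])
  qed
  also have "\<dots> = tsum M F (?D r)"
    by (rule sw_cong[OF M F comult_closed[OF rA], symmetric]) (simp add: antipode_one)
  finally show ?thesis by simp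
qed

text \<open>The R-matrix enters here: \<open>r\<^sub>2 \<otimes> \<pi>(r\<^sub>1) = \<R> (r \<otimes> 1) \<R>\<^sup>-\<^sup>1\<close> has its second leg in \<open>B\<close>.\<close>

lemma pi_coR_in_B:
  assumes p: "lin k A A p" "\<And>x. x \<in> B \<Longrightarrow> p x = x"
    and M: "module k M" and F: "bilin k A A M F" and r: "r \<in> coR"
  shows "tsum M (\<lambda>a b. F (\<pi> a) b) (comult A r) = tsum M (\<lambda>a b. F (p (\<pi> a)) b) (comult A r)"
proof -
  let ?D = "comult A" and ?R = "rmat A"
  let ?J = "tensor_map k A A (\<lambda>x. x) \<pi>"
  have rA: "r \<in> carrier A" by (rule coR_carrier[OF r])
  have pc: "p x \<in> carrier A" if "x \<in> carrier A" for x by (rule lin_closed[OF p(1) that])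
  have lJ: "lin k AA AA ?J" by (rule lin_tensor_map[OF m1 m1 m1 m1 lin_id lin_pi])
  have Jm: "?J (s \<otimes>\<^bsub>AA\<^esub> t) = ?J s \<otimes>\<^bsub>AA\<^esub> ?J t" if "s \<in> carrier AA" "t \<in> carrier AA" for s t
    by (rule tensor_map_mult[OF ka1 ka1 ka1 ka1 lin_id lin_pi _ pi_mult that]) simp_all
  have JB: "?J s = s" if "s \<in> sub_tensors k A B" for s
    by (rule SB.retract_sub_tensors[OF lin_id _ lin_pi pi_B that]) simp_all
  have iB: "rmat_inv \<in> sub_tensors k A B"
    unfolding rmat_inv_def tensor_map_tsum
    by (rule SB.tsum_sub_in_submodule[OF m2 bilin_comp[OF bilin_tens[OF m1 m1] lin_antipode lin_id]
        SB.submodule_sub_tensors rmat_B])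
       (auto intro!: SB.sub_tensors_tens B_closed)
  note iA = rmat_inv_closed
  have Jop: "?J (comult_op k A r) = ?R \<otimes>\<^bsub>AA\<^esub> tens k A A r \<one> \<otimes>\<^bsub>AA\<^esub> rmat_inv"
    using r rA iA by (simp add: rmat_comult_op inv_rmat Jm JB iB rmat_B coR_def)
  let ?P = "tensor_map k A A (\<lambda>x. x) p"
  have lP: "lin k AA AA ?P" by (rule lin_tensor_map[OF m1 m1 m1 m1 lin_id p(1)])
  have Pt: "?P (tens k A A x y) = tens k A A x (p y)" if "x \<in> carrier A" "y \<in> carrier A" for x y
    by (rule tensor_map_tens[OF m1 m1 m1 m1 lin_id p(1) that])
  have tc: "tens k A A r \<one> \<in> carrier AA" using rA by (simp add: tens_closed[OF m1 m1])
  have "?P (s \<otimes>\<^bsub>AA\<^esub> tens k A A r \<one> \<otimes>\<^bsub>AA\<^esub> u) = s \<otimes>\<^bsub>AA\<^esub> tens k A A r \<one> \<otimes>\<^bsub>AA\<^esub> u"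
    if s: "s \<in> sub_tensors k A B" and u: "u \<in> sub_tensors k A B" for s u
    using s
  proof (induction s rule: SB.sub_tensors_induct)
    case (pure a b)
    show ?case using u
    proof (induction u rule: SB.sub_tensors_induct)
      case (pure c d)
      then show ?case using \<open>a \<in> B\<close> \<open>b \<in> B\<close> rA
        by (simp add: mult_tens[OF ka1 ka1] B_carrier Pt p(2) B_closed)
    next
      case (add u v)
      moreover have "tens k A A a b \<otimes>\<^bsub>AA\<^esub> tens k A A r \<one> \<in> carrier AA"
        using pure B_carrier tc by (simp add: tens_closed[OF m1 m1])
      ultimately show ?case using SB.sub_tensors_carrier by (simp add: AA.r_distr lin_add[OF lP])
    qed
  next
    case (add s t)
    then show ?case using SB.sub_tensors_carrier tc u by (simp add: AA.l_distr lin_add[OF lP])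
  qed
  then have PJ: "?P (?J (comult_op k A r)) = ?J (comult_op k A r)"
    unfolding Jop using rmat_B iB by blast
  have op: "comult_op k A r = tsum AA (\<lambda>a b. tens k A A b a) (?D r)"
    by (simp add: comult_op_def tensor_lift_tens_grp)
  have bf: "bilin k A A AA (\<lambda>a b. tens k A A b a)" by (rule bilin_flip[OF bilin_tens[OF m1 m1]])
  have b1: "bilin k A A AA (\<lambda>a b. tens k A A b (\<pi> a))" by (auto intro!: lins')
  have b2: "bilin k A A AA (\<lambda>a b. tens k A A b (p (\<pi> a)))"
    by (rule bilin_comp[OF bf lin_comp[OF lin_pi p(1)] lin_id])
  have J': "?J (comult_op k A r) = tsum AA (\<lambda>a b. tens k A A b (\<pi> a)) (?D r)"
    unfolding op
    by (subst sw_apply[OF m2 m2 lJ bf rA], rule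
        sw_cong[OF m2 lin_comp_bilin[OF lJ bf] comult_closed[OF rA]])
       (simp add: tensor_map_tens[OF m1 m1 m1 m1 lin_id lin_pi])
  have P': "?P (tsum AA (\<lambda>a b. tens k A A b (\<pi> a)) (?D r))
      = tsum AA (\<lambda>a b. tens k A A b (p (\<pi> a))) (?D r)"
    by (subst sw_apply[OF m2 m2 lP b1 rA], rule
        sw_cong[OF m2 lin_comp_bilin[OF lP b1] comult_closed[OF rA]])
       (simp add: Pt)
  have eq: "tsum AA (\<lambda>a b. tens k A A b (p (\<pi> a))) (?D r)
      = tsum AA (\<lambda>a b. tens k A A b (\<pi> a)) (?D r)"
    using PJ unfolding J' P' .
  let ?g = "tsum M (\<lambda>b a. F a b)"
  note Ff = bilin_flip[OF F]
  have lg: "lin k AA M ?g" by (rule tsum_lin[OF m1 m1 M Ff])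
  have "?g (tsum AA (\<lambda>a b. tens k A A b (\<pi> a)) (?D r)) = tsum M (\<lambda>a b. F (\<pi> a) b) (?D r)"
    by (subst sw_apply[OF m2 M lg b1 rA], rule
        sw_cong[OF M lin_comp_bilin[OF lg b1] comult_closed[OF rA]])
       (simp add: tsum_tens[OF m1 m1 M Ff])
  moreover have "?g (tsum AA (\<lambda>a b. tens k A A b (p (\<pi> a))) (?D r))
      = tsum M (\<lambda>a b. F (p (\<pi> a)) b) (?D r)"
    by (subst sw_apply[OF m2 M lg b2 rA], rule
        sw_cong[OF M lin_comp_bilin[OF lg b2] comult_closed[OF rA]])
       (simp add: tsum_tens[OF m1 m1 M Ff] pc)
  ultimately show ?thesis using eq by simp
qed

end

context hopf_proj
begin

definition K :: "'a set" where "K = product_span k A coR B"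

lemma K_Inter: "K = \<Inter>{W. submodule W k A \<and> {r \<otimes> b | r b. r \<in> coR \<and> b \<in> B} \<subseteq> W}"
  unfolding K_def product_span_def hull_def by simp

lemma K_gen: "\<lbrakk>r \<in> coR; b \<in> B\<rbrakk> \<Longrightarrow> r \<otimes> b \<in> K"
  unfolding K_Inter by blast

lemma K_submodule: "submodule K k A"
  unfolding K_Inter
proof (rule submodule_Inter[OF m1])
  have "carrier A \<in> {W. submodule W k A \<and> {r \<otimes> b | r b. r \<in> coR \<and> b \<in> B} \<subseteq> W}"
    using carrier_is_submodule coR_carrier B_carrier by auto
  then show "{W. submodule W k A \<and> {r \<otimes> b | r b. r \<in> coR \<and> b \<in> B} \<subseteq> W} \<noteq> {}" by blast
qed simp

lemma K_minimal:
  assumes "x \<in> K" "submodule W k A" "\<And>r b. \<lbrakk>r \<in> coR; b \<in> B\<rbrakk> \<Longrightarrow> r \<otimes> b \<in> W"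
  shows "x \<in> W"
proof -
  have "{r \<otimes> b | r b. r \<in> coR \<and> b \<in> B} \<subseteq> W" using assms(3) by auto
  then show ?thesis using assms(1,2) unfolding K_Inter by (auto dest!: InterD[where X = W])
qed

lemma K_carrier: "x \<in> K \<Longrightarrow> x \<in> carrier A"
  by (rule submodule_subset[OF K_submodule])

lemma coR_K: "r \<in> coR \<Longrightarrow> r \<in> K"
  using K_gen[of r \<one>] B_closed(1) by (simp add: coR_carrier)

lemma B_K: "b \<in> B \<Longrightarrow> b \<in> K"
  using K_gen[of \<one> b] coR_one by (simp add: B_carrier)

lemma coR_mult_K:
  assumes r: "r \<in> coR" and x: "x \<in> K" shows "r \<otimes> x \<in> K"
proof -
  have "lin k A A (\<lambda>x. r \<otimes> x)" using coR_carrier[OF r] by (auto intro!: lrules')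
  from lin_vimage_submodule[OF m1 m1 this K_submodule]
  have "x \<in> {x \<in> carrier A. r \<otimes> x \<in> K}"
    by (rule K_minimal[OF x])
       (use r in \<open>auto simp: coR_carrier B_carrier m_assoc[symmetric] intro: K_gen coR_mult\<close>)
  then show ?thesis by simp
qed

lemma K_mult_B:
  assumes b: "b \<in> B" and x: "x \<in> K" shows "x \<otimes> b \<in> K"
proof -
  have "lin k A A (\<lambda>x. x \<otimes> b)" using B_carrier[OF b] by (auto intro!: lrules')
  from lin_vimage_submodule[OF m1 m1 this K_submodule]
  have "x \<in> {x \<in> carrier A. x \<otimes> b \<in> K}"
    by (rule K_minimal[OF x])
       (use b in \<open>auto simp: coR_carrier B_carrier m_assoc intro: K_gen B_closed\<close>)
  then show ?thesis by simp
qed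

lemma B_mult_coR:
  assumes b: "b \<in> B" and r: "r \<in> coR" shows "b \<otimes> r \<in> K"
proof -
  have "tsum A (\<lambda>c d. Pi' (c \<otimes> r) \<otimes> \<pi> d) (comult A b) \<in> K"
    by (rule SB.tsum_sub_in_submodule[OF m1 _ K_submodule B_closed(3)[OF b]])
       (use coR_carrier[OF r] in \<open>auto intro!: lins' K_gen Pi_in_coR simp: B_carrier pi_B\<close>)
  then show ?thesis using mult_coR[OF B_carrier[OF b] r] by simp
qed

lemma B_mult_K:
  assumes b: "b \<in> B" and x: "x \<in> K" shows "b \<otimes> x \<in> K"
proof -
  have "lin k A A (\<lambda>x. b \<otimes> x)" using B_carrier[OF b] by (auto intro!: lrules')
  from lin_vimage_submodule[OF m1 m1 this K_submodule]
  have "x \<in> {x \<in> carrier A. b \<otimes> x \<in> K}"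
    by (rule K_minimal[OF x])
       (use b in \<open>auto simp: coR_carrier B_carrier m_assoc[symmetric] intro: K_mult_B B_mult_coR\<close>)
  then show ?thesis by simp
qed

lemma K_mult:
  assumes x: "x \<in> K" and y: "y \<in> K" shows "x \<otimes> y \<in> K"
proof -
  have "lin k A A (\<lambda>x. x \<otimes> y)" using K_carrier[OF y] by (auto intro!: lrules')
  from lin_vimage_submodule[OF m1 m1 this K_submodule]
  have "x \<in> {x \<in> carrier A. x \<otimes> y \<in> K}"
    by (rule K_minimal[OF x])
       (use y in \<open>auto simp: coR_carrier B_carrier K_carrier m_assoc intro: coR_mult_K B_mult_K\<close>)
  then show ?thesis by simp
qed

sublocale SK: subspace k A K by (rule subspaceI[OF K_submodule])

lemma comult_coR_K:
  assumes r: "r \<in> coR" shows "comult A r \<in> sub_tensors k A K"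
proof -
  let ?D = "comult A"
  obtain p where p: "lin k A A p" "\<And>x. x \<in> carrier A \<Longrightarrow> p x \<in> B" "\<And>x. x \<in> B \<Longrightarrow> p x = x"
    by (rule retraction_exists[OF k.field_axioms m1 B_submodule]) blast
  note lr = lrules' lin_apply[OF p(1)]
  have rA: "r \<in> carrier A" by (rule coR_carrier[OF r])
  have bl: "bilin k A A AA (\<lambda>a b. tsum AA (\<lambda>c d. tens k A A (Pi' a \<otimes> \<pi> c) d) (?D b))"
    by (auto intro!: lr cl_rules)
  have inner: "tsum AA (\<lambda>c d. tens k A A (Pi' a \<otimes> \<pi> c) d) (?D s) \<in> sub_tensors k A K"
    if a: "a \<in> carrier A" and s: "s \<in> coR" for a s
  proof -
    have "tsum AA (\<lambda>c d. tens k A A (Pi' a \<otimes> \<pi> c) d) (?D s)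
        = tsum AA (\<lambda>c d. tens k A A (Pi' a \<otimes> \<pi> c) (Pi' d)) (?D s)"
      by (rule sw_coR_right[OF m2 _ s]) (use a in \<open>auto intro!: lr cl_rules\<close>)
    also have "\<dots> = tsum AA (\<lambda>c d. tens k A A (Pi' a \<otimes> p (\<pi> c)) (Pi' d)) (?D s)"
      by (rule pi_coR_in_B[OF p(1,3) m2 _ s, of "\<lambda>c d. tens k A A (Pi' a \<otimes> c) (Pi' d)"])
         (use a in \<open>auto intro!: lr cl_rules\<close>)
    also have "\<dots> \<in> sub_tensors k A K"
      by (rule tsum_in_submodule[OF m1 m1 m2 _ SK.submodule_sub_tensors
          comult_closed[OF coR_carrier[OF s]]],
          (use a in \<open>auto intro!: lr cl_rules simp: lin_closed[OF p(1)]\<close>)[1],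
          rule SK.sub_tensors_tens[OF K_gen[OF Pi_in_coR[OF a] p(2)] coR_K[OF Pi_in_coR]]) auto
    finally show ?thesis .
  qed
  have "?D r = tsum AA (tens k A A) (?D r)"
    using rA by (simp add: tsum_tens_self[OF m1 m1])
  also have "\<dots> = tsum AA (\<lambda>a b. tsum AA (\<lambda>c d. tens k A A (Pi' c \<otimes> \<pi> d) b) (?D a)) (?D r)"
  proof (rule sw_cong[OF m2 bilin_tens[OF m1 m1] comult_closed[OF rA]])
    fix a b assume ab: "a \<in> carrier A" "b \<in> carrier A"
    have "tens k A A (tsum A (\<lambda>c d. Pi' c \<otimes> \<pi> d) (?D a)) b
        = tsum AA (\<lambda>c d. tens k A A (Pi' c \<otimes> \<pi> d) b) (?D a)"
      by (rule sw_apply[OF m1 m2 _ _ ab(1)]) (use ab in \<open>auto intro!: lr cl_rules\<close>)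
    then show "tens k A A a b = tsum AA (\<lambda>c d. tens k A A (Pi' c \<otimes> \<pi> d) b) (?D a)"
      using ab by (simp add: sw_Pi_pi)
  qed
  also have "\<dots> = tsum AA (\<lambda>a b. tsum AA (\<lambda>c d. tens k A A (Pi' a \<otimes> \<pi> c) d) (?D b)) (?D r)"
    by (rule sw_coassoc[OF m2 _ _ rA]) (auto intro!: lr cl_rules)
  also have "\<dots> = tsum AA (\<lambda>a b. tsum AA (\<lambda>c d. tens k A A (Pi' a \<otimes> \<pi> c) d) (?D (Pi' b))) (?D r)"
    by (rule sw_coR_right[OF m2 bl r])
  also have "\<dots> \<in> sub_tensors k A K"
    by (rule tsum_in_submodule[OF m1 m1 m2 bilin_comp[OF bl lin_id lin_Pi] SK.submodule_sub_tensors
        comult_closed[OF rA]])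
       (rule inner[OF _ Pi_in_coR])
  finally show ?thesis .
qed

lemma sub_tensors_mult:
  assumes L: "submodule L k A" "\<And>x y. \<lbrakk>x \<in> L; y \<in> L\<rbrakk> \<Longrightarrow> x \<otimes> y \<in> L"
    and s: "s \<in> sub_tensors k A L" and t: "t \<in> sub_tensors k A L"
  shows "s \<otimes>\<^bsub>AA\<^esub> t \<in> sub_tensors k A L"
proof -
  interpret S: subspace k A L by (rule subspaceI[OF L(1)])
  note LA = submodule_subset[OF L(1)]
  show ?thesis using s
  proof (induction s rule: S.sub_tensors_induct)
    case (pure a b)
    show ?case using t
    proof (induction t rule: S.sub_tensors_induct)
      case (pure c d)
      then show ?case using \<open>a \<in> L\<close> \<open>b \<in> L\<close> LA
          by (simp add: mult_tens[OF ka1 ka1] S.sub_tensors_tens L(2))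
    next
      case (add t u)
      then show ?case using pure LA S.sub_tensors_carrier
        by (simp add: AA.r_distr tens_closed[OF m1 m1] submodule_add[OF S.submodule_sub_tensors])
    qed
  next
    case (add s u)
    then show ?case using t S.sub_tensors_carrier
      by (simp add: AA.l_distr submodule_add[OF S.submodule_sub_tensors])
  qed
qed

lemma B_sub_K: "t \<in> sub_tensors k A B \<Longrightarrow> t \<in> sub_tensors k A K"
  by (induction t rule: SB.sub_tensors_induct)
     (auto intro: SK.sub_tensors_tens B_K submodule_add[OF SK.submodule_sub_tensors])

lemma comult_K:
  assumes x: "x \<in> K" shows "comult A x \<in> sub_tensors k A K"
proof -
  from lin_vimage_submodule[OF m1 m2 lin_comult SK.submodule_sub_tensors]
  have "x \<in> {x \<in> carrier A. comult A x \<in> sub_tensors k A K}"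
    by (rule K_minimal[OF x])
       (simp add: coR_carrier B_carrier comult_mult sub_tensors_mult[OF K_submodule K_mult]
           comult_coR_K B_sub_K B_closed)
  then show ?thesis by simp
qed

lemma sw_antipode:
  assumes "module k M" "bilin k A A M F" "x \<in> carrier A"
  shows "tsum M F (comult A (antipode A x)) = tsum M (\<lambda>a b. F (antipode A b) (antipode A a))
      (comult A x)"
proof -
  have b: "bilin k A A AA (\<lambda>a b. tens k A A (antipode A b) (antipode A a))" by (auto intro!: lins')
  note l = tsum_lin[OF m1 m1 assms(1,2)]
  show ?thesis
    unfolding comult_antipode[OF assms(3)]
    by (subst sw_apply[OF m2 assms(1) l b assms(3)],
        rule sw_cong[OF assms(1) lin_comp_bilin[OF l b] comult_closed[OF assms(3)]])
       (simp add: tsum_tens[OF m1 m1 assms(1,2)])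
qed

lemma antipode_coR_K:
  assumes r: "r \<in> coR" shows "antipode A r \<in> K"
proof -
  let ?D = "comult A" and ?S = "antipode A"
  obtain p where p: "lin k A A p" "\<And>x. x \<in> carrier A \<Longrightarrow> p x \<in> B" "\<And>x. x \<in> B \<Longrightarrow> p x = x"
    by (rule retraction_exists[OF k.field_axioms m1 B_submodule]) blast
  note lr = lrules' lin_apply[OF p(1)]
  have rA: "r \<in> carrier A" by (rule coR_carrier[OF r])
  have "?S r = tsum A (\<lambda>a b. Pi' a \<otimes> \<pi> b) (?D (?S r))"
    using rA by (simp add: sw_Pi_pi)
  also have "\<dots> = tsum A (\<lambda>a b. Pi' (?S b) \<otimes> \<pi> (?S a)) (?D r)"
    by (rule sw_antipode[OF m1 _ rA]) (auto intro!: lr cl_rules)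
  also have "\<dots> = tsum A (\<lambda>a b. Pi' (?S b) \<otimes> ?S (\<pi> a)) (?D r)"
    by (rule sw_cong[OF m1 _ comult_closed[OF rA]]) (auto intro!: lr cl_rules simp: pi_antipode)
  also have "\<dots> = tsum A (\<lambda>a b. Pi' (?S b) \<otimes> ?S (p (\<pi> a))) (?D r)"
    by (rule pi_coR_in_B[OF p(1,3) m1 _ r, of "\<lambda>a b. Pi' (?S b) \<otimes> ?S a"]) (auto intro!: lr cl_rules)
  also have "\<dots> \<in> K"
    by (rule tsum_in_submodule[OF m1 m1 m1 _ K_submodule comult_closed[OF rA]],
        (auto intro!: lr cl_rules simp: lin_closed[OF p(1)])[1],
        rule K_gen[OF Pi_in_coR B_closed(4)[OF p(2)]]) auto
  finally show ?thesis .
qed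

lemma antipode_K:
  assumes x: "x \<in> K" shows "antipode A x \<in> K"
proof -
  from lin_vimage_submodule[OF m1 m1 lin_antipode K_submodule]
  have "x \<in> {x \<in> carrier A. antipode A x \<in> K}"
    by (rule K_minimal[OF x])
       (simp add: coR_carrier B_carrier antipode_mult B_mult_K antipode_coR_K B_closed)
  then show ?thesis by simp
qed

lemma hopf_K: "hopf_subalgebra k A K"
  by (rule hopf_subalgebraI[OF K_submodule _ K_mult comult_K antipode_K]) (rule coR_K[OF coR_one])

lemma qt_K: "qt_hopf_subalgebra k A K"
  by (rule qt_hopf_subalgebraI[OF hopf_K B_sub_K[OF rmat_B]])

lemma Pi_mult_coR:
  assumes r: "r \<in> coR" and x: "x \<in> carrier A" shows "Pi' (r \<otimes> x) = r \<otimes> Pi' x"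
proof -
  let ?D = "comult A" and ?S = "antipode A"
  have rA: "r \<in> carrier A" by (rule coR_carrier[OF r])
  have "Pi' (r \<otimes> x) = tsum A (\<lambda>a b. tsum A (\<lambda>c d. (a \<otimes> c) \<otimes> ?S (\<pi> (b \<otimes> d))) (?D x)) (?D r)"
    unfolding Pi'_def by (rule sw_mult[OF m1 _ rA x]) (auto intro!: lins')
  also have "\<dots> = tsum A (\<lambda>a b. tsum A (\<lambda>c d. (a \<otimes> c) \<otimes> (?S (\<pi> d) \<otimes> ?S (\<pi> b))) (?D x)) (?D r)"
    by (rule sw_cong[OF m1 _ comult_closed[OF rA]], (use x in \<open>auto intro!: lins'\<close>)[1],
        rule sw_cong[OF m1 _ comult_closed[OF x]])
       (auto intro!: lins' simp: pi_mult antipode_mult)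
  also have "\<dots> = tsum A (\<lambda>c d. (r \<otimes> c) \<otimes> (?S (\<pi> d) \<otimes> ?S \<one>)) (?D x)"
    by (rule sw_coR[OF m1 _ r, of "\<lambda>a b. tsum A (\<lambda>c d. (a \<otimes> c) \<otimes> (?S (\<pi> d) \<otimes> ?S b)) (?D x)"])
       (use x in \<open>auto intro!: lins'\<close>)
  also have "\<dots> = tsum A (\<lambda>c d. r \<otimes> (c \<otimes> ?S (\<pi> d))) (?D x)"
    by (rule sw_cong[OF m1 _ comult_closed[OF x]])
       (use rA in \<open>auto intro!: lins' simp: antipode_one m_assoc\<close>)
  also have "\<dots> = r \<otimes> Pi' x"
    unfolding Pi'_def by (rule sw_apply[OF m1 m1 _ _ x, symmetric]) (use rA in \<open>auto intro!: lins'\<close>)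
  finally show ?thesis .
qed

lemma Pi_pi: "x \<in> carrier A \<Longrightarrow> Pi' (\<pi> x) = counit A x \<odot> \<one>"
proof -
  assume x: "x \<in> carrier A"
  have b: "bilin k A A A (\<lambda>a b. a \<otimes> antipode A (\<pi> b))" by (auto intro!: lins')
  have "Pi' (\<pi> x) = tsum A (\<lambda>a b. \<pi> a \<otimes> antipode A (\<pi> (\<pi> b))) (comult A x)"
    unfolding Pi'_def by (rule sw_pi[OF m1 b x, symmetric])
  also have "\<dots> = tsum A (\<lambda>a b. \<pi> a \<otimes> antipode A (\<pi> b)) (comult A x)"
    by (rule sw_cong[OF m1]) (use x in \<open>auto intro!: lins' simp: pi_idem\<close>)
  also have "\<dots> = tsum A (\<lambda>a b. a \<otimes> antipode A b) (comult A (\<pi> x))"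
    by (rule sw_pi[OF m1 _ x]) (auto intro!: lins')
  finally show ?thesis using x by (simp add: sw_antipode_right pi_counit)
qed

lemma tensor_map_Pi_pi:
  assumes r: "r \<in> coR" and h: "h \<in> carrier A" "\<pi> h = h"
  shows "tensor_map k A A Pi' \<pi> (comult A (r \<otimes> h)) = tens k A A r h"
proof -
  let ?D = "comult A"
  have rA: "r \<in> carrier A" by (rule coR_carrier[OF r])
  have "tensor_map k A A Pi' \<pi> (?D (r \<otimes> h))
      = tsum AA (\<lambda>a b. tsum AA (\<lambda>c d. tens k A A (Pi' (a \<otimes> c)) (\<pi> (b \<otimes> d))) (?D h)) (?D r)"
    unfolding tensor_map_tsum by (rule sw_mult[OF m2 _ rA h(1)]) (auto intro!: lins')
  also have "\<dots> = tsum AA (\<lambda>a b. tsum AA (\<lambda>c d. tens k A A (Pi' (a \<otimes> c)) (\<pi> b \<otimes> \<pi> d)) (?D h)) (?D r)"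
    by (rule sw_cong[OF m2 _ comult_closed[OF rA]], (use h in \<open>auto intro!: lins'\<close>)[1],
        rule sw_cong[OF m2 _ comult_closed[OF h(1)]])
       (auto intro!: lins' simp: pi_mult)
  also have "\<dots> = tsum AA (\<lambda>c d. tens k A A (Pi' (r \<otimes> c)) (\<one> \<otimes> \<pi> d)) (?D h)"
    by (rule sw_coR[OF m2 _ r, of "\<lambda>a b. tsum AA (\<lambda>c d. tens k A A (Pi' (a \<otimes> c)) (b \<otimes> \<pi> d))
        (?D h)"])
       (use h in \<open>auto intro!: lins'\<close>)
  also have "\<dots> = tsum AA (\<lambda>c d. tens k A A (r \<otimes> Pi' c) (\<pi> d)) (?D h)"
    by (rule sw_cong[OF m2 _ comult_closed[OF h(1)]])
        (use rA in \<open>auto intro!: lins' simp: Pi_mult_coR[OF r]\<close>)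
  also have "\<dots> = tsum AA (\<lambda>c d. tens k A A (r \<otimes> Pi' c) (\<pi> d)) (?D (\<pi> h))"
    using h(2) by simp
  also have "\<dots> = tsum AA (\<lambda>c d. tens k A A (r \<otimes> Pi' (\<pi> c)) (\<pi> (\<pi> d))) (?D h)"
    by (rule sw_pi[OF m2 _ h(1), symmetric]) (use rA in \<open>auto intro!: lins'\<close>)
  also have "\<dots> = tsum AA (\<lambda>c d. counit A c \<odot>\<^bsub>AA\<^esub> tens k A A r (\<pi> d)) (?D h)"
    by (rule sw_cong[OF m2 _ comult_closed[OF h(1)]])
       (use rA in \<open>auto intro!: lins' simp: Pi_pi pi_idem smult_mult_right
           lin_smult[OF bilinD2[OF bilin_tens[OF m1 m1]]]\<close>)
  also have "\<dots> = tens k A A r (\<pi> h)"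
    by (rule sw_counit_left'[OF m2 _ h(1)]) (use rA in \<open>auto intro!: lins'\<close>)
  finally show ?thesis using h(2) by simp
qed

lemma act_left_Pi:
  assumes h: "h \<in> carrier A" and w: "w \<in> carrier A"
  shows "act_left A \<pi> h w = Pi' (h \<otimes> w)"
proof -
  let ?D = "comult A" and ?S = "antipode A"
  have "Pi' (h \<otimes> w) = tsum A (\<lambda>a b. tsum A (\<lambda>c d. (a \<otimes> c) \<otimes> ?S (\<pi> (b \<otimes> d))) (?D w)) (?D h)"
    unfolding Pi'_def by (rule sw_mult[OF m1 _ h w]) (auto intro!: lins')
  also have "\<dots> = tsum A (\<lambda>a b. tsum A (\<lambda>c d. a \<otimes> c \<otimes> ?S (\<pi> d) \<otimes> ?S (\<pi> b)) (?D w)) (?D h)"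
    by (rule sw_cong[OF m1 _ comult_closed[OF h]], (use w in \<open>auto intro!: lins'\<close>)[1],
        rule sw_cong[OF m1 _ comult_closed[OF w]])
       (auto intro!: lins' simp: pi_mult antipode_mult m_assoc)
  finally show ?thesis unfolding act_left_def tsum_def[symmetric] by simp
qed

end

lemma sub_natural:
  assumes A: "qt_hopf_algebra k A" and L: "hopf_subalgebra k A L" and M: "module k M" and N:
      "module k N"
    and g: "lin k M N g" and F: "bilin k (sub_qt k A L) (sub_qt k A L) M F" and G: "bilin k A A N G"
    and t: "t \<in> sub_tensors k A L" and eq: "\<And>a b. \<lbrakk>a \<in> L; b \<in> L\<rbrakk> \<Longrightarrow> g (F a b) = G a b"
  shows "g (tsum M F (restrict_tensor k A L t)) = tsum N G t"
proof -
  interpret A: qt_hopf_algebra k A by fact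
  note D = hopf_subalgebraD[OF L]
  interpret S: subspace k A L by (rule A.subspaceI[OF D(1)])
  have mL: "module k (sub_qt k A L)" by (rule module_sub_qt[OF A.m1 D(1)])
  have i: "lin k (sub_qt k A L) A (\<lambda>x. x)" by (rule linI) (auto intro: submodule_subset[OF D(1)])
  have "g (tsum M F (restrict_tensor k A L t))
      = tsum N G (tensor_map k A A (\<lambda>x. x) (\<lambda>x. x) (restrict_tensor k A L t))"
    by (rule tsum_natural[OF mL mL A.m1 A.m1 M N i i g F G])
       (use t eq in \<open>simp_all add: tensor_algebra_sub S.restrict_closed\<close>)
  then show ?thesis using S.incl_restrict[OF t] by (simp add: tensor_incl_def)
qed

section \<open>The relative tensor product\<close>

locale hopf_proj_sub = hopf_proj k A \<pi> B
  for k :: "('k, 'l) ring_scheme" and A :: "('k, 'a, 'm) qt_hopf_scheme" (structure)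
    and \<pi> :: "'a \<Rightarrow> 'a" and B :: "'a set" +
  fixes H :: "'a set"
  assumes hopf_H: "hopf_subalgebra k A H"
    and pi_H: "x \<in> carrier A \<Longrightarrow> \<pi> x \<in> H"
    and pi_on_H: "h \<in> H \<Longrightarrow> \<pi> h = h"
    and B_H: "b \<in> B \<Longrightarrow> b \<in> H"
begin

lemmas H_submodule = hopf_subalgebraD(1)[OF hopf_H]
lemmas H_closed = hopf_subalgebraD(2-5)[OF hopf_H] submodule_closed[OF H_submodule]
lemmas K_closed = hopf_subalgebraD(2-5)[OF hopf_K] submodule_closed[OF K_submodule]
lemmas H_carrier = submodule_subset[OF H_submodule]

sublocale SH: subspace k A H by (rule subspaceI[OF H_submodule])

interpretation MK: module k "A\<lparr>carrier := K\<rparr>" by (rule SK.mL)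
interpretation MH: module k "A\<lparr>carrier := H\<rparr>" by (rule SH.mL)

sublocale BT: balanced_tensor B "(\<otimes>)" "(\<otimes>)" "A\<lparr>carrier := K\<rparr>" "A\<lparr>carrier := H\<rparr>"
  by (intro balanced_tensor.intro balanced_tensor_axioms.intro MK.abelian_group_axioms
      MH.abelian_group_axioms)
     (auto intro: K_mult_B H_closed B_H)

abbreviation "rt \<equiv> rel_tens A B K H"
abbreviation "G \<equiv> rel_tens_grp A B K H"

lemma rt_eq: "rt = BT.pt" and G_eq: "G = BT.T"
  unfolding rel_tens_def rel_tens_grp_def by simp_all

lemma rt_closed: "\<lbrakk>w \<in> K; h \<in> H\<rbrakk> \<Longrightarrow> rt w h \<in> carrier G"
  and rt_add_left: "\<lbrakk>w \<in> K; w' \<in> K; h \<in> H\<rbrakk> \<Longrightarrow> rt (w \<oplus> w') h = rt w h \<otimes>\<^bsub>G\<^esub> rt w' h"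
  and rt_add_right: "\<lbrakk>w \<in> K; h \<in> H; h' \<in> H\<rbrakk> \<Longrightarrow> rt w (h \<oplus> h') = rt w h \<otimes>\<^bsub>G\<^esub> rt w h'"
  and rt_balance: "\<lbrakk>w \<in> K; b \<in> B; h \<in> H\<rbrakk> \<Longrightarrow> rt (w \<otimes> b) h = rt w (b \<otimes> h)"
  and rt_zero: "h \<in> H \<Longrightarrow> rt \<zero> h = \<one>\<^bsub>G\<^esub>"
  unfolding rt_eq G_eq
  using BT.pure_closed BT.pure_add_left BT.pure_add_right BT.pure_balance BT.pure_zero_left
      by simp_all

lemma G_comm_group: "comm_group G"
  unfolding G_eq by (rule BT.comm_group_tensor)

sublocale G: comm_group G by (rule G_comm_group)

definition \<phi> :: "('a, 'a) tensor \<Rightarrow> 'a" where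
  "\<phi> = tensor_lift (add_monoid A) (\<otimes>)"

definition \<psi> :: "'a \<Rightarrow> ('a, 'a) tensor" where
  "\<psi> x = tensor_lift G (\<lambda>a b. rt (Pi' a) (\<pi> b)) (comult A x)"

interpretation L\<phi>: balanced_lift B "(\<otimes>)" "(\<otimes>)" "A\<lparr>carrier := K\<rparr>" "A\<lparr>carrier := H\<rparr>" "add_monoid A"
    "(\<otimes>)"
  by (intro balanced_lift.intro balanced_lift_axioms.intro BT.balanced_tensor_axioms a_comm_group)
     (auto simp: balanced_map_def K_carrier H_carrier B_carrier l_distr r_distr m_assoc)

lemma phi_closed: "t \<in> carrier G \<Longrightarrow> \<phi> t \<in> carrier A"
  and phi_add: "\<lbrakk>s \<in> carrier G; t \<in> carrier G\<rbrakk> \<Longrightarrow> \<phi> (s \<otimes>\<^bsub>G\<^esub> t) = \<phi> s \<oplus> \<phi> t"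
  and phi_rt: "\<lbrakk>w \<in> K; h \<in> H\<rbrakk> \<Longrightarrow> \<phi> (rt w h) = w \<otimes> h"
  unfolding \<phi>_def G_eq rt_eq
  using hom_in_carrier[OF L\<phi>.tensor_lift_hom] hom_mult[OF L\<phi>.tensor_lift_hom] L\<phi>.tensor_lift_pure
      by simp_all

interpretation MP: module_pair k A A by unfold_locales

lemma scalar_B: "c \<in> carrier k \<Longrightarrow> c \<odot> \<one> \<in> B"
  by (rule B_closed(7)[OF _ B_closed(1)])

lemma rt_scalar:
  assumes "c \<in> carrier k" "w \<in> K" "h \<in> H"
  shows "rt (c \<odot> w) h = rt w (c \<odot> h)"
proof -
  have "rt (w \<otimes> (c \<odot> \<one>)) h = rt w ((c \<odot> \<one>) \<otimes> h)"
    by (rule rt_balance[OF assms(2) scalar_B[OF assms(1)] assms(3)])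
  then show ?thesis using assms by (simp add: smult_mult_left smult_mult_right K_carrier H_carrier)
qed

interpretation L\<psi>: balanced_lift "carrier k" "\<lambda>x c. c \<odot> x" "\<lambda>c y. c \<odot> y" A A G "\<lambda>a b.
    rt (Pi' a) (\<pi> b)"
proof (intro balanced_lift.intro balanced_lift_axioms.intro MP.B.balanced_tensor_axioms
    G_comm_group)
  have PK: "Pi' x \<in> K" if "x \<in> carrier A" for x by (rule coR_K[OF Pi_in_coR[OF that]])
  show "balanced_map (carrier k) (\<lambda>x c. c \<odot> x) (\<lambda>c y. c \<odot> y) A A G (\<lambda>a b. rt (Pi' a) (\<pi> b))"
    unfolding balanced_map_def
    by (auto simp: PK pi_H rt_closed lin_add[OF lin_Pi] lin_add[OF lin_pi] lin_smult[OF lin_Pi]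
        lin_smult[OF lin_pi]
        rt_add_left rt_add_right rt_scalar)
qed

definition \<psi>\<^sub>0 :: "('a, 'a) tensor \<Rightarrow> ('a, 'a) tensor" where
  "\<psi>\<^sub>0 = tensor_lift G (\<lambda>a b. rt (Pi' a) (\<pi> b))"

lemma psi0_closed: "t \<in> carrier AA \<Longrightarrow> \<psi>\<^sub>0 t \<in> carrier G"
  and psi0_add: "\<lbrakk>s \<in> carrier AA; t \<in> carrier AA\<rbrakk> \<Longrightarrow> \<psi>\<^sub>0 (s \<oplus>\<^bsub>AA\<^esub> t) = \<psi>\<^sub>0 s \<otimes>\<^bsub>G\<^esub> \<psi>\<^sub>0 t"
  and psi0_tens: "\<lbrakk>x \<in> carrier A; y \<in> carrier A\<rbrakk> \<Longrightarrow> \<psi>\<^sub>0 (tens k A A x y) = rt (Pi' x) (\<pi> y)"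
  unfolding \<psi>\<^sub>0_def
  using hom_in_carrier[OF L\<psi>.tensor_lift_hom] hom_mult[OF L\<psi>.tensor_lift_hom] L\<psi>.tensor_lift_pure
  by (simp_all add: tensor_algebra_simps MP.grp MP.tens)

lemma psi_eq: "\<psi> x = \<psi>\<^sub>0 (comult A x)"
  by (simp add: \<psi>_def \<psi>\<^sub>0_def)

lemma psi_closed: "x \<in> carrier A \<Longrightarrow> \<psi> x \<in> carrier G"
  by (simp add: psi_eq psi0_closed)

lemma psi_add: "\<lbrakk>x \<in> carrier A; y \<in> carrier A\<rbrakk> \<Longrightarrow> \<psi> (x \<oplus> y) = \<psi> x \<otimes>\<^bsub>G\<^esub> \<psi> y"
  by (simp add: psi_eq psi0_add lin_add[OF lin_comult])

lemma phi_psi: "x \<in> carrier A \<Longrightarrow> \<phi> (\<psi> x) = x"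
proof -
  assume x: "x \<in> carrier A"
  have b: "bilin k A A A (\<lambda>a b. Pi' a \<otimes> \<pi> b)" by (auto intro!: lins')
  have "\<phi> (\<psi>\<^sub>0 t) = tsum A (\<lambda>a b. Pi' a \<otimes> \<pi> b) t" if "t \<in> carrier AA" for t
    using that
  proof (induction t rule: MP.tensor_induct)
    case (pure x y)
    then show ?case
      by (simp add: psi0_tens phi_rt coR_K Pi_in_coR pi_H tsum_tens[OF m1 m1 m1 b])
  next
    case (add s t)
    then show ?case
      by (simp add: psi0_add phi_add psi0_closed lin_add[OF tsum_lin[OF m1 m1 m1 b]])
  qed
  then show ?thesis using x by (simp add: psi_eq sw_Pi_pi)
qed

lemma psi0_tensor_map: "t \<in> carrier AA \<Longrightarrow> \<psi>\<^sub>0 (tensor_map k A A Pi' \<pi> t) = \<psi>\<^sub>0 t"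
proof (induction t rule: MP.tensor_induct)
  case (pure x y)
  then show ?case
    by (simp add: tensor_map_tens[OF m1 m1 m1 m1 lin_Pi lin_pi] psi0_tens Pi_coR Pi_in_coR pi_idem)
next
  case (add s t)
  then show ?case
    using lin_tensor_map[OF m1 m1 m1 m1 lin_Pi lin_pi] by (simp add: lin_add lin_closed psi0_add)
qed

lemma psi_coR_H:
  assumes "r \<in> coR" "h \<in> H" shows "\<psi> (r \<otimes> h) = rt r h"
proof -
  have "\<psi> (r \<otimes> h) = \<psi>\<^sub>0 (tensor_map k A A Pi' \<pi> (comult A (r \<otimes> h)))"
    using assms by (simp add: psi_eq psi0_tensor_map coR_carrier H_carrier)
  then show ?thesis
    using assms by (simp add: tensor_map_Pi_pi H_carrier pi_on_H psi0_tens coR_carrier Pi_coR)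
qed

lemma psi_mult:
  assumes w: "w \<in> K" and h: "h \<in> H" shows "\<psi> (w \<otimes> h) = rt w h"
proof -
  let ?W = "{w \<in> K. \<forall>h\<in>H. \<psi> (w \<otimes> h) = rt w h}"
  have "w \<in> ?W"
  proof (rule K_minimal[OF w])
    show "submodule ?W k A"
    proof (rule submoduleI'[OF m1])
      show "?W \<subseteq> carrier A" using K_carrier by blast
      have "\<psi> \<zero> = \<one>\<^bsub>G\<^esub>"
        using psi_add[of \<zero> \<zero>] psi_closed[of \<zero>] by (simp add: G.l_cancel_one')
      then show "\<zero> \<in> ?W" by (simp add: K_closed H_carrier rt_zero)
      show "x \<oplus> y \<in> ?W" if "x \<in> ?W" "y \<in> ?W" for x y
        using that by (simp add: K_closed K_carrier H_carrier l_distr psi_add rt_add_left)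
      show "c \<odot> x \<in> ?W" if c: "c \<in> carrier k" and "x \<in> ?W" for c x
      proof -
        have x: "x \<in> K" "\<And>h. h \<in> H \<Longrightarrow> \<psi> (x \<otimes> h) = rt x h" using that by auto
        have "\<psi> ((c \<odot> x) \<otimes> h) = rt (c \<odot> x) h" if h: "h \<in> H" for h
        proof -
          have "(c \<odot> x) \<otimes> h = x \<otimes> (c \<odot> h)"
            using c x h by (simp add: smult_mult_left smult_mult_right K_carrier H_carrier)
          then show ?thesis using x(2)[OF H_closed(7)[OF c h]] rt_scalar[OF c x(1) h] by simp
        qed
        then show ?thesis using c x(1) by (simp add: K_closed)
      qed
    qed
    fix r b assume rb: "r \<in> coR" "b \<in> B"
    have "\<psi> ((r \<otimes> b) \<otimes> h) = rt (r \<otimes> b) h" if h: "h \<in> H" for h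
    proof -
      have "\<psi> ((r \<otimes> b) \<otimes> h) = rt r (b \<otimes> h)"
        using rb h psi_coR_H[of r "b \<otimes> h"]
            by (simp add: m_assoc coR_carrier B_carrier H_carrier H_closed B_H)
      then show ?thesis using rt_balance[OF coR_K[OF rb(1)] rb(2) h] by simp
    qed
    then show "r \<otimes> b \<in> ?W" using K_gen[OF rb] by simp
  qed
  then show ?thesis using h by simp
qed

lemma psi_phi: "t \<in> carrier G \<Longrightarrow> \<psi> (\<phi> t) = t"
  unfolding G_eq
proof (induction t rule: BT.tensor_induct)
  case (pure w h)
  then show ?case using phi_rt psi_mult by (simp add: rt_eq)
next
  case (add s t)
  then show ?case by (simp add: phi_add[unfolded G_eq] psi_add[unfolded G_eq]
      phi_closed[unfolded G_eq])
qed

definition T0 :: "('k, ('a, 'a) tensor) module" where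
  "T0 = \<lparr>carrier = carrier G, monoid.mult = (\<lambda>s t. \<psi> (\<phi> s \<otimes> \<phi> t)), one = \<psi> \<one>,
     ring.zero = \<one>\<^bsub>G\<^esub>, add = monoid.mult G, smult = (\<lambda>c t. \<psi> (c \<odot> \<phi> t))\<rparr>"

definition T :: "('k, ('a, 'a) tensor) qt_hopf" where
  "T = \<lparr>carrier = carrier G, monoid.mult = (\<lambda>s t. \<psi> (\<phi> s \<otimes> \<phi> t)), one = \<psi> \<one>,
     ring.zero = \<one>\<^bsub>G\<^esub>, add = monoid.mult G, smult = (\<lambda>c t. \<psi> (c \<odot> \<phi> t)),
     comult = (\<lambda>t. tensor_map k T0 T0 \<psi> \<psi> (comult A (\<phi> t))), counit = (\<lambda>t. counit A (\<phi> t)),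
     antipode = (\<lambda>t. \<psi> (antipode A (\<phi> t))), rmat = tensor_map k T0 T0 \<psi> \<psi> (rmat A)\<rparr>"

lemma T_simps:
  "carrier T = carrier G" "add T = monoid.mult G" "\<zero>\<^bsub>T\<^esub> = \<one>\<^bsub>G\<^esub>"
  "s \<otimes>\<^bsub>T\<^esub> t = \<psi> (\<phi> s \<otimes> \<phi> t)" "\<one>\<^bsub>T\<^esub> = \<psi> \<one>" "c \<odot>\<^bsub>T\<^esub> t = \<psi> (c \<odot> \<phi> t)"
  "comult T t = tensor_map k T T \<psi> \<psi> (comult A (\<phi> t))" "counit T t = counit A (\<phi> t)"
  "antipode T t = \<psi> (antipode A (\<phi> t))" "rmat T = tensor_map k T T \<psi> \<psi> (rmat A)"
proof -
  have "tensor_map k T T f g = tensor_map k T0 T0 f g" for f g :: "'a \<Rightarrow> ('a, 'a) tensor"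
    by (rule tensor_map_cong_target) (simp_all add: T_def T0_def)
  then show "comult T t = tensor_map k T T \<psi> \<psi> (comult A (\<phi> t))" "rmat T
      = tensor_map k T T \<psi> \<psi> (rmat A)"
    by (simp_all add: T_def)
qed (simp_all add: T_def)

lemma phi_inj: "\<lbrakk>\<phi> s = \<phi> t; s \<in> carrier T; t \<in> carrier T\<rbrakk> \<Longrightarrow> s = t"
  using psi_phi by (metis T_simps(1))

lemma k_algebra_T: "k_algebra k T"
proof (rule k_algebra_pullback[OF ka1, where j = \<phi>])
  have "\<phi> \<one>\<^bsub>G\<^esub> \<oplus> \<phi> \<one>\<^bsub>G\<^esub> = \<phi> \<one>\<^bsub>G\<^esub>"
    using phi_add[of "\<one>\<^bsub>G\<^esub>" "\<one>\<^bsub>G\<^esub>"] by simp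
  then show "\<phi> \<zero>\<^bsub>T\<^esub> = \<zero>" using phi_closed[of "\<one>\<^bsub>G\<^esub>"] by (simp add: T_simps add.l_cancel_one')
  show "inj_on \<phi> (carrier T)" using phi_inj by (intro inj_onI)
qed (simp_all add: T_simps phi_closed psi_closed phi_psi phi_add)

lemmas mT = k_algebra_module[OF k_algebra_T]

lemma lin_phi: "lin k T A \<phi>"
  by (rule linI) (simp_all add: T_simps phi_closed phi_add phi_psi)

lemma lin_psi: "lin k A T \<psi>"
proof (rule linI)
  fix c x assume "c \<in> carrier k" "x \<in> carrier A"
  then show "\<psi> (c \<odot> x) = c \<odot>\<^bsub>T\<^esub> \<psi> x" by (simp add: T_simps phi_psi)
qed (simp_all add: T_simps psi_closed psi_add)

abbreviation "TT \<equiv> tensor_algebra k T T"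
abbreviation "\<Phi> \<equiv> tensor_map k A A \<phi> \<phi>"

lemma Phi_psi: "t \<in> carrier AA \<Longrightarrow> \<Phi> (tensor_map k T T \<psi> \<psi> t) = t"
  by (rule tensor_map_retract[OF m1 m1 mT mT lin_psi lin_psi lin_phi lin_phi phi_psi phi_psi])

lemma psi_Phi: "t \<in> carrier TT \<Longrightarrow> tensor_map k T T \<psi> \<psi> (\<Phi> t) = t"
  by (rule tensor_map_retract[OF mT mT m1 m1 lin_phi lin_phi lin_psi lin_psi])
      (simp_all add: T_simps psi_phi)

lemma Phi_inj: "\<lbrakk>\<Phi> s = \<Phi> t; s \<in> carrier TT; t \<in> carrier TT\<rbrakk> \<Longrightarrow> s = t"
  using psi_Phi by metis

lemma lin_Phi: "lin k TT AA \<Phi>"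
  by (rule lin_tensor_map[OF mT mT m1 m1 lin_phi lin_phi])

lemma psi_tensor_closed: "t \<in> carrier AA \<Longrightarrow> tensor_map k T T \<psi> \<psi> t \<in> carrier TT"
  by (rule lin_closed[OF lin_tensor_map[OF m1 m1 mT mT lin_psi lin_psi]])

lemma phi_carrier: "t \<in> carrier T \<Longrightarrow> \<phi> t \<in> carrier A"
  by (rule lin_closed[OF lin_phi])

lemma Phi_comult: "t \<in> carrier T \<Longrightarrow> \<Phi> (comult T t) = comult A (\<phi> t)"
  by (simp add: T_simps(7) Phi_psi phi_carrier)

lemma Phi_rmat: "\<Phi> (rmat T) = rmat A"
  by (simp add: T_simps(10) Phi_psi)

lemma qt_T: "qt_hopf_algebra k T"
proof -
  have "qt_embedding k A T \<phi> \<psi>"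
  proof (intro qt_embedding.intro qt_hopf_algebra_axioms qt_embedding_axioms.intro k_algebra_T
      lin_phi lin_psi)
  qed (simp_all add: Phi_comult Phi_rmat,
       simp_all add: T_simps psi_phi phi_psi phi_closed psi_closed psi_tensor_closed)
  then show ?thesis by (rule qt_embedding.qt_hopf_U)
qed

lemma phi_iso: "\<phi> \<in> qt_iso k T A"
proof -
  have "bij_betw \<phi> (carrier T) (carrier A)"
    by (rule bij_betw_byWitness[where f' = \<psi>])
        (auto simp: T_simps psi_phi phi_psi phi_closed psi_closed)
  then show ?thesis
    unfolding qt_iso_def qt_hom_def bialg_hom_def alg_hom_def ring_hom_def
    using lin_phi
    by (simp add: Phi_comult Phi_rmat lin_def)
       (simp add: T_simps phi_closed phi_psi)
qed

abbreviation "Ks \<equiv> sub_qt k A K"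
abbreviation "Hs \<equiv> sub_qt k A H"

lemmas mKs = module_sub_qt[OF m1 K_submodule]
lemmas mHs = module_sub_qt[OF m1 H_submodule]

lemma rt_carrier: "\<lbrakk>w \<in> K; h \<in> H\<rbrakk> \<Longrightarrow> rt w h \<in> carrier T"
  by (simp add: T_simps rt_closed)

lemma rt_psi: "\<lbrakk>w \<in> K; h \<in> H\<rbrakk> \<Longrightarrow> rt w h = \<psi> (w \<otimes> h)"
  by (simp add: psi_mult)

lemma bilin_rt: "bilin k Ks Hs T rt"
proof (intro bilinI linI)
  fix w h c assume "w \<in> carrier Ks" "h \<in> carrier Hs" "c \<in> carrier k"
  then show "rt w (c \<odot>\<^bsub>Hs\<^esub> h) = c \<odot>\<^bsub>T\<^esub> rt w h"
    by (simp add: T_simps phi_rt) (simp add: rt_psi H_closed smult_mult_right K_carrier H_carrier)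
next
  fix w h c assume "w \<in> carrier Hs" "h \<in> carrier Ks" "c \<in> carrier k"
  then show "rt (c \<odot>\<^bsub>Ks\<^esub> h) w = c \<odot>\<^bsub>T\<^esub> rt h w"
    by (simp add: T_simps phi_rt) (simp add: rt_psi K_closed smult_mult_left K_carrier H_carrier)
qed (simp_all add: T_simps rt_closed rt_add_left rt_add_right)

lemma lin_incl_Ks: "lin k Ks A (\<lambda>x. x)" and lin_incl_Hs: "lin k Hs A (\<lambda>x. x)"
  by (rule linI; simp add: K_carrier H_carrier)+

lemma lin_to_Ks: "\<lbrakk>lin k Y A f; \<And>x. x \<in> carrier Y \<Longrightarrow> f x \<in> K\<rbrakk> \<Longrightarrow> lin k Y Ks f"
  and lin_to_Hs: "\<lbrakk>lin k Y A f; \<And>x. x \<in> carrier Y \<Longrightarrow> f x \<in> H\<rbrakk> \<Longrightarrow> lin k Y Hs f"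
  by (auto simp: lin_def)

lemma comult_Ks: "w \<in> K \<Longrightarrow> comult Ks w \<in> carrier (tensor_algebra k Ks Ks)"
  and comult_Hs: "h \<in> H \<Longrightarrow> comult Hs h \<in> carrier (tensor_algebra k Hs Hs)"
  by (simp_all add: tensor_algebra_sub SK.restrict_closed SH.restrict_closed comult_K H_closed)

lemma natural_K:
  "\<lbrakk>module k M; module k N; lin k M N g; bilin k Ks Ks M F; bilin k A A N G'; w \<in> K;
    \<And>a b. \<lbrakk>a \<in> K; b \<in> K\<rbrakk> \<Longrightarrow> g (F a b) = G' a b\<rbrakk> \<Longrightarrow> g (tsum M F (comult Ks w))
        = tsum N G' (comult A w)"
  using sub_natural[OF qt_hopf_algebra_axioms hopf_K, of M N g F G' "comult A w"] comult_K by simp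

lemma natural_H:
  "\<lbrakk>module k M; module k N; lin k M N g; bilin k Hs Hs M F; bilin k A A N G'; h \<in> H;
    \<And>a b. \<lbrakk>a \<in> H; b \<in> H\<rbrakk> \<Longrightarrow> g (F a b) = G' a b\<rbrakk> \<Longrightarrow> g (tsum M F (comult Hs h))
        = tsum N G' (comult A h)"
  using sub_natural[OF qt_hopf_algebra_axioms hopf_H, of M N g F G' "comult A h"] H_closed(3)
      by simp

lemmas srules = lin_bilin_left[OF bilin_rt] lin_bilin_right[OF bilin_rt] lin_to_Ks lin_to_Hs
  lin_incl_Ks lin_incl_Hs lin_id lin_mult_left[OF ka1] lin_mult_right[OF ka1]
      lin_apply[OF lin_antipode]
  lin_apply[OF lin_pi] lin_apply[OF lin_Pi] lin_tens_left[OF mT mT] lin_tens_right[OF mT mT]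
  lin_tsum_param[OF mKs mKs] mKs mHs mT module_tensor[OF mT mT] tens_closed[OF mT mT] bilinI

lemmas srules' = lin_bilin_left[OF bilin_rt] lin_bilin_right[OF bilin_rt] lin_to_Ks lin_to_Hs
  lin_incl_Ks lin_incl_Hs lin_id lin_mult_left[OF ka1] lin_mult_right[OF ka1]
      lin_apply[OF lin_antipode]
  lin_apply[OF lin_pi] lin_apply[OF lin_Pi] lin_tens_left[OF mT mT] lin_tens_right[OF mT mT]
  lin_tsum_param[OF mHs mHs] mKs mHs mT module_tensor[OF mT mT] tens_closed[OF mT mT] bilinI

lemma Pi_K: "x \<in> carrier A \<Longrightarrow> Pi' x \<in> K"
  by (rule coR_K[OF Pi_in_coR])

lemmas ssimps = K_carrier H_carrier K_closed(1,2,4) H_closed(1,2,4) Pi_K pi_H rt_carrier comult_Ks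
    comult_Hs

lemma mult_T_eq:
  assumes w: "w \<in> K" and h: "h \<in> H" and w': "w' \<in> K" and h': "h' \<in> H"
  shows "rt w h \<otimes>\<^bsub>T\<^esub> rt w' h' = tsum T (\<lambda>h1 h2. tsum T (\<lambda>w1 w2.
      rt (w \<otimes> act_left A \<pi> h1 w1) (act_right A \<pi> h2 w2 \<otimes> h')) (comult Ks w')) (comult Hs h)"
proof -
  note c = w h w' h' K_carrier[OF w] H_carrier[OF h] K_carrier[OF w'] H_carrier[OF h']
  let ?F = "\<lambda>h1 h2 w1 w2. rt (w \<otimes> Pi' (h1 \<otimes> w1)) (h2 \<otimes> \<pi> w2 \<otimes> h')"
  have bi: "bilin k Ks Ks T (?F h1 h2)" if "h1 \<in> H" "h2 \<in> H" for h1 h2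
    using that c by (auto intro!: srules simp: ssimps simp del: sub_qt_simps(7))
  have bo: "bilin k Hs Hs T (\<lambda>h1 h2. tsum T (?F h1 h2) (comult Ks w'))"
    using c by (auto intro!: srules simp: ssimps simp del: sub_qt_simps(7))
  have inner: "tsum T (\<lambda>w1 w2. rt (w \<otimes> act_left A \<pi> h1 w1) (act_right A \<pi> h2 w2 \<otimes> h'))
      (comult Ks w')
      = tsum T (?F h1 h2) (comult Ks w')" if hh: "h1 \<in> H" "h2 \<in> H" for h1 h2
    by (rule tsum_cong[OF mKs mKs mT bi[OF hh] comult_Ks[OF w'], symmetric])
       (use hh in \<open>simp add: act_left_Pi act_right_def ssimps\<close>)
  have "tsum T (\<lambda>h1 h2. tsum T (\<lambda>w1 w2.
      rt (w \<otimes> act_left A \<pi> h1 w1) (act_right A \<pi> h2 w2 \<otimes> h')) (comult Ks w')) (comult Hs h)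
    = tsum T (\<lambda>h1 h2. tsum T (?F h1 h2) (comult Ks w')) (comult Hs h)" (is "?rhs = ?t")
    by (rule tsum_cong[OF mHs mHs mT bo comult_Hs[OF h], symmetric])
        (simp add: inner del: sub_qt_simps(7))
  moreover have "rt w h \<otimes>\<^bsub>T\<^esub> rt w' h' = ?t"
  proof (rule phi_inj)
    let ?G = "\<lambda>h1 h2 w1 w2. (w \<otimes> Pi' (h1 \<otimes> w1)) \<otimes> (\<pi> (h2 \<otimes> w2) \<otimes> h')"
    have bG: "bilin k A A A (\<lambda>h1 h2. tsum A (?G h1 h2) (comult A w'))"
      using c by (auto intro!: lins')
    have "\<phi> ?t = tsum A (\<lambda>h1 h2. tsum A (?G h1 h2) (comult A w')) (comult A h)"
    proof (rule natural_H[OF mT m1 lin_phi bo bG h])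
      fix h1 h2 assume hh: "h1 \<in> H" "h2 \<in> H"
      show "\<phi> (tsum T (?F h1 h2) (comult Ks w')) = tsum A (?G h1 h2) (comult A w')"
        by (rule natural_K[OF mT m1 lin_phi bi[OF hh] _ w'])
           (use hh c in \<open>auto intro!: lins' simp: ssimps phi_rt pi_mult pi_on_H\<close>)
    qed
    also have "\<dots> = tsum A (\<lambda>a b. (w \<otimes> Pi' a) \<otimes> (\<pi> b \<otimes> h')) (comult A (h \<otimes> w'))"
      by (rule sw_mult[OF m1 _ c(6,7), symmetric]) (use c in \<open>auto intro!: lins'\<close>)
    also have "\<dots> = tsum A (\<lambda>a b. w \<otimes> (Pi' a \<otimes> \<pi> b) \<otimes> h') (comult A (h \<otimes> w'))"
      by (rule sw_cong[OF m1]) (use c in \<open>auto intro!: lins' simp: m_assoc\<close>)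
    also have "\<dots> = w \<otimes> tsum A (\<lambda>a b. Pi' a \<otimes> \<pi> b) (comult A (h \<otimes> w')) \<otimes> h'"
      by (rule sw_apply[OF m1 m1, symmetric]) (use c in \<open>auto intro!: lins'\<close>)
    also have "\<dots> = \<phi> (rt w h \<otimes>\<^bsub>T\<^esub> rt w' h')"
      using c by (simp add: sw_Pi_pi T_simps phi_psi phi_rt m_assoc)
    finally show "\<phi> (rt w h \<otimes>\<^bsub>T\<^esub> rt w' h') = \<phi> ?t" by simp
    show "?t \<in> carrier T" by (rule tsum_closed[OF mHs mHs mT bo comult_Hs[OF h]])
    show "rt w h \<otimes>\<^bsub>T\<^esub> rt w' h' \<in> carrier T"
      using c by (simp add: T_simps psi_closed phi_rt)
  qed
  ultimately show ?thesis by simp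
qed

lemma comult_T_eq:
  assumes w: "w \<in> K" and h: "h \<in> H"
  shows "comult T (rt w h) = tsum TT (\<lambda>w1 w2. tsum TT (\<lambda>h1 h2. tens k T T (rt w1 h1) (rt w2 h2))
      (comult Hs h)) (comult Ks w)"
proof (rule Phi_inj)
  note c = w h K_carrier[OF w] H_carrier[OF h]
  let ?F = "\<lambda>w1 w2 h1 h2. tens k T T (rt w1 h1) (rt w2 h2)"
  have bi: "bilin k Hs Hs TT (?F w1 w2)" if "w1 \<in> K" "w2 \<in> K" for w1 w2
    using that c by (auto intro!: srules' simp: ssimps simp del: sub_qt_simps(7))
  have bo: "bilin k Ks Ks TT (\<lambda>w1 w2. tsum TT (?F w1 w2) (comult Hs h))"
    using c by (auto intro!: srules' simp: ssimps simp del: sub_qt_simps(7))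
  let ?G = "\<lambda>w1 w2 h1 h2. tens k A A (w1 \<otimes> h1) (w2 \<otimes> h2)"
  have bG: "bilin k A A AA (\<lambda>w1 w2. tsum AA (?G w1 w2) (comult A h))"
    using c by (auto intro!: lins')
  have "\<Phi> (tsum TT (\<lambda>w1 w2. tsum TT (?F w1 w2) (comult Hs h)) (comult Ks w))
    = tsum AA (\<lambda>w1 w2. tsum AA (?G w1 w2) (comult A h)) (comult A w)"
  proof (rule natural_K[OF module_tensor[OF mT mT] m2 lin_Phi bo bG w])
    fix w1 w2 assume ww: "w1 \<in> K" "w2 \<in> K"
    show "\<Phi> (tsum TT (?F w1 w2) (comult Hs h)) = tsum AA (?G w1 w2) (comult A h)"
      by (rule natural_H[OF module_tensor[OF mT mT] m2 lin_Phi bi[OF ww] _ h],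
          (use ww in \<open>auto intro!: lins' simp: ssimps\<close>)[1])
         (use ww in \<open>simp add: tensor_map_tens[OF mT mT m1 m1 lin_phi lin_phi] ssimps phi_rt\<close>)
  qed
  also have "\<dots> = tsum AA (tens k A A) (comult A (w \<otimes> h))"
    by (rule sw_mult[OF m2 bilin_tens[OF m1 m1] c(3,4), symmetric])
  also have "\<dots> = \<Phi> (comult T (rt w h))"
    using c by (simp add: tsum_tens_self[OF m1 m1] Phi_comult rt_carrier phi_rt)
  finally show "\<Phi> (comult T (rt w h)) = \<Phi>
      (tsum TT (\<lambda>w1 w2. tsum TT (?F w1 w2) (comult Hs h)) (comult Ks w))" by simp
  show "comult T (rt w h) \<in> carrier TT"
    using c by (simp add: T_simps psi_tensor_closed phi_rt)
  show "tsum TT (\<lambda>w1 w2. tsum TT (?F w1 w2) (comult Hs h)) (comult Ks w) \<in> carrier TT"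
    by (rule tsum_closed[OF mKs mKs module_tensor[OF mT mT] bo comult_Ks[OF w]])
qed

lemma antipode_T_eq:
  assumes w: "w \<in> K" and h: "h \<in> H"
  shows "antipode T (rt w h) = tsum T (\<lambda>w1 w2. tsum T (\<lambda>h1 h2.
      rt (act_left A \<pi> (antipode A h2) (antipode A w2))
          (act_right A \<pi> (antipode A h1) (antipode A w1)))
      (comult Hs h)) (comult Ks w)"
proof -
  let ?S = "antipode A"
  note c = w h K_carrier[OF w] H_carrier[OF h]
  let ?F = "\<lambda>w1 w2 h1 h2. rt (Pi' (?S h2 \<otimes> ?S w2)) (?S h1 \<otimes> \<pi> (?S w1))"
  have bi: "bilin k Hs Hs T (?F w1 w2)" if "w1 \<in> K" "w2 \<in> K" for w1 w2
    using that c by (auto intro!: srules' simp: ssimps simp del: sub_qt_simps(7))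
  have bo: "bilin k Ks Ks T (\<lambda>w1 w2. tsum T (?F w1 w2) (comult Hs h))"
    using c by (auto intro!: srules' simp: ssimps simp del: sub_qt_simps(7))
  have inner: "tsum T (\<lambda>h1 h2. rt (act_left A \<pi> (?S h2) (?S w2)) (act_right A \<pi> (?S h1) (?S w1)))
      (comult Hs h)
      = tsum T (?F w1 w2) (comult Hs h)" if ww: "w1 \<in> K" "w2 \<in> K" for w1 w2
    by (rule tsum_cong[OF mHs mHs mT bi[OF ww] comult_Hs[OF h], symmetric])
       (use ww in \<open>simp add: act_left_Pi act_right_def ssimps\<close>)
  have "tsum T (\<lambda>w1 w2. tsum T (\<lambda>h1 h2.
      rt (act_left A \<pi> (?S h2) (?S w2)) (act_right A \<pi> (?S h1) (?S w1))) (comult Hs h))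
          (comult Ks w)
    = tsum T (\<lambda>w1 w2. tsum T (?F w1 w2) (comult Hs h)) (comult Ks w)" (is "?rhs = ?t")
    by (rule tsum_cong[OF mKs mKs mT bo comult_Ks[OF w], symmetric])
        (simp add: inner del: sub_qt_simps(7))
  moreover have "antipode T (rt w h) = ?t"
  proof (rule phi_inj)
    let ?G = "\<lambda>w1 w2 h1 h2. Pi' (?S (w2 \<otimes> h2)) \<otimes> \<pi> (?S (w1 \<otimes> h1))"
    have bG: "bilin k A A A (\<lambda>w1 w2. tsum A (?G w1 w2) (comult A h))"
      using c by (auto intro!: lins')
    have "\<phi> ?t = tsum A (\<lambda>w1 w2. tsum A (?G w1 w2) (comult A h)) (comult A w)"
    proof (rule natural_K[OF mT m1 lin_phi bo bG w])
      fix w1 w2 assume ww: "w1 \<in> K" "w2 \<in> K"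
      show "\<phi> (tsum T (?F w1 w2) (comult Hs h)) = tsum A (?G w1 w2) (comult A h)"
        by (rule natural_H[OF mT m1 lin_phi bi[OF ww] _ h])
           (use ww c in \<open>auto intro!: lins' simp: ssimps phi_rt pi_mult pi_on_H antipode_mult\<close>)
    qed
    also have "\<dots> = tsum A (\<lambda>a b. Pi' (?S b) \<otimes> \<pi> (?S a)) (comult A (w \<otimes> h))"
      by (rule sw_mult[OF m1 _ c(3,4), symmetric]) (auto intro!: lins')
    also have "\<dots> = tsum A (\<lambda>a b. Pi' a \<otimes> \<pi> b) (comult A (?S (w \<otimes> h)))"
      by (rule sw_antipode[OF m1, symmetric]) (use c in \<open>auto intro!: lins'\<close>)
    also have "\<dots> = \<phi> (antipode T (rt w h))"
      using c by (simp add: sw_Pi_pi T_simps phi_psi phi_rt)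
    finally show "\<phi> (antipode T (rt w h)) = \<phi> ?t" by simp
    show "?t \<in> carrier T" by (rule tsum_closed[OF mKs mKs mT bo comult_Ks[OF w]])
    show "antipode T (rt w h) \<in> carrier T"
      using c by (simp add: T_simps psi_closed phi_rt)
  qed
  ultimately show ?thesis by simp
qed

lemma rmat_T_eq:
  assumes R: "rmat A \<in> sub_tensors k A H"
  shows "rmat T = tsum TT (\<lambda>x y. tens k T T (rt \<one> x) (rt \<one> y)) (rmat Hs)"
proof (rule Phi_inj)
  have b: "bilin k Hs Hs TT (\<lambda>x y. tens k T T (rt \<one> x) (rt \<one> y))"
    by (auto intro!: srules' simp: ssimps)
  have "\<Phi> (tsum TT (\<lambda>x y. tens k T T (rt \<one> x) (rt \<one> y)) (restrict_tensor k A H (rmat A)))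
      = tsum AA (tens k A A) (rmat A)"
    by (rule sub_natural[OF qt_hopf_algebra_axioms hopf_H module_tensor[OF mT mT] m2 lin_Phi b
        bilin_tens[OF m1 m1] R])
       (simp add: tensor_map_tens[OF mT mT m1 m1 lin_phi lin_phi] ssimps phi_rt)
  then show "\<Phi> (rmat T) = \<Phi> (tsum TT (\<lambda>x y. tens k T T (rt \<one> x) (rt \<one> y)) (rmat Hs))"
    by (simp add: Phi_rmat tsum_tens_self[OF m1 m1])
  show "rmat T \<in> carrier TT" by (simp add: T_simps psi_tensor_closed)
  show "tsum TT (\<lambda>x y. tens k T T (rt \<one> x) (rt \<one> y)) (rmat Hs) \<in> carrier TT"
    by (rule tsum_closed[OF mHs mHs module_tensor[OF mT mT] b])
       (simp add: tensor_algebra_sub SH.restrict_closed R)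
qed

end

lemma hopf_proj_subI:
  assumes A: "qt_hopf_algebra k A" and H: "qt_hopf_subalgebra k A H" and p:
      "hopf_projection k A H \<pi>"
    and B: "B = minimal_qt k (sub_qt k A H)"
  shows "hopf_proj_sub k A \<pi> B H"
proof -
  interpret A: qt_hopf_algebra k A by fact
  have H': "hopf_subalgebra k A H" "rmat A \<in> sub_tensors k A H" "qt_hopf_algebra k (sub_qt k A H)"
    using H unfolding qt_hopf_subalgebra_def by auto
  note DH = hopf_subalgebraD[OF H'(1)]
  interpret S: subspace k A H by (rule A.subspaceI[OF DH(1)])
  interpret HH: qt_hopf_algebra k "sub_qt k A H" by (rule H'(3))
  note tr = A.hopf_subalgebra_trans[OF H'(1,2) HH.minimal_qt_subalgebra]
  let ?H = "sub_hopf k A H"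
  have mH: "module k ?H" by (rule module_sub_hopf[OF A.m1 DH(1)])
  have pH: "\<pi> x \<in> H" if "x \<in> carrier A" for x
    using p that unfolding hopf_projection_def hopf_hom_def bialg_hom_def alg_hom_def ring_hom_def
        by auto
  have ph: "\<pi> h = h" if "h \<in> H" for h using p that unfolding hopf_projection_def by blast
  have lin: "lin k A A \<pi>"
    using p submodule_subset[OF DH(1)]
    unfolding hopf_projection_def hopf_hom_def bialg_hom_def alg_hom_def ring_hom_def
        by (auto simp: lin_def)
  have linH: "lin k A ?H \<pi>" using lin pH by (auto simp: lin_def)
  have inclH: "lin k ?H A (\<lambda>x. x)" by (rule linI) (auto intro: submodule_subset[OF DH(1)])
  have com: "comult A (\<pi> x) = tensor_map k A A \<pi> \<pi> (comult A x)" if x: "x \<in> carrier A" for x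
  proof -
    have "restrict_tensor k A H (comult A (\<pi> x)) = tensor_map k ?H ?H \<pi> \<pi> (comult A x)"
      using p x unfolding hopf_projection_def hopf_hom_def bialg_hom_def by simp
    then have "tensor_incl k A (restrict_tensor k A H (comult A (\<pi> x)))
        = tensor_map k A A (\<lambda>x. x) (\<lambda>x. x) (tensor_map k ?H ?H \<pi> \<pi> (comult A x))"
      by (simp add: tensor_incl_def)
    also have "\<dots> = tensor_map k A A \<pi> \<pi> (comult A x)"
      by (rule tensor_map_comp[OF A.m1 A.m1 mH mH A.m1 A.m1 linH linH inclH inclH
          A.comult_closed[OF x]])
    finally show ?thesis using S.incl_restrict[OF DH(4)[OF pH[OF x]]] by simp
  qed
  show ?thesis
    unfolding B
  proof (intro hopf_proj_sub.intro hopf_proj.intro hopf_proj_axioms.intro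
      hopf_proj_sub_axioms.intro A tr lin com pH H'(1))
    fix x y assume xy: "x \<in> carrier A" "y \<in> carrier A"
    show "\<pi> (x \<otimes>\<^bsub>A\<^esub> y) = \<pi> x \<otimes>\<^bsub>A\<^esub> \<pi> y"
      using p xy unfolding hopf_projection_def hopf_hom_def bialg_hom_def alg_hom_def ring_hom_def
          by auto
  next
    show "\<pi> \<one>\<^bsub>A\<^esub> = \<one>\<^bsub>A\<^esub>" by (rule ph[OF DH(2)])
  next
    fix x assume x: "x \<in> carrier A"
    show "counit A (\<pi> x) = counit A x" "\<pi> (antipode A x) = antipode A (\<pi> x)"
      using p x unfolding hopf_projection_def hopf_hom_def bialg_hom_def by auto
  qed (use tr(2) ph pH in auto)
qed

context hopf_proj_sub
begin

lemma coinvariants_eq: "coinvariants k A H \<pi> = coR"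
proof -
  let ?H = "sub_hopf k A H"
  have mH: "module k ?H" by (rule module_sub_hopf[OF m1 H_submodule])
  have linH: "lin k A ?H \<pi>" using lin_pi pi_H by (auto simp: lin_def)
  have inclH: "lin k ?H A (\<lambda>x. x)" by (rule linI) (auto simp: H_carrier)
  have "tensor_map k A ?H (\<lambda>x. x) \<pi> (comult A r) = tens k A ?H r \<one> \<longleftrightarrow>
      tensor_map k A A (\<lambda>x. x) \<pi> (comult A r) = tens k A A r \<one>" if r: "r \<in> carrier A" for r
  proof
    assume "tensor_map k A ?H (\<lambda>x. x) \<pi> (comult A r) = tens k A ?H r \<one>"
    then have "tensor_map k A A (\<lambda>x. x) (\<lambda>x. x) (tensor_map k A ?H (\<lambda>x. x) \<pi> (comult A r))
       = tensor_map k A A (\<lambda>x. x) (\<lambda>x. x) (tens k A ?H r \<one>)" by simp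
    then show "tensor_map k A A (\<lambda>x. x) \<pi> (comult A r) = tens k A A r \<one>"
      using r H_closed(1) by (simp add: tensor_map_comp[OF m1 m1 m1 mH m1 m1 lin_id linH lin_id
          inclH]
          tensor_map_tens[OF m1 mH m1 m1 lin_id inclH])
  next
    assume "tensor_map k A A (\<lambda>x. x) \<pi> (comult A r) = tens k A A r \<one>"
    then have "tensor_map k A ?H (\<lambda>x. x) \<pi> (tensor_map k A A (\<lambda>x. x) \<pi> (comult A r))
       = tensor_map k A ?H (\<lambda>x. x) \<pi> (tens k A A r \<one>)" by simp
    moreover have "tensor_map k A ?H (\<lambda>x. x) (\<lambda>y. \<pi> (\<pi> y)) (comult A r)
        = tensor_map k A ?H (\<lambda>x. x) \<pi> (comult A r)"
      by (rule tensor_map_cong[OF m1 m1 m1 mH lin_id lin_comp[OF lin_pi linH]])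
          (simp_all add: pi_idem r)
    ultimately show "tensor_map k A ?H (\<lambda>x. x) \<pi> (comult A r) = tens k A ?H r \<one>"
      using r by (simp add: tensor_map_comp[OF m1 m1 m1 m1 m1 mH lin_id lin_pi lin_id linH]
          tensor_map_tens[OF m1 m1 m1 mH lin_id linH] pi_one)
  qed
  then show ?thesis unfolding coinvariants_def coR_def by blast
qed

end

theorem theorem4p22:
  fixes k :: "('k, 'l) ring_scheme"
    and A :: "('k, 'a) qt_hopf"
    and H :: "'a set" and \<pi> :: "'a \<Rightarrow> 'a"
  assumes "field k"
    and "qt_hopf_algebra k A"
    and "qt_hopf_subalgebra k A H"
    and "hopf_projection k A H \<pi>"
    and "B = minimal_qt k (sub_qt k A H)"
    and "R = coinvariants k A H \<pi>"
    and "K = product_span k A R B"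
  shows "qt_hopf_subalgebra k A K \<and>
    (\<exists>T :: ('k, ('a, 'a) tensor) qt_hopf. \<exists>\<phi>.
      carrier T = carrier (rel_tens_grp A B K H) \<and>
      add T = monoid.mult (rel_tens_grp A B K H) \<and>
      \<zero>\<^bsub>T\<^esub> = \<one>\<^bsub>rel_tens_grp A B K H\<^esub> \<and>
      (\<forall>c\<in>carrier k. \<forall>w\<in>K. \<forall>h\<in>H.
         c \<odot>\<^bsub>T\<^esub> rel_tens A B K H w h = rel_tens A B K H (c \<odot>\<^bsub>A\<^esub> w) h) \<and>
      (\<forall>h\<in>H. \<forall>w\<in>K. act_left A \<pi> h w \<in> R \<and> act_right A \<pi> h w \<in> H) \<and>
      (\<forall>w\<in>K. \<forall>h\<in>H. \<forall>w'\<in>K. \<forall>h'\<in>H.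
         rel_tens A B K H w h \<otimes>\<^bsub>T\<^esub> rel_tens A B K H w' h' =
           tensor_lift (add_monoid T) (\<lambda>h1 h2.
             tensor_lift (add_monoid T) (\<lambda>w1' w2'.
               rel_tens A B K H (w \<otimes>\<^bsub>A\<^esub> act_left A \<pi> h1 w1') (act_right A \<pi> h2 w2' \<otimes>\<^bsub>A\<^esub> h'))
               (comult (sub_qt k A K) w'))
             (comult (sub_qt k A H) h)) \<and>
      \<one>\<^bsub>T\<^esub> = rel_tens A B K H \<one>\<^bsub>A\<^esub> \<one>\<^bsub>A\<^esub> \<and>
      (\<forall>w\<in>K. \<forall>h\<in>H.
         comult T (rel_tens A B K H w h) =
           tensor_lift (tens_grp k T T) (\<lambda>w1 w2.
             tensor_lift (tens_grp k T T) (\<lambda>h1 h2.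
               tens k T T (rel_tens A B K H w1 h1) (rel_tens A B K H w2 h2))
               (comult (sub_qt k A H) h))
             (comult (sub_qt k A K) w)) \<and>
      (\<forall>w\<in>K. \<forall>h\<in>H.
         counit T (rel_tens A B K H w h) =
           counit (sub_qt k A K) w \<otimes>\<^bsub>k\<^esub> counit (sub_qt k A H) h) \<and>
      (\<forall>w\<in>K. \<forall>h\<in>H.
         antipode T (rel_tens A B K H w h) =
           tensor_lift (add_monoid T) (\<lambda>w1 w2.
             tensor_lift (add_monoid T) (\<lambda>h1 h2.
               rel_tens A B K H
                 (act_left A \<pi> (antipode (sub_qt k A H) h2) (antipode (sub_qt k A K) w2))
                 (act_right A \<pi> (antipode (sub_qt k A H) h1) (antipode (sub_qt k A K) w1)))
               (comult (sub_qt k A H) h))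
             (comult (sub_qt k A K) w)) \<and>
      rmat T =
        tensor_lift (tens_grp k T T) (\<lambda>x y.
          tens k T T (rel_tens A B K H \<one>\<^bsub>A\<^esub> x) (rel_tens A B K H \<one>\<^bsub>A\<^esub> y))
          (rmat (sub_qt k A H)) \<and>
      qt_hopf_algebra k T \<and>
      \<phi> \<in> qt_iso k T A \<and>
      (\<forall>w\<in>K. \<forall>h\<in>H. \<phi> (rel_tens A B K H w h) = w \<otimes>\<^bsub>A\<^esub> h))"
proof -
  interpret P: hopf_proj_sub k A \<pi> B H
    by (rule hopf_proj_subI[OF assms(2-5)])
  have R: "R = P.coR" using assms(6) P.coinvariants_eq by simp
  have K: "K = P.K" using assms(7) R by (simp add: P.K_def)
  show ?thesis
    unfolding R K
  proof (intro conjI exI[of _ P.T] exI[of _ P.\<phi>] ballI)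
    show "qt_hopf_subalgebra k A P.K" by (rule P.qt_K)
    show "carrier P.T = carrier P.G" "add P.T = monoid.mult P.G" "\<zero>\<^bsub>P.T\<^esub> = \<one>\<^bsub>P.G\<^esub>"
      by (rule P.T_simps)+
    show "\<one>\<^bsub>P.T\<^esub> = P.rt \<one>\<^bsub>A\<^esub> \<one>\<^bsub>A\<^esub>"
      by (simp add: P.T_simps P.rt_psi P.K_closed P.H_closed)
    show "qt_hopf_algebra k P.T" by (rule P.qt_T)
    show "P.\<phi> \<in> qt_iso k P.T A" by (rule P.phi_iso)
    show "rmat P.T = tensor_lift (tens_grp k P.T P.T) (\<lambda>x y.
        tens k P.T P.T (P.rt \<one>\<^bsub>A\<^esub> x) (P.rt \<one>\<^bsub>A\<^esub> y)) (rmat (sub_qt k A H))"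
      unfolding tensor_lift_tens_grp
      by (rule P.rmat_T_eq) (use assms(3) in \<open>simp add: qt_hopf_subalgebra_def\<close>)
  next
    fix c w h assume "c \<in> carrier k" "w \<in> P.K" "h \<in> H"
    then show "c \<odot>\<^bsub>P.T\<^esub> P.rt w h = P.rt (c \<odot>\<^bsub>A\<^esub> w) h"
      using lin_smult[OF bilinD2[OF P.bilin_rt]] by simp
  next
    fix w h assume wh: "w \<in> P.K" "h \<in> H"
    then have c: "w \<in> carrier A" "h \<in> carrier A" by (simp_all add: P.K_carrier P.H_carrier)
    show "act_left A \<pi> h w \<in> P.coR"
      using c by (simp add: P.act_left_Pi P.Pi_in_coR)
    show "act_right A \<pi> h w \<in> H"
      using wh c by (simp add: act_right_def P.H_closed P.pi_H)
    show "P.\<phi> (P.rt w h) = w \<otimes>\<^bsub>A\<^esub> h" using wh by (rule P.phi_rt)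
    show "counit P.T (P.rt w h) = counit (sub_qt k A P.K) w \<otimes>\<^bsub>k\<^esub> counit (sub_qt k A H) h"
      using wh c by (simp add: P.T_simps P.phi_rt P.counit_mult)
    show "comult P.T (P.rt w h) =
           tensor_lift (tens_grp k P.T P.T) (\<lambda>w1 w2.
             tensor_lift (tens_grp k P.T P.T) (\<lambda>h1 h2.
               tens k P.T P.T (P.rt w1 h1) (P.rt w2 h2)) (comult (sub_qt k A H) h))
             (comult (sub_qt k A P.K) w)"
      unfolding tensor_lift_tens_grp by (rule P.comult_T_eq[OF wh])
    show "antipode P.T (P.rt w h) =
           tensor_lift (add_monoid P.T) (\<lambda>w1 w2.
             tensor_lift (add_monoid P.T) (\<lambda>h1 h2.
               P.rt
                 (act_left A \<pi> (antipode (sub_qt k A H) h2) (antipode (sub_qt k A P.K) w2))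
                 (act_right A \<pi> (antipode (sub_qt k A H) h1) (antipode (sub_qt k A P.K) w1)))
               (comult (sub_qt k A H) h))
             (comult (sub_qt k A P.K) w)"
      unfolding tsum_def[symmetric] sub_qt_simps(9) by (rule P.antipode_T_eq[OF wh])
  next
    fix w h w' h' assume "w \<in> P.K" "h \<in> H" "w' \<in> P.K" "h' \<in> H"
    then show "P.rt w h \<otimes>\<^bsub>P.T\<^esub> P.rt w' h' =
           tensor_lift (add_monoid P.T) (\<lambda>h1 h2.
             tensor_lift (add_monoid P.T) (\<lambda>w1' w2'.
               P.rt (w \<otimes>\<^bsub>A\<^esub> act_left A \<pi> h1 w1') (act_right A \<pi> h2 w2' \<otimes>\<^bsub>A\<^esub> h'))
               (comult (sub_qt k A P.K) w')) (comult (sub_qt k A H) h)"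
      unfolding tsum_def[symmetric] by (rule P.mult_T_eq)
  qed
qed

end
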